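(* The following statements hold. (a) The group $G$ is isomorphic to the group $H$ via a group isomorphism $\varrho: G\to H$ with $\varrho(a)=A$, $\varrho(b)=B$, $\varrho(c)=C$, $\varrho(d)=D$. In particular, there is a well-defined action $\alpha$ of $G$ on $\Omega_\tau$ given by $\alpha_g(\omega):=\varrho(g)(\omega)$ for $g\in G$, $\omega\in\Omega_\tau$, and via this action we obtain a dynamical system $(\Omega_\tau,G)$. (b) The dynamical system $(X,G)$ is a factor of the dynamical system $(\Omega_\tau,G)$ via the map $\psi:\Omega_\tau\to X$, $\omega\mapsto \mathrm{Gr}(\omega)$ (that is, $\psi$ maps $\Omega_\tau$ into $X$, is continuous and surjective, and intertwines the actions of $G$: $\psi(\alpha_g(\omega))=g\,\psi(\omega)$ for all $g\in G$, $\omega\in\Omega_\tau$), and $\psi$ is two-to-one. (c) For every $\omega\in\Omega_\tau$ the orbits $\{T^n\omega : n\in\mathbb Z\}$ and $\{\alpha_g(\omega): g\in G\}$ coincide. (d) The dynamical system $(\Omega_\tau,G)$ is uniquely ergodic, and the unique $T$-invariant probability measure on $\Omega_\tau$ coincides with the unique $G$-invariant probability measure on $\Omega_\tau$.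
   Context: **The subshift.** Let $\mathcal A=\{a,x,y,z\}$ and let $\tau$ be the substitution $a\mapsto axa$, $x\mapsto y$, $y\mapsto z$, $z\mapsto x$, extended to words by concatenation. $\mathrm{Sub}_\tau$ is the set of all finite subwords (blocks of consecutive letters, including the empty word) of the words $\tau^n(s)$, $s\in\mathcal A$, $n\ge 0$. Let $\Omega_\tau=\{\omega\in\mathcal A^{\mathbb Z}: \text{every finite subword of }\omega\text{ belongs to }\mathrm{Sub}_\tau\}$, with the product topology of the discrete topologies, and $T$ the shift $(T\omega)(n)=\omega(n+1)$. In every $\omega\in\Omega_\tau$ every other letter is $a$. The subshift $(\Omega_\tau,T)$ is minimal and uniquely ergodic. **The group.** $G$ is Grigorchuk's group: the group of automorphisms of the rooted binary tree $\mathcal T$ (vertex set $\{0,1\}^*$) generated by the involutions $a,b,c,d$ given by $a(0w)=1w$, $a(1w)=0w$; $b(0w)=0a(w)$, $b(1w)=1c(w)$; $c(0w)=0a(w)$, $c(1w)=1d(w)$; $d(0w)=0w$, $d(1w)=1b(w)$. It acts by homeomorphisms on the boundary $\partial\mathcal T=\{0,1\}^{\mathbb N}$. **Schreier graphs and $X$.** For $\xi\in\partial\mathcal T$ the graph $\Gamma_\xi$ has vertex set $G\xi$ and, for each $s\in\{a,b,c,d\}$, an undirected edge labeled $s$ between $p$ and $q$ iff $sp=q$ (loops and multiple edges allowed; each vertex is incident to exactly one edge of each label). $\mathcal G_*$ is the space of isomorphism classes $[(\Gamma,v)]$ of rooted connected graphs with edges labeled in $\{a,b,c,d\}$, with the topology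 of local convergence (two classes are close if large balls around the roots are isomorphic as rooted labeled graphs). Put $\mathcal F(\xi)=[(\Gamma_\xi,\xi)]$ and $X:=\overline{\mathcal F(\partial\mathcal T)}\setminus\{\text{isolated points of }\overline{\mathcal F(\partial\mathcal T)}\}$. $G$ acts on $X$ by changing the root: a generator $s$ sends $[(\Gamma,v)]$ to $[(\Gamma,v')]$, where $v'$ is the other endpoint of the unique edge labeled $s$ at $v$ ($v'=v$ if it is a loop). **The group $H$.** Define homeomorphisms $A,B,C,D$ of $\Omega_\tau$: $A\omega=T\omega$ if $\omega_1=a$, and $A\omega=T^{-1}\omega$ if $\omega_0=a$. $B\omega=T\omega$ if $\omega_1\in\{x,y\}$, $B\omega=T^{-1}\omega$ if $\omega_0\in\{x,y\}$, $B\omega=\omega$ otherwise. $C$ is defined like $B$ with $\{x,z\}$ in place of $\{x,y\}$, and $D$ like $B$ with $\{y,z\}$ in place of $\{x,y\}$. All are involutions. $H$ is the group generated by $A,B,C,D$ in the group of homeomorphisms of $\Omega_\tau$. **The map $\mathrm{Gr}$.** For $\omega\in\Omega_\tau$ let $\mathrm{gr}(\omega)$ be the rooted labeled graph with vertex set $\mathbb Z$, root $1$, and for each $n\in\mathbb Z$: if $\omega(n)=a$, an edge labeled $a$ between $n$ and $n+1$; if $\omega(n)=x$ (resp. $y$, $z$), two edges between $n$ and $n+1$ labeled $b,c$ (resp. $b,d$; $c,d$), and one loop labeled $d$ (resp. $c$; $b$) at each of $n$ and $n+1$. $\mathrm{Gr}(\omega)\in\mathcal G_*$ is the isomorphism class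 of $\mathrm{gr}(\omega)$. *)

theory Defs
  imports
    "HOL-Probability.Probability_Measure"
    "HOL-Algebra.Elementary_Groups"
    "HOL-Algebra.Group_Action"
    "HOL-Library.Sublist"
begin

section \<open>Groups of homeomorphisms and dynamical systems\<close>

definition homeo_group :: "'x topology \<Rightarrow> ('x \<Rightarrow> 'x) monoid" where
  "homeo_group \<X> = (BijGroup (topspace \<X>))
     \<lparr>carrier := {f \<in> Bij (topspace \<X>). homeomorphic_map \<X> \<X> f}\<rparr>"

text \<open>A dynamical system is a compact Hausdorff space on which a group acts by homeomorphisms.\<close>

definition dyn_system :: "('g, 'm) monoid_scheme \<Rightarrow> 'x topology \<Rightarrow> ('g \<Rightarrow> 'x \<Rightarrow> 'x) \<Rightarrow> bool" where
  "dyn_system G \<X> \<alpha> \<longleftrightarrow>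
     compact_space \<X> \<and> Hausdorff_space \<X> \<and>
     group_action G (topspace \<X>) \<alpha> \<and>
     (\<forall>g\<in>carrier G. homeomorphic_map \<X> \<X> (\<alpha> g))"

definition factor_map :: "('g, 'm) monoid_scheme \<Rightarrow>
    'x topology \<Rightarrow> ('g \<Rightarrow> 'x \<Rightarrow> 'x) \<Rightarrow> 'y topology \<Rightarrow> ('g \<Rightarrow> 'y \<Rightarrow> 'y) \<Rightarrow> ('x \<Rightarrow> 'y) \<Rightarrow> bool" where
  "factor_map G \<X> \<alpha> \<Y> \<beta> \<psi> \<longleftrightarrow>
     continuous_map \<X> \<Y> \<psi> \<and> \<psi> ` topspace \<X> = topspace \<Y> \<and>
     (\<forall>g\<in>carrier G. \<forall>x\<in>topspace \<X>. \<psi> (\<alpha> g x) = \<beta> g (\<psi> x))"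

definition invariant_prob :: "'x topology \<Rightarrow> ('x \<Rightarrow> 'x) set \<Rightarrow> 'x measure \<Rightarrow> bool" where
  "invariant_prob \<X> F \<mu> \<longleftrightarrow>
     sets \<mu> = sigma_sets (topspace \<X>) {U. openin \<X> U} \<and> prob_space \<mu> \<and>
     (\<forall>f\<in>F. \<forall>S\<in>sets \<mu>. emeasure \<mu> (f -` S \<inter> space \<mu>) = emeasure \<mu> S)"

definition uniquely_ergodic :: "'x topology \<Rightarrow> ('x \<Rightarrow> 'x) set \<Rightarrow> bool" where
  "uniquely_ergodic \<X> F \<longleftrightarrow> (\<exists>!\<mu>. invariant_prob \<X> F \<mu>)"


section \<open>The subshift\<close>

datatype letter = La | Lx | Ly | Lz

fun subst_letter :: "letter \<Rightarrow> letter list" where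
  "subst_letter La = [La, Lx, La]"
| "subst_letter Lx = [Ly]"
| "subst_letter Ly = [Lz]"
| "subst_letter Lz = [Lx]"

definition subst :: "letter list \<Rightarrow> letter list" where
  "subst w = concat (map subst_letter w)"

definition Sub_tau :: "letter list set" where
  "Sub_tau = {w. \<exists>n s. sublist w ((subst ^^ n) [s])}"

definition Omega_tau :: "(int \<Rightarrow> letter) set" where
  "Omega_tau = {\<omega>. \<forall>m k. map (\<lambda>i. \<omega> (m + int i)) [0..<k] \<in> Sub_tau}"

definition Omega_top :: "(int \<Rightarrow> letter) topology" where
  "Omega_top = subtopology (product_topology (\<lambda>_. discrete_topology UNIV) UNIV) Omega_tau"

definition shift :: "(int \<Rightarrow> letter) \<Rightarrow> int \<Rightarrow> letter" where
  "shift \<omega> = (\<lambda>n. \<omega> (n + 1))"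

definition shift_inv :: "(int \<Rightarrow> letter) \<Rightarrow> int \<Rightarrow> letter" where
  "shift_inv \<omega> = (\<lambda>n. \<omega> (n - 1))"

text \<open>As elements of a \<^const>\<open>BijGroup\<close>, maps of the subshift are extensional.\<close>

definition shift_Omega :: "(int \<Rightarrow> letter) \<Rightarrow> int \<Rightarrow> letter" where
  "shift_Omega = restrict shift Omega_tau"

definition flip_along :: "letter set \<Rightarrow> (int \<Rightarrow> letter) \<Rightarrow> int \<Rightarrow> letter" where
  "flip_along S = (\<lambda>\<omega>\<in>Omega_tau.
     if \<omega> 1 \<in> S then shift \<omega> else if \<omega> 0 \<in> S then shift_inv \<omega> else \<omega>)"

datatype gen = Ga | Gb | Gc | Gd

fun edge_letters :: "gen \<Rightarrow> letter set" where
  "edge_letters Ga = {La}"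
| "edge_letters Gb = {Lx, Ly}"
| "edge_letters Gc = {Lx, Lz}"
| "edge_letters Gd = {Ly, Lz}"

text \<open>The homeomorphisms \<open>A\<close>, \<open>B\<close>, \<open>C\<close>, \<open>D\<close> are \<open>H_gen Ga\<close>, \<open>H_gen Gb\<close>, \<open>H_gen Gc\<close>, \<open>H_gen Gd\<close>.
  Every other letter of a point of \<^const>\<open>Omega_tau\<close> is \<^const>\<open>La\<close>, so the first two
  branches in \<^const>\<open>flip_along\<close> exclude each other, and for \<open>H_gen Ga\<close> the third never occurs.\<close>

definition H_gen :: "gen \<Rightarrow> (int \<Rightarrow> letter) \<Rightarrow> int \<Rightarrow> letter" where
  "H_gen s = flip_along (edge_letters s)"

definition H_group :: "((int \<Rightarrow> letter) \<Rightarrow> int \<Rightarrow> letter) monoid" where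
  "H_group = subgroup_generated (homeo_group Omega_top) (range H_gen)"


section \<open>Grigorchuk's group\<close>

text \<open>Vertices of the rooted binary tree are lists of booleans, with \<^const>\<open>False\<close> for 0
  and \<^const>\<open>True\<close> for 1.\<close>

definition tree_adj :: "bool list \<Rightarrow> bool list \<Rightarrow> bool" where
  "tree_adj u v \<longleftrightarrow> (\<exists>i. v = u @ [i] \<or> u = v @ [i])"

definition tree_aut :: "(bool list \<Rightarrow> bool list) monoid" where
  "tree_aut = (BijGroup UNIV)
     \<lparr>carrier := {f \<in> Bij UNIV. f [] = [] \<and> (\<forall>u v. tree_adj (f u) (f v) \<longleftrightarrow> tree_adj u v)}\<rparr>"

fun G_gen :: "gen \<Rightarrow> bool list \<Rightarrow> bool list" where
  "G_gen s [] = []"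
| "G_gen Ga (i # w) = (\<not> i) # w"
| "G_gen Gb (False # w) = False # G_gen Ga w"
| "G_gen Gb (True # w) = True # G_gen Gc w"
| "G_gen Gc (False # w) = False # G_gen Ga w"
| "G_gen Gc (True # w) = True # G_gen Gd w"
| "G_gen Gd (False # w) = False # w"
| "G_gen Gd (True # w) = True # G_gen Gb w"

definition G_group :: "(bool list \<Rightarrow> bool list) monoid" where
  "G_group = subgroup_generated tree_aut (range G_gen)"

text \<open>The image of a boundary point \<open>\<xi>\<close> is the ray passing through the images of the
  finite prefixes of \<open>\<xi>\<close>.\<close>

definition boundary_act :: "(bool list \<Rightarrow> bool list) \<Rightarrow> (nat \<Rightarrow> bool) \<Rightarrow> nat \<Rightarrow> bool" where
  "boundary_act g \<xi> = (\<lambda>n. g (map \<xi> [0..<Suc n]) ! n)"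


section \<open>Rooted labeled graphs\<close>

text \<open>\<open>gmult \<Gamma> s u v\<close> is the number of edges with label \<open>s\<close> between \<open>u\<close> and \<open>v\<close>
  (for \<open>u = v\<close>, the number of loops at \<open>u\<close> with label \<open>s\<close>).\<close>

record 'v rgraph =
  gverts :: "'v set"
  groot :: 'v
  gmult :: "gen \<Rightarrow> 'v \<Rightarrow> 'v \<Rightarrow> nat"

definition gadj :: "'v rgraph \<Rightarrow> ('v \<times> 'v) set" where
  "gadj \<Gamma> = {(u, v). \<exists>s. gmult \<Gamma> s u v > 0}"

definition rooted_graph :: "'v rgraph \<Rightarrow> bool" where
  "rooted_graph \<Gamma> \<longleftrightarrow>
     groot \<Gamma> \<in> gverts \<Gamma> \<and>
     gadj \<Gamma> \<subseteq> gverts \<Gamma> \<times> gverts \<Gamma> \<and>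
     (\<forall>s u v. gmult \<Gamma> s u v = gmult \<Gamma> s v u) \<and>
     (\<forall>u\<in>gverts \<Gamma>. \<forall>v\<in>gverts \<Gamma>. (u, v) \<in> (gadj \<Gamma>)\<^sup>*) \<and>
     (\<forall>u\<in>gverts \<Gamma>. finite (gadj \<Gamma> `` {u}))"

definition graph_iso :: "'v rgraph \<Rightarrow> 'w rgraph \<Rightarrow> bool" where
  "graph_iso \<Gamma> \<Delta> \<longleftrightarrow> (\<exists>f. bij_betw f (gverts \<Gamma>) (gverts \<Delta>) \<and> f (groot \<Gamma>) = groot \<Delta> \<and>
     (\<forall>s. \<forall>u\<in>gverts \<Gamma>. \<forall>v\<in>gverts \<Gamma>. gmult \<Gamma> s u v = gmult \<Delta> s (f u) (f v)))"

text \<open>The subgraph induced on the vertices at distance at most \<open>r\<close> from the root.\<close>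

definition gball_verts :: "nat \<Rightarrow> 'v rgraph \<Rightarrow> 'v set" where
  "gball_verts r \<Gamma> = {v \<in> gverts \<Gamma>. \<exists>k\<le>r. (groot \<Gamma>, v) \<in> gadj \<Gamma> ^^ k}"

definition gball :: "nat \<Rightarrow> 'v rgraph \<Rightarrow> 'v rgraph" where
  "gball r \<Gamma> = \<lparr>gverts = gball_verts r \<Gamma>, groot = groot \<Gamma>,
     gmult = (\<lambda>s u v. if u \<in> gball_verts r \<Gamma> \<and> v \<in> gball_verts r \<Gamma> then gmult \<Gamma> s u v else 0)\<rparr>"

text \<open>A connected locally finite graph has countably many vertices. The isomorphism class of
  such a graph, over whatever vertex type, is therefore faithfully represented by the nonempty set
  of all graphs isomorphic to it whose vertices are natural numbers.\<close>

type_synonym gclass = "nat rgraph set"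

definition iso_class :: "'v rgraph \<Rightarrow> gclass" where
  "iso_class \<Gamma> = {\<Delta>. rooted_graph \<Delta> \<and> graph_iso \<Delta> \<Gamma>}"

definition G_star :: "gclass set" where
  "G_star = {iso_class \<Gamma> |\<Gamma> :: nat rgraph. rooted_graph \<Gamma>}"

definition same_ball :: "nat \<Rightarrow> gclass \<Rightarrow> gclass \<Rightarrow> bool" where
  "same_ball r p q \<longleftrightarrow> (\<exists>\<Gamma>\<in>p. \<exists>\<Delta>\<in>q. graph_iso (gball r \<Gamma>) (gball r \<Delta>))"

text \<open>The topology of local convergence.\<close>

definition G_star_top :: "gclass topology" where
  "G_star_top = topology_generated_by {{q \<in> G_star. same_ball r p q} |r p. p \<in> G_star}"

definition reroot :: "gen \<Rightarrow> gclass \<Rightarrow> gclass" where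
  "reroot s p = (\<lambda>\<Gamma>. \<Gamma>\<lparr>groot := (THE w. gmult \<Gamma> s (groot \<Gamma>) w > 0)\<rparr>) ` p"


section \<open>Schreier graphs\<close>

definition Schreier :: "(nat \<Rightarrow> bool) \<Rightarrow> (nat \<Rightarrow> bool) rgraph" where
  "Schreier \<xi> = (let V = orbit G_group boundary_act \<xi> in
     \<lparr>gverts = V, groot = \<xi>,
      gmult = (\<lambda>s p q. of_bool (p \<in> V \<and> q \<in> V \<and> boundary_act (G_gen s) p = q))\<rparr>)"

definition Schreier_closure :: "gclass set" where
  "Schreier_closure = G_star_top closure_of (range (\<lambda>\<xi>. iso_class (Schreier \<xi>)))"

definition X_space :: "gclass set" where
  "X_space = Schreier_closure -
     {p \<in> Schreier_closure. openin (subtopology G_star_top Schreier_closure) {p}}"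

definition X_top :: "gclass topology" where
  "X_top = subtopology G_star_top X_space"

text \<open>An action of the group on \<^const>\<open>X_space\<close> is determined by what the generators do.\<close>

definition root_change_action ::
    "((bool list \<Rightarrow> bool list) \<Rightarrow> gclass \<Rightarrow> gclass) \<Rightarrow> bool" where
  "root_change_action \<beta> \<longleftrightarrow> dyn_system G_group X_top \<beta> \<and>
     (\<forall>s. \<forall>p\<in>X_space. \<beta> (G_gen s) p = reroot s p)"


section \<open>Graphs of points of the subshift\<close>

text \<open>The letter at \<open>n\<close> produces edges between \<open>n\<close> and \<open>n + 1\<close> with the labels \<open>s\<close> such that
  \<open>\<omega> n \<in> edge_letters s\<close>, and loops at \<open>n\<close> and \<open>n + 1\<close> with the labels \<open>s\<close> such that
  \<open>\<omega> n \<in> loop_letters s\<close>.\<close>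

fun loop_letters :: "gen \<Rightarrow> letter set" where
  "loop_letters Ga = {}"
| "loop_letters Gb = {Lz}"
| "loop_letters Gc = {Ly}"
| "loop_letters Gd = {Lx}"

definition gr :: "(int \<Rightarrow> letter) \<Rightarrow> int rgraph" where
  "gr \<omega> = \<lparr>gverts = UNIV, groot = 1,
     gmult = (\<lambda>s m n.
         of_bool (n = m + 1 \<and> \<omega> m \<in> edge_letters s)
       + of_bool (m = n + 1 \<and> \<omega> n \<in> edge_letters s)
       + of_bool (m = n \<and> \<omega> n \<in> loop_letters s)
       + of_bool (m = n \<and> \<omega> (n - 1) \<in> loop_letters s))\<rparr>"

definition Gr :: "(int \<Rightarrow> letter) \<Rightarrow> gclass" where
  "Gr \<omega> = iso_class (gr \<omega>)"

end

theory Submission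
  imports Defs
    "HOL-Probability.Infinite_Product_Measure"
    "HOL-Probability.Probability_Mass_Function"
begin

text \<open>
  The letter at position \<open>i\<close> of \<open>\<tau>\<^sup>n(a)\<close>, counted from 1, depends only on the 2-adic valuation of
  \<open>i\<close>; so \<open>\<Omega>\<^sub>\<tau>\<close> consists of the two-sided sequences that look locally like this ruler sequence.
  On the side of the group, the complemented Gray code identifies the orbit of \<open>1\<^sup>\<infinity>\<close> with the
  half-line labelled by the ruler sequence itself. A rooted graph given by four involutions is
  determined by the words that fix its root, and balls are determined by the short words. As every
  finite string of digits occurs as a prefix arbitrarily far out on the half-line, a word is trivial
  in \<open>G\<close> iff it closes up everywhere on the half-line iff it is trivial in \<open>H\<close> (points of
  \<open>\<Omega>\<^sub>\<tau>\<close> are aperiodic). Allowing a missing letter as an end, the closure of the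
  Schreier graphs is that of the half-lines rooted at their various vertices; the half-lines in it are isolated
  because the end is recognised by its three loops, and the remaining graphs are the lines
  \<open>Gr \<omega>\<close>, which determine \<open>\<omega>\<close> up to reflection about the root. Finally an invariant measure,
  for the shift as well as for \<open>G\<close>, gives mass \<open>2\<^sup>-\<^sup>k\<close> to each of the \<open>2\<^sup>k\<close> level \<open>k\<close> phases of the Toeplitz
  structure; this determines it, and coin tossing for the digits of the phase produces it.
\<close>


section \<open>The ruler sequence and the subshift\<close>

text \<open>The graphs to be compared live on unrelated vertex sets: boundary points, integers,
  natural numbers. Since each label leaves a vertex along exactly one edge, an isomorphism is forced
  once the root is placed; hence words can replace vertices throughout, and isomorphisms of growing
  balls glue together. The Gray code fits because two rotations run in step: doubling an index
  advances its letter along x, y, z, x, while below a digit 1 the recursion of the generators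
  advances along b, c, d, b. Only the orbit of \<open>1^\<infinity>\<close> is computed explicitly.
  Any other boundary point is approximated from it, because a digit 0 stops the recursion, so that a
  short word alters digits up to a bounded index only. For measures, invariance under T and under G
  meet through piecewise maps: each generator is locally a power of the shift, and the shift is
  locally a generator. Uniqueness precedes invariance and yields it: translating an equidistributed
  measure gives an equidistributed measure, hence the same one.\<close>

fun nxt :: "letter \<Rightarrow> letter" where
  "nxt La = Lx" | "nxt Lx = Ly" | "nxt Ly = Lz" | "nxt Lz = Lx"

text \<open>\<open>nxt\<close> follows the substitution, except that \<open>La\<close> goes to the
  middle letter of its image; the levels 1, 2, 3, ... therefore carry x, y, z with period 3.\<close>

definition lev :: "nat \<Rightarrow> letter" where
  "lev v = (nxt ^^ v) La"

text \<open>At 0 the multiplicity is 0 by convention, so \<open>ruler 0 = La\<close> is a junk value.\<close>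

definition ruler :: "int \<Rightarrow> letter" where
  "ruler n = lev (multiplicity 2 n)"

lemma lev_0 [simp]: "lev 0 = La"
  and lev_Suc: "lev (Suc v) = nxt (lev v)"
  by (simp_all add: lev_def)

lemma nxt_ne [simp]: "nxt l \<noteq> l" "nxt l \<noteq> La"
  by (cases l; simp)+

lemma lev_Suc_ne: "lev (Suc v) \<noteq> lev v"
  by (simp add: lev_Suc)

text \<open>Supplies arbitrarily high levels with the letter \<open>Lx\<close>, so that
  \<open>Lx\<close> can stand at a position that plays the role of infinite valuation.\<close>

lemma lev_3 [simp]: "lev (Suc (3 * j)) = Lx"
  by (induction j) (simp_all add: lev_Suc numeral_3_eq_3)

lemma ruler_odd: "odd n \<Longrightarrow> ruler n = La"
  by (simp add: ruler_def not_dvd_imp_multiplicity_0)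

lemma ruler_double: "n \<noteq> 0 \<Longrightarrow> ruler (2 * n) = nxt (ruler n)"
  by (simp add: ruler_def multiplicity_times_same lev_Suc)

lemma ruler_minus [simp]: "ruler (- n) = ruler n"
  unfolding ruler_def by (rule arg_cong[where f = lev], rule multiplicity_cong) simp

lemma ruler_eq_La_iff: "n \<noteq> 0 \<Longrightarrow> ruler n = La \<longleftrightarrow> odd n"
  by (auto simp: ruler_double ruler_odd elim!: evenE)

lemma multiplicity_2_unique: "2 ^ v dvd n \<Longrightarrow> \<not> 2 ^ Suc v dvd n \<Longrightarrow> multiplicity 2 (n :: int) = v"
  by (rule multiplicity_eqI) auto

lemma ruler_lev: "2 ^ v dvd n \<Longrightarrow> \<not> 2 ^ Suc v dvd n \<Longrightarrow> ruler n = lev v"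
  unfolding ruler_def using multiplicity_2_unique by metis

lemma two_pow_decomp:
  assumes "\<not> 2 ^ k dvd (n :: int)"
  obtains v where "v < k" "2 ^ v dvd n" "\<not> 2 ^ Suc v dvd n"
  using assms
proof (induction k arbitrary: thesis)
  case (Suc k)
  then show ?case by (metis less_Suc_eq)
qed simp

text \<open>The first hypothesis puts the valuation of \<open>n\<close> below \<open>k\<close>,
  where adding a multiple of \<open>2^k\<close> cannot change it. It also keeps both arguments away
  from the junk value at 0.\<close>

lemma ruler_cong:
  assumes "\<not> 2 ^ k dvd n" "2 ^ k dvd (n - n')"
  shows "ruler n = ruler n'"
proof -
  obtain v where v: "v < k" "2 ^ v dvd n" "\<not> 2 ^ Suc v dvd n"
    using assms(1) by (rule two_pow_decomp)
  have "2 ^ Suc v dvd (2 :: int) ^ k"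
    using v(1) by (intro le_imp_power_dvd) simp
  hence d: "2 ^ Suc v dvd n - n'" using assms(2) by (rule dvd_trans)
  hence "2 ^ v dvd n - n'" by (rule power_le_dvd) simp
  hence "2 ^ v dvd n'" using dvd_diff[OF v(2)] by fastforce
  moreover have "\<not> 2 ^ Suc v dvd n'" using dvd_add[OF d] v(3) by fastforce
  ultimately show ?thesis using v ruler_lev[of v n] ruler_lev[of v n'] by simp
qed

lemma int_less_two_pow: "int k < 2 ^ k"
  using of_nat_less_iff[of k "2 ^ k", where 'a = int] by (simp add: less_exp del: of_nat_less_iff)

lemma two_pow_not_dvd_small: "i \<noteq> 0 \<Longrightarrow> \<bar>i\<bar> < 2 ^ k \<Longrightarrow> \<not> 2 ^ k dvd (i :: int)"
  using dvd_imp_le_int[of i "2 ^ k"] by auto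

lemma ruler_add_pow:
  assumes "i \<noteq> 0" "\<bar>i\<bar> < 2 ^ k" "2 ^ k dvd c"
  shows "ruler (c + i) = ruler i"
proof -
  have "\<not> 2 ^ k dvd i" using assms(1,2) by (rule two_pow_not_dvd_small)
  thus ?thesis using ruler_cong[of k i "c + i"] assms(3) by (simp add: dvd_minus_iff)
qed

lemma ruler_pow [simp]: "ruler (2 ^ k) = lev k"
  by (rule ruler_lev) (auto dest: power_dvd_imp_le)

section \<open>Iterates of the substitution\<close>

lemma subst_append: "subst (u @ w) = subst u @ subst w"
  by (simp add: subst_def)

lemma subst_single [simp]: "subst [l] = subst_letter l"
  by (simp add: subst_def)

lemma subst_pow_append: "(subst ^^ n) (u @ w) = (subst ^^ n) u @ (subst ^^ n) w"
  by (induction n) (simp_all add: subst_append)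

lemma subst_pow_single:
  assumes "l \<noteq> La"
  shows "\<exists>l'. (subst ^^ n) [l] = [l']"
proof -
  have "\<exists>l'. (subst ^^ n) [l] = [l'] \<and> l' \<noteq> La"
  proof (induction n)
    case (Suc n)
    then obtain l' where "(subst ^^ n) [l] = [l']" "l' \<noteq> La" by blast
    thus ?case by (cases l') simp_all
  qed (use assms in simp)
  thus ?thesis by blast
qed

lemma subst_pow_Lx: "(subst ^^ n) [Lx] = [lev (Suc n)]"
proof (induction n)
  case (Suc n)
  have "lev (Suc n) \<noteq> La" by (simp add: lev_Suc)
  thus ?case using Suc by (cases "lev (Suc n)") (simp_all add: subst_def lev_Suc)
qed (simp add: lev_Suc)

text \<open>In the recursion \<open>\<tau>^(n+1)(a) = \<tau>^n(a) \<tau>^n(x) \<tau>^n(a)\<close>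
  the middle letter sits at position \<open>2^(n+1)\<close>, and the valuations after it repeat
  those before it because the distances to it stay below \<open>2^(n+1)\<close>.\<close>

lemma subst_pow_La:
  "(subst ^^ n) [La] = map (\<lambda>i. ruler (1 + int i)) [0..<2 ^ Suc n - 1]"
proof (induction n)
  case (Suc n)
  define m :: nat where "m = 2 ^ Suc n - 1"
  have m: "2 ^ Suc (Suc n) - 1 = Suc m + m" "int (Suc m) = 2 ^ Suc n"
    by (simp_all add: m_def of_nat_diff)
  have "(subst ^^ Suc n) [La] = (subst ^^ n) ([La] @ [Lx] @ [La])"
    by (simp add: funpow_swap1 subst_def del: funpow.simps) (simp add: subst_def funpow_swap1)
  also have "\<dots> = map (\<lambda>i. ruler (1 + int i)) [0..<m] @ [lev (Suc n)] @ map (\<lambda>i. ruler (1 + int i)) [0..<m]"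
    unfolding subst_pow_append Suc.IH subst_pow_Lx m_def by simp
  also have "map (\<lambda>i. ruler (1 + int i)) [0..<m] @ [lev (Suc n)] @ map (\<lambda>i. ruler (1 + int i)) [0..<m]
    = map (\<lambda>i. ruler (1 + int i)) [0..<m] @ [lev (Suc n)] @ map (\<lambda>i. ruler (1 + int i)) (map (\<lambda>i. i + Suc m) [0..<m])"
  proof (simp add: m(2), intro ballI)
    fix i assume "i \<in> {0..<m}"
    hence "int i + 1 < 2 ^ Suc n" using m(2) by simp
    thus "ruler (1 + int i) = ruler (2 + (int i + int m))"
      using ruler_add_pow[of "int i + 1" "Suc n" "int (Suc m)"] m(2) by (simp add: algebra_simps del: power_Suc)
  qed
  also have "\<dots> =
     map (\<lambda>i. ruler (1 + int i)) ([0..<m] @ [m] @ map (\<lambda>i. i + Suc m) [0..<m])"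
    using m(2) ruler_pow[of "Suc n"] by (simp del: ruler_pow add: add.commute)
  also have "[0..<m] @ [m] @ map (\<lambda>i. i + Suc m) [0..<m] = [0..<Suc m] @ [Suc m..<Suc m + m]"
    by (simp only: map_add_upt add.commute[of m "Suc m"] upt_Suc_append[OF le0] append_assoc)
  also have "\<dots> = [0..<Suc m + m]" by (rule upt_add_eq_append[OF le0, symmetric])
  finally show ?case by (simp only: m)
qed (simp add: ruler_odd)

text \<open>The iterates of x, y, z are single letters, each of which occurs in the ruler sequence;
  the iterates of a are prefixes of that sequence, of unbounded length.\<close>

lemma Sub_tau_iff:
  "w \<in> Sub_tau \<longleftrightarrow> (\<exists>q\<ge>1. w = map (\<lambda>i. ruler (q + int i)) [0..<length w])"
proof
  assume "w \<in> Sub_tau"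
  then obtain n s where ns: "sublist w ((subst ^^ n) [s])" by (auto simp: Sub_tau_def)
  show "\<exists>q\<ge>1. w = map (\<lambda>i. ruler (q + int i)) [0..<length w]"
  proof (cases "s = La")
    case True
    then obtain u v where "u @ w @ v = map (\<lambda>i. ruler (1 + int i)) [0..<2 ^ Suc n - 1]"
      using ns unfolding subst_pow_La[symmetric] sublist_def by auto
    note eq = this
    have len: "length u + length w \<le> 2 ^ Suc n - 1"
      using arg_cong[OF eq, of length] by simp
    have "w ! i = ruler (1 + int (length u) + int i)" if "i < length w" for i
      using arg_cong[OF eq, of "\<lambda>x. x ! (length u + i)"] that len
      by (simp add: nth_append algebra_simps)
    hence "w = map (\<lambda>i. ruler ((1 + int (length u)) + int i)) [0..<length w]"
      by (intro nth_equalityI) auto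
    thus ?thesis by (intro exI[of _ "1 + int (length u)"]) auto
  next
    case False
    then obtain l where "sublist w [l]" using ns subst_pow_single by metis
    then consider "w = []" | "w = [l]" by (auto simp: sublist_Cons_right prefix_Cons)
    then show ?thesis
    proof cases
      case 2
      have "\<exists>k. lev k = l"
        by (cases l) (metis lev_0 lev_Suc nxt.simps)+
      then obtain k where "lev k = l" ..
      thus ?thesis using 2 by (intro exI[of _ "2 ^ k"]) simp
    qed (auto intro: exI[of _ 1])
  qed
next
  assume "\<exists>q\<ge>1. w = map (\<lambda>i. ruler (q + int i)) [0..<length w]"
  then obtain q :: int where q: "q \<ge> 1" "w = map (\<lambda>i. ruler (q + int i)) [0..<length w]" by blast
  define p where "p = nat (q - 1)"
  \<comment> \<open>A generous exponent: the iterate has length \<open>2^(n+1) - 1\<close>, which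
    exceeds \<open>n\<close> as soon as \<open>n > 0\<close>, so it reaches past the block.\<close>
  define n where "n = p + length w"
  define M :: nat where "M = 2 ^ Suc n - 1"
  have "n < 2 ^ n" by (rule less_exp)
  hence "n \<le> M" unfolding M_def power_Suc by linarith
  hence M: "p + length w \<le> M" by (simp add: n_def)
  have eq: "map (\<lambda>i. ruler (1 + int i)) [0..<M]
     = map (\<lambda>i. ruler (1 + int i)) ([0..<p] @ [p..<p + length w] @ [p + length w..<M])"
    using M upt_add_eq_append[of 0 p "M - p"] upt_add_eq_append[of p "p + length w" "M - p - length w"]
    by simp
  have "map (\<lambda>i. ruler (1 + int i)) [p..<p + length w] = w"
  proof (rule nth_equalityI)
    fix i assume "i < length (map (\<lambda>i. ruler (1 + int i)) [p..<p + length w])"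
    moreover from this have "w ! i = ruler (q + int i)"
      by (subst q(2)) simp
    ultimately show "map (\<lambda>i. ruler (1 + int i)) [p..<p + length w] ! i = w ! i"
      using q(1) by (simp add: p_def)
  qed simp
  hence "sublist w ((subst ^^ n) [La])"
    unfolding subst_pow_La M_def[symmetric] sublist_def eq map_append by metis
  thus "w \<in> Sub_tau" by (auto simp: Sub_tau_def)
qed

section \<open>Windows, and points of the subshift as local copies of the ruler sequence\<close>

definition agree :: "nat \<Rightarrow> (int \<Rightarrow> 'l) \<Rightarrow> (int \<Rightarrow> 'l) \<Rightarrow> bool" where
  "agree N \<omega> \<omega>' \<longleftrightarrow> (\<forall>i. \<bar>i\<bar> \<le> int N \<longrightarrow> \<omega> i = \<omega>' i)"

lemma agree_refl [simp]: "agree N \<omega> \<omega>"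
  and agree_sym: "agree N \<omega> \<omega>' \<Longrightarrow> agree N \<omega>' \<omega>"
  and agree_trans: "agree N \<omega> \<omega>' \<Longrightarrow> agree N \<omega>' \<omega>'' \<Longrightarrow> agree N \<omega> \<omega>''"
  and agree_mono: "agree N \<omega> \<omega>' \<Longrightarrow> M \<le> N \<Longrightarrow> agree M \<omega> \<omega>'"
  by (auto simp: agree_def)

lemma agreeD: "agree N \<omega> \<omega>' \<Longrightarrow> \<bar>i\<bar> \<le> int N \<Longrightarrow> \<omega> i = \<omega>' i"
  by (simp add: agree_def)

text \<open>Windows centred at 0 suffice, as every block lies in one of them;
  \<open>q > int N\<close> keeps the copied stretch at positive positions.\<close>

lemma Omega_tau_iff:
  "\<omega> \<in> Omega_tau \<longleftrightarrow> (\<forall>N. \<exists>q>int N. agree N \<omega> (\<lambda>i. ruler (q + i)))"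
proof
  assume w: "\<omega> \<in> Omega_tau"
  show "\<forall>N. \<exists>q>int N. agree N \<omega> (\<lambda>i. ruler (q + i))"
  proof
    fix N :: nat
    let ?w = "map (\<lambda>i. \<omega> (- int N + int i)) [0..<2 * N + 1]"
    have "?w \<in> Sub_tau" using w unfolding Omega_tau_def mem_Collect_eq by blast
    then obtain q where q: "q \<ge> 1" "?w = map (\<lambda>i. ruler (q + int i)) [0..<2 * N + 1]"
      unfolding Sub_tau_iff by (auto simp del: upt_Suc)
    have "\<omega> i = ruler (q + int N + i)" if "\<bar>i\<bar> \<le> int N" for i
    proof -
      have "nat (i + int N) < 2 * N + 1" using that by linarith
      hence "?w ! nat (i + int N) = ruler (q + int (nat (i + int N)))"
        unfolding q(2) by (simp del: upt_Suc)
      moreover have "int (nat (i + int N)) = i + int N" using that by linarith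
      ultimately show ?thesis using \<open>nat (i + int N) < 2 * N + 1\<close>
        by (simp del: upt_Suc int_nat_eq add: algebra_simps)
    qed
    thus "\<exists>q>int N. agree N \<omega> (\<lambda>i. ruler (q + i))"
      using q(1) by (intro exI[of _ "q + int N"]) (auto simp: agree_def)
  qed
next
  assume a: "\<forall>N. \<exists>q>int N. agree N \<omega> (\<lambda>i. ruler (q + i))"
  show "\<omega> \<in> Omega_tau" unfolding Omega_tau_def mem_Collect_eq
  proof (intro allI)
    fix m :: int and k :: nat
    define N where "N = nat \<bar>m\<bar> + k"
    obtain q where q: "q > int N" "agree N \<omega> (\<lambda>i. ruler (q + i))" using a by blast
    have "map (\<lambda>i. \<omega> (m + int i)) [0..<k] = map (\<lambda>i. ruler (q + m + int i)) [0..<k]"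
      using q by (auto simp: N_def intro!: agreeD[OF q(2), simplified add.assoc[symmetric]] simp: add.assoc)
    moreover have "q + m \<ge> 1" using q(1) by (simp add: N_def)
    ultimately show "map (\<lambda>i. \<omega> (m + int i)) [0..<k] \<in> Sub_tau"
      unfolding Sub_tau_iff by (intro exI[of _ "q + m"]) simp
  qed
qed

lemma Omega_tauE:
  assumes "\<omega> \<in> Omega_tau"
  obtains q where "q > int N" "agree N \<omega> (\<lambda>i. ruler (q + i))"
  using assms unfolding Omega_tau_iff by blast

lemma Omega_alternating:
  assumes "\<omega> \<in> Omega_tau"
  shows "\<omega> (n + 1) = La \<longleftrightarrow> \<omega> n \<noteq> La"
proof -
  obtain q where q: "q > int (nat \<bar>n\<bar> + 1)" "agree (nat \<bar>n\<bar> + 1) \<omega> (\<lambda>i. ruler (q + i))"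
    using assms by (rule Omega_tauE)
  have "\<omega> n = ruler (q + n)" "\<omega> (n + 1) = ruler (q + n + 1)"
    using agreeD[OF q(2), of n] agreeD[OF q(2), of "n + 1"] by (auto simp: add.assoc)
  moreover have "q + n \<noteq> 0" "q + n + 1 \<noteq> 0" using q(1) by linarith+
  ultimately show ?thesis by (simp add: ruler_eq_La_iff)
qed

text \<open>A limit of copies of the ruler sequence recentred at powers of 2 whose letter is
  \<open>Lx\<close>; position 0 stands for infinite valuation.\<close>

definition ruler_x :: "int \<Rightarrow> letter" where
  "ruler_x n = (if n = 0 then Lx else ruler n)"

lemma ruler_x_Omega: "ruler_x \<in> Omega_tau"
  unfolding Omega_tau_iff
proof
  fix N :: nat
  \<comment> \<open>A level beyond \<open>N\<close> that carries \<open>Lx\<close>: the copy around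
    \<open>2^k\<close> shows \<open>Lx\<close> at its centre and \<open>ruler i\<close> at the other
    positions of the window.\<close>
  define k where "k = Suc (3 * N)"
  have "int k < 2 ^ k" by (rule int_less_two_pow)
  hence k: "int N < 2 ^ k" by (simp add: k_def)
  have "ruler_x i = ruler (2 ^ k + i)" if "\<bar>i\<bar> \<le> int N" for i
  proof (cases "i = 0")
    case True
    thus ?thesis using ruler_pow[of k] by (simp add: ruler_x_def k_def del: ruler_pow)
  next
    case False
    thus ?thesis using ruler_add_pow[of i k "2 ^ k"] that k by (simp add: ruler_x_def)
  qed
  thus "\<exists>q>int N. agree N ruler_x (\<lambda>i. ruler (q + i))" using k unfolding agree_def by blast
qed

text \<open>If \<open>p\<close> has valuation \<open>v\<close>, a position of valuation
  \<open>v + 1\<close> in a local copy differs by \<open>p\<close> from one of valuation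
  \<open>v\<close>, and neighbouring levels carry different letters.\<close>

lemma Omega_aperiodic:
  assumes "\<omega> \<in> Omega_tau" "\<And>n. \<omega> (n + p) = \<omega> n"
  shows "p = 0"
proof (rule ccontr)
  assume "p \<noteq> 0"
  define k where "k = nat \<bar>p\<bar>"
  have "int k < 2 ^ k" by (rule int_less_two_pow)
  hence "\<bar>p\<bar> < 2 ^ k" by (simp add: k_def)
  hence "\<not> 2 ^ k dvd p" by (rule two_pow_not_dvd_small[OF \<open>p \<noteq> 0\<close>])
  then obtain v where v: "2 ^ v dvd p" "\<not> 2 ^ Suc v dvd p" by (rule two_pow_decomp)
  define N where "N = nat (2 ^ (v + 2) + \<bar>p\<bar>)"
  have N: "int N = 2 ^ (v + 2) + \<bar>p\<bar>" by (simp add: N_def)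
  obtain q where q: "q > int N" "agree N \<omega> (\<lambda>i. ruler (q + i))"
    using assms(1) by (rule Omega_tauE)
  \<comment> \<open>Chosen so that \<open>q + n + p\<close> is congruent to \<open>2^(v+1)\<close>
    modulo \<open>2^(v+2)\<close>, hence of valuation \<open>v + 1\<close>.\<close>
  define n where "n = (2 ^ Suc v - q - p) mod 2 ^ (v + 2)"
  have n: "0 \<le> n" "n < 2 ^ (v + 2)" by (simp_all add: n_def)
  have "2 ^ (v + 2) dvd (2 ^ Suc v - q - p) - n" unfolding n_def by simp
  then obtain t where "2 ^ Suc v - q - p - n = 2 ^ (v + 2) * t" by (rule dvdE)
  hence t: "q + n + p = 2 ^ Suc v - 2 ^ (v + 2) * t" by linarith
  have qnp: "q + n + p = 2 ^ Suc v * (1 - 2 * t)" using t by (simp add: algebra_simps)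
  moreover have "\<not> 2 ^ Suc (Suc v) dvd 2 ^ Suc v * (1 - 2 * t)"
    by (simp only: power_Suc2[of _ "Suc v"] dvd_mult_cancel_left) simp
  ultimately have 1: "ruler (q + n + p) = lev (Suc v)" by (intro ruler_lev) auto
  have "2 ^ Suc v dvd q + n + p" using qnp by simp
  moreover from this have "2 ^ v dvd q + n + p" by (rule power_le_dvd) simp
  ultimately have "2 ^ v dvd q + n" "\<not> 2 ^ Suc v dvd q + n"
    using v dvd_diff[of "2 ^ v" "q + n + p" p] dvd_diff[of "2 ^ Suc v" "q + n + p" "q + n"] by auto
  hence 2: "ruler (q + n) = lev v" by (rule ruler_lev)
  have "\<omega> n = lev v" "\<omega> (n + p) = lev (Suc v)"
    using agreeD[OF q(2), of n] agreeD[OF q(2), of "n + p"] 1 2 n N by (auto simp: add.assoc)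
  thus False using assms(2)[of n] lev_Suc_ne by metis
qed


section \<open>Rooted graphs of involutions\<close>

definition orb :: "(gen \<Rightarrow> 'v \<Rightarrow> 'v) \<Rightarrow> 'v \<Rightarrow> 'v set" where
  "orb \<sigma> v = range (\<lambda>w. foldr \<sigma> w v)"

text \<open>The common form of the Schreier graphs, of the graphs \<open>gr \<omega>\<close> and of
  the half-lines: four involutions acting on some set, seen from one point.\<close>

definition action_graph :: "(gen \<Rightarrow> 'v \<Rightarrow> 'v) \<Rightarrow> 'v \<Rightarrow> 'v rgraph" where
  "action_graph \<sigma> v = \<lparr>gverts = orb \<sigma> v, groot = v,
     gmult = (\<lambda>s p q. of_bool (p \<in> orb \<sigma> v \<and> q \<in> orb \<sigma> v \<and> \<sigma> s p = q))\<rparr>"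

text \<open>A set of words rather than of group elements, so that stabilisers in actions on
  different sets can be compared directly.\<close>

definition stab :: "(gen \<Rightarrow> 'v \<Rightarrow> 'v) \<Rightarrow> 'v \<Rightarrow> gen list set" where
  "stab \<sigma> v = {w. foldr \<sigma> w v = v}"

definition involutive :: "(gen \<Rightarrow> 'v \<Rightarrow> 'v) \<Rightarrow> bool" where
  "involutive \<sigma> \<longleftrightarrow> (\<forall>s u. \<sigma> s (\<sigma> s u) = u)"

lemma UNIV_gen: "UNIV = {Ga, Gb, Gc, Gd}"
  using gen.exhaust by blast

instance gen :: finite
  by standard (simp add: UNIV_gen)

lemma involutiveD [simp]: "involutive \<sigma> \<Longrightarrow> \<sigma> s (\<sigma> s u) = u"
  by (simp add: involutive_def)

lemma foldr_rev_cancel: "involutive \<sigma> \<Longrightarrow> foldr \<sigma> (rev w) (foldr \<sigma> w v) = v"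
  by (induction w arbitrary: v) simp_all

lemma foldr_rev_cancel': "involutive \<sigma> \<Longrightarrow> foldr \<sigma> w (foldr \<sigma> (rev w) v) = v"
  using foldr_rev_cancel[of \<sigma> "rev w"] by simp

text \<open>For involutions \<open>rev w'\<close> undoes \<open>w'\<close>; so the coincidence of
  two endpoints is a question about one word, whose length is the sum of the two.\<close>

lemma foldr_eq_iff_stab:
  "involutive \<sigma> \<Longrightarrow> foldr \<sigma> w v = foldr \<sigma> w' v \<longleftrightarrow> rev w' @ w \<in> stab \<sigma> v"
  unfolding stab_def using foldr_rev_cancel'[of \<sigma> w' "foldr \<sigma> w v"] foldr_rev_cancel[of \<sigma> w' v] by auto

lemma orb_self [simp]: "v \<in> orb \<sigma> v"
  unfolding orb_def by (rule range_eqI[of _ _ "[]"]) simp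

lemma orb_foldr [simp]: "foldr \<sigma> w v \<in> orb \<sigma> v"
  by (simp add: orb_def)

lemma orb_step: "u \<in> orb \<sigma> v \<Longrightarrow> \<sigma> s u \<in> orb \<sigma> v"
  unfolding orb_def by (auto intro: range_eqI[of _ _ "s # _"])

lemma orb_step_iff [simp]:
  assumes "involutive \<sigma>"
  shows "\<sigma> s u \<in> orb \<sigma> v \<longleftrightarrow> u \<in> orb \<sigma> v"
  using orb_step[of u \<sigma> v s] orb_step[of "\<sigma> s u" \<sigma> v s] assms by auto

lemma orbE: "u \<in> orb \<sigma> v \<Longrightarrow> (\<And>w. u = foldr \<sigma> w v \<Longrightarrow> P) \<Longrightarrow> P"
  by (auto simp: orb_def)

lemma action_graph_simps [simp]:
  "gverts (action_graph \<sigma> v) = orb \<sigma> v"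
  "groot (action_graph \<sigma> v) = v"
  "gmult (action_graph \<sigma> v) s p q = of_bool (p \<in> orb \<sigma> v \<and> q \<in> orb \<sigma> v \<and> \<sigma> s p = q)"
  by (simp_all add: action_graph_def)

lemma gadj_action_graph:
  "gadj (action_graph \<sigma> v) = {(p, q). p \<in> orb \<sigma> v \<and> q \<in> orb \<sigma> v \<and> (\<exists>s. \<sigma> s p = q)}"
  by (auto simp: gadj_def)

lemma gadj_pow_action_graph:
  "(v, u) \<in> gadj (action_graph \<sigma> v) ^^ k \<longleftrightarrow> (\<exists>w. length w = k \<and> u = foldr \<sigma> w v)"
proof (induction k arbitrary: u)
  case (Suc k)
  show ?case
  proof
    assume "(v, u) \<in> gadj (action_graph \<sigma> v) ^^ Suc k"
    then obtain p where "(v, p) \<in> gadj (action_graph \<sigma> v) ^^ k" "(p, u) \<in> gadj (action_graph \<sigma> v)"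
      by auto
    then obtain w s where "length w = k" "p = foldr \<sigma> w v" "u = \<sigma> s p"
      using Suc.IH by (auto simp: gadj_action_graph)
    thus "\<exists>w. length w = Suc k \<and> u = foldr \<sigma> w v" by (intro exI[of _ "s # w"]) simp
  next
    assume "\<exists>w. length w = Suc k \<and> u = foldr \<sigma> w v"
    then obtain s w where "length w = k" "u = \<sigma> s (foldr \<sigma> w v)"
      by (auto simp: length_Suc_conv)
    thus "(v, u) \<in> gadj (action_graph \<sigma> v) ^^ Suc k"
      using Suc.IH by (auto simp: gadj_action_graph orb_step intro!: relcompI)
  qed
qed auto

lemma gball_verts_action_graph:
  "gball_verts r (action_graph \<sigma> v) = {foldr \<sigma> w v |w. length w \<le> r}"
  by (auto simp: gball_verts_def gadj_pow_action_graph)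

lemma gball_simps [simp]:
  "gverts (gball r \<Gamma>) = gball_verts r \<Gamma>" "groot (gball r \<Gamma>) = groot \<Gamma>"
  "gmult (gball r \<Gamma>) s u v = (if u \<in> gball_verts r \<Gamma> \<and> v \<in> gball_verts r \<Gamma> then gmult \<Gamma> s u v else 0)"
  by (simp_all add: gball_def)

lemma rooted_action_graph:
  assumes "involutive \<sigma>"
  shows "rooted_graph (action_graph \<sigma> v)"
  unfolding rooted_graph_def
proof (intro conjI ballI allI)
  let ?E = "gadj (action_graph \<sigma> v)"
  have sym: "sym ?E" using involutiveD[OF assms] by (auto simp: sym_def gadj_action_graph)
  have "(v, foldr \<sigma> w v) \<in> ?E\<^sup>*" for w
    using gadj_pow_action_graph[where v = v and u = "foldr \<sigma> w v" and \<sigma> = \<sigma> and k = "length w"] by (auto simp: rtrancl_power)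
  hence 1: "(v, u) \<in> ?E\<^sup>*" if "u \<in> orb \<sigma> v" for u
    using that by (auto elim!: orbE)
  fix u w assume "u \<in> gverts (action_graph \<sigma> v)" "w \<in> gverts (action_graph \<sigma> v)"
  thus "(u, w) \<in> ?E\<^sup>*"
    using 1 sym_rtrancl[OF sym] by (metis action_graph_simps(1) rtrancl_trans symD)
next
  fix u assume "u \<in> gverts (action_graph \<sigma> v)"
  have "gadj (action_graph \<sigma> v) `` {u} \<subseteq> (\<lambda>s. \<sigma> s u) ` UNIV"
    by (auto simp: gadj_action_graph)
  thus "finite (gadj (action_graph \<sigma> v) `` {u})" by (rule finite_subset) simp
next
  fix s p q
  show "gmult (action_graph \<sigma> v) s p q = gmult (action_graph \<sigma> v) s q p"
    using assms by auto
qed (auto simp: gadj_action_graph)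

section \<open>Isomorphisms of graphs and of balls\<close>

lemma graph_iso_refl: "graph_iso \<Gamma> \<Gamma>"
  unfolding graph_iso_def by (intro exI[of _ id]) simp

lemma graph_iso_sym:
  assumes "graph_iso \<Gamma> \<Delta>" "groot \<Gamma> \<in> gverts \<Gamma>"
  shows "graph_iso \<Delta> \<Gamma>"
proof -
  obtain f where f: "bij_betw f (gverts \<Gamma>) (gverts \<Delta>)" "f (groot \<Gamma>) = groot \<Delta>"
    "\<forall>s. \<forall>u\<in>gverts \<Gamma>. \<forall>v\<in>gverts \<Gamma>. gmult \<Gamma> s u v = gmult \<Delta> s (f u) (f v)"
    using assms(1) unfolding graph_iso_def by blast
  let ?g = "inv_into (gverts \<Gamma>) f"
  have "gmult \<Delta> s u v = gmult \<Gamma> s (?g u) (?g v)" if "u \<in> gverts \<Delta>" "v \<in> gverts \<Delta>" for s u v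
    using f(1,3) that by (simp add: bij_betw_inv_into_right bij_betw_apply[OF bij_betw_inv_into])
  moreover have "?g (groot \<Delta>) = groot \<Gamma>"
    using f(1,2) assms(2) by (metis bij_betw_inv_into_left)
  ultimately show ?thesis unfolding graph_iso_def using bij_betw_inv_into[OF f(1)] by blast
qed

lemma graph_iso_trans:
  assumes "graph_iso \<Gamma> \<Delta>" "graph_iso \<Delta> \<Theta>"
  shows "graph_iso \<Gamma> \<Theta>"
proof -
  obtain f where f: "bij_betw f (gverts \<Gamma>) (gverts \<Delta>)" "f (groot \<Gamma>) = groot \<Delta>"
    "\<forall>s. \<forall>u\<in>gverts \<Gamma>. \<forall>v\<in>gverts \<Gamma>. gmult \<Gamma> s u v = gmult \<Delta> s (f u) (f v)"
    using assms(1) unfolding graph_iso_def by blast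
  obtain g where g: "bij_betw g (gverts \<Delta>) (gverts \<Theta>)" "g (groot \<Delta>) = groot \<Theta>"
    "\<forall>s. \<forall>u\<in>gverts \<Delta>. \<forall>v\<in>gverts \<Delta>. gmult \<Delta> s u v = gmult \<Theta> s (g u) (g v)"
    using assms(2) unfolding graph_iso_def by blast
  have "f u \<in> gverts \<Delta>" if "u \<in> gverts \<Gamma>" for u using that f(1) by (rule bij_betw_apply[rotated])
  thus ?thesis unfolding graph_iso_def using f g
    by (intro exI[of _ "g \<circ> f"]) (auto intro: bij_betw_trans)
qed

lemma relpow_map:
  assumes "\<And>x y. (x, y) \<in> E \<Longrightarrow> (f x, f y) \<in> E'" "(x, y) \<in> E ^^ k"
  shows "(f x, f y) \<in> E' ^^ k"
  using assms(2) by (induction k arbitrary: y) (auto intro: assms(1))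

text \<open>The adjacency hypotheses keep every path inside the vertex set, where \<open>f\<close>
  and its inverse respect edges; hence distances from the root are preserved.\<close>

lemma graph_iso_gball:
  assumes "graph_iso \<Gamma> \<Delta>" "groot \<Gamma> \<in> gverts \<Gamma>"
    "gadj \<Gamma> \<subseteq> gverts \<Gamma> \<times> gverts \<Gamma>" "gadj \<Delta> \<subseteq> gverts \<Delta> \<times> gverts \<Delta>"
  shows "graph_iso (gball r \<Gamma>) (gball r \<Delta>)"
proof -
  obtain f where f: "bij_betw f (gverts \<Gamma>) (gverts \<Delta>)" "f (groot \<Gamma>) = groot \<Delta>"
    "\<And>s u v. u\<in>gverts \<Gamma> \<Longrightarrow> v\<in>gverts \<Gamma> \<Longrightarrow> gmult \<Gamma> s u v = gmult \<Delta> s (f u) (f v)"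
    using assms(1) unfolding graph_iso_def by blast
  let ?g = "inv_into (gverts \<Gamma>) f"
  have fin: "f u \<in> gverts \<Delta>" if "u \<in> gverts \<Gamma>" for u using that f(1) by (rule bij_betw_apply[rotated])
  have gin: "?g u \<in> gverts \<Gamma>" "f (?g u) = u" if "u \<in> gverts \<Delta>" for u
    using that f(1) by (auto simp: bij_betw_inv_into_right bij_betw_apply[OF bij_betw_inv_into])
  have 1: "(f x, f y) \<in> gadj \<Delta>" if "(x, y) \<in> gadj \<Gamma>" for x y
  proof -
    have "x \<in> gverts \<Gamma>" "y \<in> gverts \<Gamma>" using that assms(3) by auto
    thus ?thesis using that f(3) by (auto simp: gadj_def)
  qed
  have 2: "(?g x, ?g y) \<in> gadj \<Gamma>" if "(x, y) \<in> gadj \<Delta>" for x y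
  proof -
    have "x \<in> gverts \<Delta>" "y \<in> gverts \<Delta>" using that assms(4) by auto
    thus ?thesis using that f(3) gin by (auto simp: gadj_def)
  qed
  have groot: "?g (groot \<Delta>) = groot \<Gamma>"
    using f(1,2) assms(2) by (metis bij_betw_inv_into_left)
  have mem: "f u \<in> gball_verts r \<Delta> \<longleftrightarrow> u \<in> gball_verts r \<Gamma>" if "u \<in> gverts \<Gamma>" for u
  proof -
    have "?g (f u) = u" using that f(1) by (simp add: bij_betw_inv_into_left)
    hence "(groot \<Delta>, f u) \<in> gadj \<Delta> ^^ k \<longleftrightarrow> (groot \<Gamma>, u) \<in> gadj \<Gamma> ^^ k" for k
      using relpow_map[of "gadj \<Gamma>" f "gadj \<Delta>", OF 1] relpow_map[of "gadj \<Delta>" ?g "gadj \<Gamma>", OF 2]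
        f(2) groot by metis
    thus ?thesis using that fin by (auto simp: gball_verts_def)
  qed
  have sub: "gball_verts r \<Gamma> \<subseteq> gverts \<Gamma>" "gball_verts r \<Delta> \<subseteq> gverts \<Delta>"
    by (auto simp: gball_verts_def)
  have "f ` gball_verts r \<Gamma> = gball_verts r \<Delta>"
  proof
    show "f ` gball_verts r \<Gamma> \<subseteq> gball_verts r \<Delta>" using mem sub by auto
    show "gball_verts r \<Delta> \<subseteq> f ` gball_verts r \<Gamma>"
    proof
      fix u assume "u \<in> gball_verts r \<Delta>"
      hence "f (?g u) = u" "?g u \<in> gball_verts r \<Gamma>" using gin mem[of "?g u"] sub by auto
      thus "u \<in> f ` gball_verts r \<Gamma>" by (metis imageI)
    qed
  qed
  hence "bij_betw f (gball_verts r \<Gamma>) (gball_verts r \<Delta>)"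
    using f(1) sub(1) by (metis bij_betw_subset)
  moreover have "u \<in> gverts \<Gamma>" if "u \<in> gball_verts r \<Gamma>" for u using that sub by auto
  ultimately show ?thesis unfolding graph_iso_def using f(2) mem
    by (intro exI[of _ f]) (simp add: f(3)[symmetric])
qed

text \<open>A path of length at most \<open>r'\<close> from the root never leaves the ball of radius
  \<open>r'\<close>, so short distances measured inside that ball are the true ones.\<close>

lemma gball_gball:
  assumes "r \<le> r'" "groot \<Gamma> \<in> gverts \<Gamma>" "gadj \<Gamma> \<subseteq> gverts \<Gamma> \<times> gverts \<Gamma>"
  shows "gball r (gball r' \<Gamma>) = gball r \<Gamma>"
proof -
  have adj: "gadj (gball r' \<Gamma>) \<subseteq> gadj \<Gamma>" by (auto simp: gadj_def split: if_splits)
  have 1: "(groot \<Gamma>, u) \<in> gadj (gball r' \<Gamma>) ^^ k \<Longrightarrow> (groot \<Gamma>, u) \<in> gadj \<Gamma> ^^ k" for u k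
    using relpow_map[of "gadj (gball r' \<Gamma>)" id "gadj \<Gamma>"] adj by auto
  have 2: "(groot \<Gamma>, u) \<in> gadj (gball r' \<Gamma>) ^^ k"
    if "(groot \<Gamma>, u) \<in> gadj \<Gamma> ^^ k" "k \<le> r'" for u k
    using that
  proof (induction k arbitrary: u)
    case (Suc k)
    then obtain p where p: "(groot \<Gamma>, p) \<in> gadj \<Gamma> ^^ k" "(p, u) \<in> gadj \<Gamma>" by auto
    have "p \<in> gverts \<Gamma>" "u \<in> gverts \<Gamma>" using p(2) assms(3) by auto
    moreover have "k \<le> r'" using Suc.prems by simp
    ultimately have "p \<in> gball_verts r' \<Gamma>" "u \<in> gball_verts r' \<Gamma>"
      using p(1) Suc.prems unfolding gball_verts_def by blast+
    hence "(p, u) \<in> gadj (gball r' \<Gamma>)" using p(2) by (auto simp: gadj_def)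
    thus ?case using Suc.IH[OF p(1)] Suc.prems by auto
  qed simp
  have "gball_verts r (gball r' \<Gamma>) = gball_verts r \<Gamma>"
    unfolding gball_verts_def[of r] gball_simps using 1 2 assms(1)
    by (auto simp: gball_verts_def) (meson order_trans)+
  moreover have "gball_verts r \<Gamma> \<subseteq> gball_verts r' \<Gamma>"
    using assms(1) by (auto simp: gball_verts_def) (meson order_trans)
  ultimately show ?thesis by (auto simp: gball_def[of r] fun_eq_iff)
qed

lemma iso_class_eqI:
  assumes "graph_iso \<Gamma> \<Delta>" "groot \<Gamma> \<in> gverts \<Gamma>"
  shows "iso_class \<Gamma> = iso_class \<Delta>"
  unfolding iso_class_def using assms graph_iso_sym graph_iso_trans by (metis (no_types, lifting))

text \<open>Send the endpoint of a word to the endpoint of the same word in the other action. The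
  set \<open>W\<close> is a parameter because balls need the short words and whole graphs need all
  of them.\<close>

lemma word_map:
  fixes \<sigma> :: "gen \<Rightarrow> 'v \<Rightarrow> 'v" and \<sigma>' :: "gen \<Rightarrow> 'w \<Rightarrow> 'w"
  assumes "\<And>w w'. w \<in> W \<Longrightarrow> w' \<in> W \<Longrightarrow> foldr \<sigma> w v = foldr \<sigma> w' v \<longleftrightarrow> foldr \<sigma>' w v' = foldr \<sigma>' w' v'"
    and "\<And>s w w'. w \<in> W \<Longrightarrow> w' \<in> W \<Longrightarrow>
      \<sigma> s (foldr \<sigma> w v) = foldr \<sigma> w' v \<longleftrightarrow> \<sigma>' s (foldr \<sigma>' w v') = foldr \<sigma>' w' v'"
    and "[] \<in> W"
  obtains f where "bij_betw f ((\<lambda>w. foldr \<sigma> w v) ` W) ((\<lambda>w. foldr \<sigma>' w v') ` W)" "f v = v'"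
    "\<And>s p q. p \<in> (\<lambda>w. foldr \<sigma> w v) ` W \<Longrightarrow> q \<in> (\<lambda>w. foldr \<sigma> w v) ` W \<Longrightarrow> \<sigma> s p = q \<longleftrightarrow> \<sigma>' s (f p) = f q"
proof -
  define f where "f p = foldr \<sigma>' (SOME w. w \<in> W \<and> p = foldr \<sigma> w v) v'" for p
  have f: "f (foldr \<sigma> w v) = foldr \<sigma>' w v'" if "w \<in> W" for w
  proof -
    let ?w = "SOME w'. w' \<in> W \<and> foldr \<sigma> w v = foldr \<sigma> w' v"
    have "?w \<in> W \<and> foldr \<sigma> w v = foldr \<sigma> ?w v" using that by (rule_tac someI) auto
    thus ?thesis using assms(1) that unfolding f_def by metis
  qed
  show thesis
  proof (rule that)
    show "bij_betw f ((\<lambda>w. foldr \<sigma> w v) ` W) ((\<lambda>w. foldr \<sigma>' w v') ` W)"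
      unfolding bij_betw_def inj_on_def by (auto simp: f assms(1) image_iff)
    show "f v = v'" using f[OF assms(3)] by simp
  qed (auto simp: f assms(2))
qed

text \<open>An edge labelled \<open>s\<close> from the endpoint of \<open>w\<close> to that of
  \<open>w'\<close> means that \<open>rev w' @ s # w\<close> fixes the root; for words of length at
  most \<open>r\<close> this explains the bound \<open>2 * r + 1\<close>.\<close>

lemma graph_iso_gball_action_graph:
  assumes "involutive \<sigma>" "involutive \<sigma>'"
    and "\<And>w. length w \<le> 2 * r + 1 \<Longrightarrow> w \<in> stab \<sigma> v \<longleftrightarrow> w \<in> stab \<sigma>' v'"
  shows "graph_iso (gball r (action_graph \<sigma> v)) (gball r (action_graph \<sigma>' v'))"
proof -
  let ?W = "{w :: gen list. length w \<le> r}"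
  have eq: "foldr \<sigma> w v = foldr \<sigma> w' v \<longleftrightarrow> foldr \<sigma>' w v' = foldr \<sigma>' w' v'"
    if "length w + length w' \<le> 2 * r + 1" for w w'
    using assms that by (simp add: foldr_eq_iff_stab)
  obtain f where f: "bij_betw f ((\<lambda>w. foldr \<sigma> w v) ` ?W) ((\<lambda>w. foldr \<sigma>' w v') ` ?W)" "f v = v'"
    "\<And>s p q. p \<in> (\<lambda>w. foldr \<sigma> w v) ` ?W \<Longrightarrow> q \<in> (\<lambda>w. foldr \<sigma> w v) ` ?W \<Longrightarrow> \<sigma> s p = q \<longleftrightarrow> \<sigma>' s (f p) = f q"
  proof (rule word_map[of ?W \<sigma> v \<sigma>' v'])
    show "\<sigma> s (foldr \<sigma> w v) = foldr \<sigma> w' v \<longleftrightarrow> \<sigma>' s (foldr \<sigma>' w v') = foldr \<sigma>' w' v'"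
      if "w \<in> ?W" "w' \<in> ?W" for s w w'
      using that eq[of "s # w" w'] by simp
  qed (use eq in auto)
  have V: "gball_verts r (action_graph \<sigma> v) = (\<lambda>w. foldr \<sigma> w v) ` ?W"
    "gball_verts r (action_graph \<sigma>' v') = (\<lambda>w. foldr \<sigma>' w v') ` ?W"
    by (auto simp: gball_verts_action_graph)
  have "f p \<in> (\<lambda>w. foldr \<sigma>' w v') ` ?W" if "p \<in> (\<lambda>w. foldr \<sigma> w v) ` ?W" for p
    using that f(1) by (rule bij_betw_apply[rotated])
  moreover have "(\<lambda>w. foldr \<sigma> w v) ` ?W \<subseteq> orb \<sigma> v" "(\<lambda>w. foldr \<sigma>' w v') ` ?W \<subseteq> orb \<sigma>' v'"
    by auto
  ultimately show ?thesis unfolding graph_iso_def gball_simps action_graph_simps V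
    using f by (intro exI[of _ f]) (auto simp: subset_iff)
qed

lemma graph_iso_action_graph:
  assumes "involutive \<sigma>" "involutive \<sigma>'" "stab \<sigma> v = stab \<sigma>' v'"
  shows "graph_iso (action_graph \<sigma> v) (action_graph \<sigma>' v')"
proof -
  have eq: "foldr \<sigma> w v = foldr \<sigma> w' v \<longleftrightarrow> foldr \<sigma>' w v' = foldr \<sigma>' w' v'" for w w'
    using assms by (simp add: foldr_eq_iff_stab)
  obtain f where f: "bij_betw f (orb \<sigma> v) (orb \<sigma>' v')" "f v = v'"
    "\<And>s p q. p \<in> orb \<sigma> v \<Longrightarrow> q \<in> orb \<sigma> v \<Longrightarrow> \<sigma> s p = q \<longleftrightarrow> \<sigma>' s (f p) = f q"
    unfolding orb_def
  proof (rule word_map[of UNIV \<sigma> v \<sigma>' v'])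
    show "\<sigma> s (foldr \<sigma> w v) = foldr \<sigma> w' v \<longleftrightarrow> \<sigma>' s (foldr \<sigma>' w v') = foldr \<sigma>' w' v'" for s w w'
      using eq[of "s # w" w'] by simp
  qed (use eq in auto)
  have "f p \<in> orb \<sigma>' v'" if "p \<in> orb \<sigma> v" for p
    using that f(1) by (rule bij_betw_apply[rotated])
  thus ?thesis unfolding graph_iso_def action_graph_simps using f
    by (intro exI[of _ f]) auto
qed

text \<open>An isomorphism has to follow a word letter by letter, and the vertices met lie in the
  ball as long as the word has length at most \<open>r\<close>.\<close>

lemma gball_iso_stab:
  assumes "involutive \<sigma>" "involutive \<sigma>'"
    and "graph_iso (gball r (action_graph \<sigma> v)) (gball r (action_graph \<sigma>' v'))"
    and "length w \<le> r"
  shows "w \<in> stab \<sigma> v \<longleftrightarrow> w \<in> stab \<sigma>' v'"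
proof -
  let ?B = "gball_verts r (action_graph \<sigma> v)" and ?B' = "gball_verts r (action_graph \<sigma>' v')"
  obtain f where f: "bij_betw f ?B ?B'" "f v = v'"
    "\<And>s p q. p \<in> ?B \<Longrightarrow> q \<in> ?B \<Longrightarrow> gmult (gball r (action_graph \<sigma> v)) s p q
        = gmult (gball r (action_graph \<sigma>' v')) s (f p) (f q)"
    using assms(3) unfolding graph_iso_def by auto
  have B: "foldr \<sigma> w v \<in> ?B" if "length w \<le> r" for w
    using that by (auto simp: gball_verts_action_graph)
  have "f (foldr \<sigma> w v) = foldr \<sigma>' w v'" if "length w \<le> r" for w
    using that
  proof (induction w)
    case (Cons s w)
    have "gmult (gball r (action_graph \<sigma>' v')) s (f (foldr \<sigma> w v)) (f (foldr \<sigma> (s # w) v)) = 1"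
      using f(3)[of "foldr \<sigma> w v" "foldr \<sigma> (s # w) v" s] B[of w] B[of "s # w"] Cons.prems
        orb_foldr[of \<sigma> "s # w" v] by simp
    thus ?case using Cons by (simp split: if_splits del: One_nat_def)
  qed (use f in simp)
  moreover have "foldr \<sigma> w v = v \<longleftrightarrow> f (foldr \<sigma> w v) = f v"
    using f(1) B[OF assms(4)] B[of "[]"] unfolding bij_betw_def by (auto dest: inj_onD)
  ultimately show ?thesis using assms(4) f(2) by (simp add: stab_def)
qed

lemma rooted_graphD:
  assumes "rooted_graph \<Gamma>"
  shows "groot \<Gamma> \<in> gverts \<Gamma>" "gadj \<Gamma> \<subseteq> gverts \<Gamma> \<times> gverts \<Gamma>"
    "gmult \<Gamma> s u v = gmult \<Gamma> s v u" "u \<in> gverts \<Gamma> \<Longrightarrow> v \<in> gverts \<Gamma> \<Longrightarrow> (u, v) \<in> (gadj \<Gamma>)\<^sup>*"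
    "gmult \<Gamma> s u v > 0 \<Longrightarrow> u \<in> gverts \<Gamma>" "gmult \<Gamma> s u v > 0 \<Longrightarrow> v \<in> gverts \<Gamma>"
  using assms unfolding rooted_graph_def gadj_def by blast+

text \<open>A labelled path from the root has a determined image, because the labels act as
  functions on the right; so the isomorphisms given for different radii agree where both are
  defined, and they glue.\<close>

lemma graph_iso_action_graph_limit:
  assumes "rooted_graph \<Gamma>" "involutive \<sigma>"
    and iso: "\<And>r. graph_iso (gball r \<Gamma>) (gball r (action_graph \<sigma> v))"
  shows "graph_iso \<Gamma> (action_graph \<sigma> v)"
proof -
  let ?B = "\<lambda>r. gball_verts r \<Gamma>" and ?B' = "\<lambda>r. gball_verts r (action_graph \<sigma> v)"
  have "\<forall>r. \<exists>f. bij_betw f (?B r) (?B' r) \<and> f (groot \<Gamma>) = v \<and> (\<forall>s. \<forall>p\<in>?B r. \<forall>q\<in>?B r.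
     gmult (gball r \<Gamma>) s p q = gmult (gball r (action_graph \<sigma> v)) s (f p) (f q))"
    using iso unfolding graph_iso_def by auto
  from choice[OF this] obtain f where f: "\<And>r. bij_betw (f r) (?B r) (?B' r)" "\<And>r. f r (groot \<Gamma>) = v"
    "\<And>r s p q. p \<in> ?B r \<Longrightarrow> q \<in> ?B r \<Longrightarrow>
       gmult (gball r \<Gamma>) s p q = gmult (gball r (action_graph \<sigma> v)) s (f r p) (f r q)"
    by blast
  let ?D = "\<lambda>u k. u \<in> gverts \<Gamma> \<and> (groot \<Gamma>, u) \<in> gadj \<Gamma> ^^ k"
  have B: "u \<in> ?B r" if "?D u k" "k \<le> r" for u k r using that by (auto simp: gball_verts_def)
  have B': "f r u \<in> ?B' r" if "u \<in> ?B r" for u r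
    using that f(1) by (rule bij_betw_apply[rotated])
  have gm: "gmult \<Gamma> s p q = of_bool (\<sigma> s (f r p) = f r q)" if "p \<in> ?B r" "q \<in> ?B r" for p q r s
    using f(3)[OF that, of s] B'[OF that(1)] B'[OF that(2)] that
    by (auto simp: gball_verts_def split: if_splits)
  have agree: "f r u = f r' u" if "?D u k" "k \<le> r" "k \<le> r'" for u k r r'
    using that
  proof (induction k arbitrary: u)
    case (Suc k)
    then obtain p s where p: "(groot \<Gamma>, p) \<in> gadj \<Gamma> ^^ k" "gmult \<Gamma> s p u > 0"
      by (auto simp: gadj_def)
    have "?D p k" using p rooted_graphD[OF assms(1)] by blast
    hence "\<sigma> s (f r'' p) = f r'' u" if "k < r''" for r''
      using that p(2) gm[of p r'' u s] B[of p k r''] B[of u "Suc k" r''] Suc.prems by (auto split: if_splits)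
    thus ?case using Suc.IH[of p] \<open>?D p k\<close> Suc.prems by (metis Suc_le_eq less_imp_le)
  qed (use f(2) in simp)
  \<comment> \<open>The length of some path to \<open>u\<close>, not necessarily the distance; by
    \<open>agree\<close> every such length leads to the same value.\<close>
  define d where "d u = (SOME k. ?D u k)" for u
  have d: "?D u (d u)" if "u \<in> gverts \<Gamma>" for u
  proof -
    have "\<exists>k. ?D u k"
      using that rooted_graphD(4)[OF assms(1) rooted_graphD(1)[OF assms(1)] that] by (auto simp: rtrancl_power)
    thus ?thesis unfolding d_def by (rule someI_ex)
  qed
  define F where "F u = f (d u) u" for u
  have F: "F u = f r u" "u \<in> ?B r" if "u \<in> gverts \<Gamma>" "d u \<le> r" for u r
    unfolding F_def using agree[OF d[OF that(1)] order_refl that(2)] B[OF d[OF that(1)] that(2)] .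
  have F': "F u = f k u" if "?D u k" for u k
    using F(1)[of u "max k (d u)"] agree[OF that order_refl, of "max k (d u)"] that by simp
  have "bij_betw F (gverts \<Gamma>) (orb \<sigma> v)"
    unfolding bij_betw_def
  proof
    show "inj_on F (gverts \<Gamma>)"
    proof (rule inj_onI)
      fix p q assume pq: "p \<in> gverts \<Gamma>" "q \<in> gverts \<Gamma>" "F p = F q"
      let ?r = "max (d p) (d q)"
      have "f ?r p = f ?r q" "p \<in> ?B ?r" "q \<in> ?B ?r" using pq F[of p ?r] F[of q ?r] by auto
      thus "p = q" using f(1)[of ?r] by (auto simp: bij_betw_def inj_on_def)
    qed
    show "F ` gverts \<Gamma> = orb \<sigma> v"
    proof
      show "F ` gverts \<Gamma> \<subseteq> orb \<sigma> v"
        using F(2) B' by (fastforce simp: F_def gball_verts_def)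
      show "orb \<sigma> v \<subseteq> F ` gverts \<Gamma>"
      proof
        fix y assume "y \<in> orb \<sigma> v"
        then obtain w where "y = foldr \<sigma> w v" by (rule orbE)
        hence "y \<in> ?B' (length w)" by (auto simp: gball_verts_action_graph)
        then obtain u where u: "u \<in> ?B (length w)" "y = f (length w) u"
          using f(1)[of "length w"] by (auto simp: bij_betw_def)
        then obtain k where k: "?D u k" "k \<le> length w" by (auto simp: gball_verts_def)
        have "F u = y" using F'[OF k(1)] agree[OF k(1) order_refl k(2)] u(2) by simp
        thus "y \<in> F ` gverts \<Gamma>" using k by auto
      qed
    qed
  qed
  moreover have "F (groot \<Gamma>) = v" by (simp add: F_def f(2))
  moreover have "gmult \<Gamma> s p q = gmult (action_graph \<sigma> v) s (F p) (F q)"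
    if "p \<in> gverts \<Gamma>" "q \<in> gverts \<Gamma>" for s p q
  proof -
    let ?r = "max (d p) (d q)"
    have "F p = f ?r p" "p \<in> ?B ?r" "F q = f ?r q" "q \<in> ?B ?r"
      using F[of p ?r] F[of q ?r] that by auto
    thus ?thesis using gm[of p ?r q s] B'[of p ?r] B'[of q ?r] by (auto simp: gball_verts_def)
  qed
  ultimately show ?thesis unfolding graph_iso_def by auto
qed

section \<open>Isomorphism classes of graphs of involutions\<close>

instance gen :: countable by countable_datatype

text \<open>\<open>iso_class\<close> admits only graphs on natural numbers, so its being nonempty
  requires a copy of the orbit there; one exists since there are only countably many words.\<close>

lemma nat_action:
  fixes \<sigma> :: "gen \<Rightarrow> 'v \<Rightarrow> 'v"
  assumes "involutive \<sigma>"
  obtains \<sigma>' :: "gen \<Rightarrow> nat \<Rightarrow> nat" and v' where "involutive \<sigma>'" "stab \<sigma>' v' = stab \<sigma> v"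
proof -
  have "countable (orb \<sigma> v)" by (simp add: orb_def)
  define f where "f = to_nat_on (orb \<sigma> v)"
  have inj: "inj_on f (orb \<sigma> v)" unfolding f_def by (rule inj_on_to_nat_on) fact
  \<comment> \<open>Fixing all numbers outside the copy keeps \<open>\<sigma>'\<close> an involution
    everywhere.\<close>
  define \<sigma>' where "\<sigma>' s n = (if n \<in> f ` orb \<sigma> v then f (\<sigma> s (inv_into (orb \<sigma> v) f n)) else n)" for s n
  have step: "\<sigma>' s (f u) = f (\<sigma> s u)" if "u \<in> orb \<sigma> v" for s u
    using that inj by (simp add: \<sigma>'_def)
  have "\<sigma>' s (\<sigma>' s n) = n" for s n
  proof (cases "n \<in> f ` orb \<sigma> v")
    case True
    thus ?thesis using assms by (auto simp: step)
  qed (simp add: \<sigma>'_def)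
  moreover have "foldr \<sigma>' w (f v) = f (foldr \<sigma> w v)" for w
    by (induction w) (simp_all add: step)
  hence "stab \<sigma>' (f v) = stab \<sigma> v"
    using inj by (auto simp: stab_def dest: inj_onD)
  ultimately show thesis by (intro that) (auto simp: involutive_def)
qed

definition cls :: "(gen \<Rightarrow> 'v \<Rightarrow> 'v) \<Rightarrow> 'v \<Rightarrow> gclass" where
  "cls \<sigma> v = iso_class (action_graph \<sigma> v)"

lemma cls_eqI:
  "involutive \<sigma> \<Longrightarrow> involutive \<sigma>' \<Longrightarrow> stab \<sigma> v = stab \<sigma>' v' \<Longrightarrow> cls \<sigma> v = cls \<sigma>' v'"
  unfolding cls_def by (intro iso_class_eqI graph_iso_action_graph) auto

lemma iso_class_self: "rooted_graph \<Gamma> \<Longrightarrow> \<Gamma> \<in> iso_class \<Gamma>"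
  by (simp add: iso_class_def graph_iso_refl)

lemma cls_nat:
  fixes \<sigma> :: "gen \<Rightarrow> 'v \<Rightarrow> 'v"
  assumes "involutive \<sigma>"
  obtains \<Gamma> :: "nat rgraph" where "rooted_graph \<Gamma>" "cls \<sigma> v = iso_class \<Gamma>" "\<Gamma> \<in> cls \<sigma> v"
proof -
  obtain \<sigma>' :: "gen \<Rightarrow> nat \<Rightarrow> nat" and v' where \<sigma>': "involutive \<sigma>'" "stab \<sigma>' v' = stab \<sigma> v"
    using nat_action[OF assms] .
  have "rooted_graph (action_graph \<sigma>' v')" using \<sigma>'(1) by (rule rooted_action_graph)
  moreover have "cls \<sigma> v = cls \<sigma>' v'" using assms \<sigma>' by (intro cls_eqI) auto
  ultimately show thesis by (intro that[of "action_graph \<sigma>' v'"]) (auto simp: cls_def iso_class_self)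
qed

lemma cls_G_star: "involutive \<sigma> \<Longrightarrow> cls \<sigma> v \<in> G_star"
  using cls_nat[of \<sigma> v] unfolding G_star_def by (metis (mono_tags, lifting) mem_Collect_eq)

lemma gball_iso_class:
  assumes "\<Gamma> \<in> iso_class \<Delta>" "rooted_graph \<Delta>"
  shows "graph_iso (gball r \<Gamma>) (gball r \<Delta>)"
  using assms unfolding iso_class_def by (auto intro!: graph_iso_gball dest: rooted_graphD(1,2))

lemma groot_gball: "rooted_graph \<Gamma> \<Longrightarrow> groot (gball r \<Gamma>) \<in> gverts (gball r \<Gamma>)"
  using rooted_graphD(1)[of \<Gamma>] by (auto simp: gball_verts_def intro!: exI[of _ 0])

lemma same_ball_iff:
  assumes "rooted_graph \<Gamma>" "rooted_graph \<Delta>" "iso_class \<Gamma> \<noteq> {}" "iso_class \<Delta> \<noteq> {}"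
  shows "same_ball r (iso_class \<Gamma>) (iso_class \<Delta>) \<longleftrightarrow> graph_iso (gball r \<Gamma>) (gball r \<Delta>)"
proof
  assume "same_ball r (iso_class \<Gamma>) (iso_class \<Delta>)"
  then obtain \<Gamma>' \<Delta>' where *: "\<Gamma>' \<in> iso_class \<Gamma>" "\<Delta>' \<in> iso_class \<Delta>" "graph_iso (gball r \<Gamma>') (gball r \<Delta>')"
    unfolding same_ball_def by blast
  have "rooted_graph \<Gamma>'" using *(1) by (simp add: iso_class_def)
  hence "graph_iso (gball r \<Gamma>) (gball r \<Gamma>')"
    by (intro graph_iso_sym[OF gball_iso_class[OF *(1) assms(1)]] groot_gball)
  thus "graph_iso (gball r \<Gamma>) (gball r \<Delta>)"
    by (rule graph_iso_trans[OF _ graph_iso_trans[OF *(3) gball_iso_class[OF *(2) assms(2)]]])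
next
  assume *: "graph_iso (gball r \<Gamma>) (gball r \<Delta>)"
  obtain \<Gamma>' \<Delta>' where **: "\<Gamma>' \<in> iso_class \<Gamma>" "\<Delta>' \<in> iso_class \<Delta>" using assms(3,4) by blast
  have "rooted_graph \<Delta>'" using **(2) by (simp add: iso_class_def)
  hence "graph_iso (gball r \<Delta>) (gball r \<Delta>')"
    by (intro graph_iso_sym[OF gball_iso_class[OF **(2) assms(2)]] groot_gball)
  hence "graph_iso (gball r \<Gamma>') (gball r \<Delta>')"
    by (rule graph_iso_trans[OF graph_iso_trans[OF gball_iso_class[OF **(1) assms(1)] *]])
  thus "same_ball r (iso_class \<Gamma>) (iso_class \<Delta>)" unfolding same_ball_def using ** by blast
qed

lemma same_ball_cls_iff:
  assumes "involutive \<sigma>" "involutive \<sigma>'"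
  shows "same_ball r (cls \<sigma> v) (cls \<sigma>' v') \<longleftrightarrow>
    graph_iso (gball r (action_graph \<sigma> v)) (gball r (action_graph \<sigma>' v'))"
proof -
  have "cls \<sigma> v \<noteq> {}" using cls_nat[OF assms(1)] by blast
  moreover have "cls \<sigma>' v' \<noteq> {}" using cls_nat[OF assms(2)] by blast
  ultimately show ?thesis unfolding cls_def
    by (intro same_ball_iff rooted_action_graph assms) auto
qed

lemma same_ball_clsI:
  "involutive \<sigma> \<Longrightarrow> involutive \<sigma>' \<Longrightarrow>
   (\<And>w. length w \<le> 2 * r + 1 \<Longrightarrow> w \<in> stab \<sigma> v \<longleftrightarrow> w \<in> stab \<sigma>' v') \<Longrightarrow> same_ball r (cls \<sigma> v) (cls \<sigma>' v')"
  by (simp add: same_ball_cls_iff graph_iso_gball_action_graph)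

lemma same_ball_clsD:
  "involutive \<sigma> \<Longrightarrow> involutive \<sigma>' \<Longrightarrow> same_ball r (cls \<sigma> v) (cls \<sigma>' v') \<Longrightarrow> length w \<le> r \<Longrightarrow>
   w \<in> stab \<sigma> v \<longleftrightarrow> w \<in> stab \<sigma>' v'"
  by (auto simp: same_ball_cls_iff dest: gball_iso_stab)

text \<open>Equal classes have equal balls of every radius, and these decide every word. Equality of
  graphs on unrelated vertex types thereby becomes equality of two sets of words.\<close>

lemma cls_eq_iff:
  assumes "involutive \<sigma>" "involutive \<sigma>'"
  shows "cls \<sigma> v = cls \<sigma>' v' \<longleftrightarrow> stab \<sigma> v = stab \<sigma>' v'"
proof
  assume "cls \<sigma> v = cls \<sigma>' v'"
  hence "same_ball r (cls \<sigma> v) (cls \<sigma>' v')" for r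
    using assms(2) by (auto intro: same_ball_clsI)
  thus "stab \<sigma> v = stab \<sigma>' v'" using assms by (auto dest: same_ball_clsD)
qed (rule cls_eqI[OF assms])

section \<open>The topology of local convergence\<close>

lemma G_starE:
  assumes "p \<in> G_star"
  obtains \<Gamma> :: "nat rgraph" where "p = iso_class \<Gamma>" "rooted_graph \<Gamma>" "iso_class \<Gamma> \<noteq> {}"
proof -
  obtain \<Gamma> :: "nat rgraph" where "p = iso_class \<Gamma>" "rooted_graph \<Gamma>" using assms unfolding G_star_def by blast
  moreover from this have "iso_class \<Gamma> \<noteq> {}" using iso_class_self[of \<Gamma>] by blast
  ultimately show thesis by (rule that)
qed

lemma same_ball_refl: "p \<in> G_star \<Longrightarrow> same_ball r p p"
  by (erule G_starE) (simp add: same_ball_iff graph_iso_refl)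

lemma same_ball_trans:
  assumes "p \<in> G_star" "q \<in> G_star" "t \<in> G_star" "same_ball r p q" "same_ball r q t"
  shows "same_ball r p t"
proof -
  obtain \<Gamma> :: "nat rgraph" where \<Gamma>: "p = iso_class \<Gamma>" "rooted_graph \<Gamma>" "iso_class \<Gamma> \<noteq> {}" using assms(1) by (rule G_starE)
  obtain \<Delta> :: "nat rgraph" where \<Delta>: "q = iso_class \<Delta>" "rooted_graph \<Delta>" "iso_class \<Delta> \<noteq> {}" using assms(2) by (rule G_starE)
  obtain \<Theta> :: "nat rgraph" where \<Theta>: "t = iso_class \<Theta>" "rooted_graph \<Theta>" "iso_class \<Theta> \<noteq> {}" using assms(3) by (rule G_starE)
  have "graph_iso (gball r \<Gamma>) (gball r \<Delta>)" "graph_iso (gball r \<Delta>) (gball r \<Theta>)"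
    using assms(4,5) \<Gamma> \<Delta> \<Theta> by (simp_all add: same_ball_iff)
  hence "graph_iso (gball r \<Gamma>) (gball r \<Theta>)" by (rule graph_iso_trans)
  thus ?thesis using \<Gamma> \<Theta> by (simp add: same_ball_iff)
qed

lemma same_ball_mono:
  assumes "p \<in> G_star" "q \<in> G_star" "same_ball r' p q" "r \<le> r'"
  shows "same_ball r p q"
proof -
  obtain \<Gamma> :: "nat rgraph" where \<Gamma>: "p = iso_class \<Gamma>" "rooted_graph \<Gamma>" "iso_class \<Gamma> \<noteq> {}" using assms(1) by (rule G_starE)
  obtain \<Delta> :: "nat rgraph" where \<Delta>: "q = iso_class \<Delta>" "rooted_graph \<Delta>" "iso_class \<Delta> \<noteq> {}" using assms(2) by (rule G_starE)
  have adj: "gadj (gball r' \<Theta>) \<subseteq> gverts (gball r' \<Theta>) \<times> gverts (gball r' \<Theta>)" for \<Theta> :: "nat rgraph"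
    by (auto simp: gadj_def split: if_splits)
  have "graph_iso (gball r' \<Gamma>) (gball r' \<Delta>)" using assms(3) \<Gamma> \<Delta> by (simp add: same_ball_iff)
  hence "graph_iso (gball r (gball r' \<Gamma>)) (gball r (gball r' \<Delta>))"
    by (rule graph_iso_gball[OF _ groot_gball[OF \<Gamma>(2)] adj adj])
  thus ?thesis using assms(4) \<Gamma> \<Delta> by (simp add: same_ball_iff gball_gball rooted_graphD(1,2))
qed

lemma topspace_G_star [simp]: "topspace G_star_top = G_star"
  unfolding G_star_top_def topology_generated_by_topspace using same_ball_refl by blast

lemma openin_same_ball: "p \<in> G_star \<Longrightarrow> openin G_star_top {q \<in> G_star. same_ball r p q}"
  unfolding G_star_top_def by (rule topology_generated_by_Basis) blast

text \<open>\<open>same_ball r\<close> is an equivalence relation on \<open>G_star\<close> that gets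
  finer with \<open>r\<close>; so each generating set is a ball about each of its members, and
  intersections of two balls contain a smaller one.\<close>

lemma openin_G_star_iff:
  "openin G_star_top U \<longleftrightarrow> U \<subseteq> G_star \<and> (\<forall>p\<in>U. \<exists>r. \<forall>q\<in>G_star. same_ball r p q \<longrightarrow> q \<in> U)"
proof
  assume U: "openin G_star_top U"
  have "U \<subseteq> G_star" using openin_subset[OF U] by simp
  moreover have "\<forall>p\<in>U. p \<in> G_star \<longrightarrow> (\<exists>r. \<forall>q\<in>G_star. same_ball r p q \<longrightarrow> q \<in> U)"
    using U[unfolded G_star_top_def openin_topology_generated_by_iff]
  proof (induction rule: generate_topology_on.induct)
    case (Int a b)
    show ?case
    proof (intro ballI impI)
      fix p assume p: "p \<in> a \<inter> b" "p \<in> G_star"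
      obtain r r' where "\<forall>q\<in>G_star. same_ball r p q \<longrightarrow> q \<in> a" "\<forall>q\<in>G_star. same_ball r' p q \<longrightarrow> q \<in> b"
        using Int.IH p by blast
      thus "\<exists>r. \<forall>q\<in>G_star. same_ball r p q \<longrightarrow> q \<in> a \<inter> b"
        using same_ball_mono[OF p(2)] by (intro exI[of _ "max r r'"]) (meson IntI max.cobounded1 max.cobounded2)
    qed
  next
    case (UN K)
    thus ?case by (meson UnionE UnionI)
  next
    case (Basis b)
    thus ?case using same_ball_trans by blast
  qed simp
  ultimately show "U \<subseteq> G_star \<and> (\<forall>p\<in>U. \<exists>r. \<forall>q\<in>G_star. same_ball r p q \<longrightarrow> q \<in> U)" by blast
next
  assume U: "U \<subseteq> G_star \<and> (\<forall>p\<in>U. \<exists>r. \<forall>q\<in>G_star. same_ball r p q \<longrightarrow> q \<in> U)"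
  hence "\<forall>p\<in>U. \<exists>r. p \<in> G_star \<and> {q \<in> G_star. same_ball r p q} \<subseteq> U" by blast
  then obtain r where r: "\<And>p. p \<in> U \<Longrightarrow> p \<in> G_star \<and> {q \<in> G_star. same_ball (r p) p q} \<subseteq> U"
    by metis
  have "U = (\<Union>p\<in>U. {q \<in> G_star. same_ball (r p) p q})"
    using r same_ball_refl by fastforce
  moreover have "openin G_star_top (\<Union>p\<in>U. {q \<in> G_star. same_ball (r p) p q})"
    using r openin_same_ball by (intro openin_Union) blast
  ultimately show "openin G_star_top U" by simp
qed

lemma in_closure_G_star_iff:
  assumes "S \<subseteq> G_star"
  shows "p \<in> G_star_top closure_of S \<longleftrightarrow> p \<in> G_star \<and> (\<forall>r. \<exists>q\<in>S. same_ball r p q)"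
proof
  assume p: "p \<in> G_star_top closure_of S"
  hence pG: "p \<in> G_star" and T: "\<And>T. p \<in> T \<Longrightarrow> openin G_star_top T \<Longrightarrow> \<exists>y. y \<in> S \<and> y \<in> T"
    by (auto simp: in_closure_of)
  show "p \<in> G_star \<and> (\<forall>r. \<exists>q\<in>S. same_ball r p q)"
    using T[OF _ openin_same_ball[OF pG]] pG same_ball_refl[OF pG] by auto
next
  assume p: "p \<in> G_star \<and> (\<forall>r. \<exists>q\<in>S. same_ball r p q)"
  show "p \<in> G_star_top closure_of S"
    unfolding in_closure_of topspace_G_star
  proof (intro conjI allI impI)
    fix T assume "p \<in> T \<and> openin G_star_top T"
    then obtain r where "\<forall>q\<in>G_star. same_ball r p q \<longrightarrow> q \<in> T" unfolding openin_G_star_iff by blast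
    moreover obtain q where "q \<in> S" "same_ball r p q" using p by blast
    ultimately show "\<exists>y. y \<in> S \<and> y \<in> T" using assms by blast
  qed (use p in simp)
qed

text \<open>Identifies a limit point of which nothing is known but its balls; in particular
  \<open>p\<close> need not be presented by involutions beforehand.\<close>

lemma eq_cls_if_same_balls:
  assumes "p \<in> G_star" "involutive \<sigma>" "\<And>r. same_ball r p (cls \<sigma> v)"
  shows "p = cls \<sigma> v"
proof -
  obtain \<Gamma> :: "nat rgraph" where \<Gamma>: "p = iso_class \<Gamma>" "rooted_graph \<Gamma>" "iso_class \<Gamma> \<noteq> {}" using assms(1) by (rule G_starE)
  have "cls \<sigma> v \<noteq> {}" using cls_nat[OF assms(2)] by blast
  hence "graph_iso (gball r \<Gamma>) (gball r (action_graph \<sigma> v))" for r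
    using assms(3)[of r] \<Gamma> assms(2) unfolding cls_def by (simp add: same_ball_iff rooted_action_graph)
  hence "graph_iso \<Gamma> (action_graph \<sigma> v)" using \<Gamma>(2) assms(2) by (rule_tac graph_iso_action_graph_limit)
  thus ?thesis unfolding \<Gamma>(1) cls_def using rooted_graphD(1)[OF \<Gamma>(2)] by (rule iso_class_eqI)
qed

lemma orb_root_step: "involutive \<sigma> \<Longrightarrow> orb \<sigma> (\<sigma> s v) = orb \<sigma> v"
proof -
  assume inv: "involutive \<sigma>"
  have *: "orb \<sigma> (\<sigma> s u) \<subseteq> orb \<sigma> u" for u
  proof
    fix x assume "x \<in> orb \<sigma> (\<sigma> s u)"
    then obtain w where "x = foldr \<sigma> (w @ [s]) u" by (auto elim: orbE)
    thus "x \<in> orb \<sigma> u" by (simp only: orb_foldr)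
  qed
  show ?thesis using *[of v] *[of "\<sigma> s v"] inv by auto
qed

text \<open>On representatives, moving the root along \<open>s\<close> is well defined because
  exactly one edge labelled \<open>s\<close> leaves the root. Doing it twice gives the graph back,
  which makes the image the whole class.\<close>

lemma reroot_cls:
  assumes "involutive \<sigma>"
  shows "reroot s (cls \<sigma> v) = cls \<sigma> (\<sigma> s v)"
proof -
  define rr where "rr \<Gamma> = \<Gamma>\<lparr>groot := (THE w. gmult \<Gamma> s (groot \<Gamma>) w > 0)\<rparr>" for \<Gamma> :: "nat rgraph"
  have rr: "rr \<Gamma> \<in> cls \<sigma> (\<sigma> s v) \<and> rr (rr \<Gamma>) = \<Gamma>" if "\<Gamma> \<in> cls \<sigma> v" for \<Gamma> v
  proof -
    have \<Gamma>: "rooted_graph \<Gamma>" "graph_iso \<Gamma> (action_graph \<sigma> v)"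
      using that by (auto simp: cls_def iso_class_def)
    obtain f where f: "bij_betw f (gverts \<Gamma>) (orb \<sigma> v)" "f (groot \<Gamma>) = v"
      "\<And>s p q. p \<in> gverts \<Gamma> \<Longrightarrow> q \<in> gverts \<Gamma> \<Longrightarrow> gmult \<Gamma> s p q = gmult (action_graph \<sigma> v) s (f p) (f q)"
      using \<Gamma>(2) unfolding graph_iso_def by auto
    have fin: "f p \<in> orb \<sigma> v" if "p \<in> gverts \<Gamma>" for p using that f(1) by (rule bij_betw_apply[rotated])
    have gm: "gmult \<Gamma> s p q > 0 \<longleftrightarrow> p \<in> gverts \<Gamma> \<and> q \<in> gverts \<Gamma> \<and> \<sigma> s (f p) = f q" for p q
      using f(3)[of p q s] rooted_graphD(5,6)[OF \<Gamma>(1), of s p q] fin by auto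
    have root: "groot \<Gamma> \<in> gverts \<Gamma>" using \<Gamma>(1) by (rule rooted_graphD)
    obtain w where w: "w \<in> gverts \<Gamma>" "f w = \<sigma> s v"
      using f(1) orb_step[OF orb_self, of \<sigma> s v] by (metis bij_betw_imp_surj_on imageE)
    have uniq: "q = q'" if "q \<in> gverts \<Gamma>" "q' \<in> gverts \<Gamma>" "f q = f q'" for q q'
      using f(1) that by (auto simp: bij_betw_def inj_on_def)
    have "(THE w. gmult \<Gamma> s (groot \<Gamma>) w > 0) = w"
      by (rule the_equality) (use gm w f(2) root uniq in auto)
    hence rr1: "rr \<Gamma> = \<Gamma>\<lparr>groot := w\<rparr>" by (simp add: rr_def)
    have "(THE u. gmult \<Gamma> s w u > 0) = groot \<Gamma>"
      by (rule the_equality) (use gm w f(2) root uniq assms in auto)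
    hence "rr (rr \<Gamma>) = \<Gamma>" unfolding rr1 by (simp add: rr_def)
    moreover have "gadj (rr \<Gamma>) = gadj \<Gamma>" by (simp add: rr1 gadj_def)
    hence "rooted_graph (rr \<Gamma>)" using \<Gamma>(1) w(1) unfolding rooted_graph_def by (simp add: rr1)
    moreover have "graph_iso (rr \<Gamma>) (action_graph \<sigma> (\<sigma> s v))"
      unfolding graph_iso_def using f w assms by (intro exI[of _ f]) (auto simp: rr1 orb_root_step)
    ultimately show ?thesis by (simp add: cls_def iso_class_def)
  qed
  have "reroot s (cls \<sigma> v) = rr ` cls \<sigma> v" by (simp add: reroot_def rr_def[abs_def])
  also have "\<dots> = cls \<sigma> (\<sigma> s v)"
  proof
    show "rr ` cls \<sigma> v \<subseteq> cls \<sigma> (\<sigma> s v)" using rr by blast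
    show "cls \<sigma> (\<sigma> s v) \<subseteq> rr ` cls \<sigma> v"
    proof
      fix \<Gamma> assume "\<Gamma> \<in> cls \<sigma> (\<sigma> s v)"
      from rr[OF this] have "rr \<Gamma> \<in> cls \<sigma> v" "\<Gamma> = rr (rr \<Gamma>)" using assms by auto
      thus "\<Gamma> \<in> rr ` cls \<sigma> v" by (rule rev_image_eqI)
    qed
  qed
  finally show ?thesis .
qed


section \<open>Labelled lines\<close>

text \<open>The letter at \<open>n\<close> sits on the gap between the vertices \<open>n\<close> and
  \<open>n + 1\<close>, whence the two positions read at \<open>n\<close>; a label found at neither
  is a loop.\<close>

definition lstep :: "(int \<Rightarrow> letter option) \<Rightarrow> gen \<Rightarrow> int \<Rightarrow> int" where
  "lstep \<omega> s n = (if \<omega> n \<in> Some ` edge_letters s then n + 1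
     else if \<omega> (n - 1) \<in> Some ` edge_letters s then n - 1 else n)"

definition full :: "(int \<Rightarrow> letter) \<Rightarrow> int \<Rightarrow> letter option" where
  full_apply [simp]: "full \<omega> n = Some (\<omega> n)"

text \<open>What makes \<open>lstep\<close> an involution: the two letters meeting at a vertex never
  share a label. \<open>None\<close> counts as a letter other than \<open>La\<close>, so a cut has
  \<open>La\<close> on both sides.\<close>

definition alternating :: "(int \<Rightarrow> letter option) \<Rightarrow> bool" where
  "alternating \<omega> \<longleftrightarrow> (\<forall>n. \<omega> (n + 1) = Some La \<longleftrightarrow> \<omega> n \<noteq> Some La)"

lemma La_edge_letters [simp]: "La \<in> edge_letters s \<longleftrightarrow> s = Ga"
  by (cases s) auto

lemma edge_letters_not_both:
  assumes "l \<in> edge_letters s" "l' \<in> edge_letters s" shows "l = La \<longleftrightarrow> l' = La"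
  using assms by (cases s) auto

lemma lstep_excl:
  assumes "alternating \<omega>" "\<omega> n \<in> Some ` edge_letters s"
  shows "\<omega> (n + 1) \<notin> Some ` edge_letters s" "\<omega> (n - 1) \<notin> Some ` edge_letters s"
proof -
  have "\<omega> (n + 1) = Some La \<longleftrightarrow> \<omega> n \<noteq> Some La" "\<omega> n = Some La \<longleftrightarrow> \<omega> (n - 1) \<noteq> Some La"
    using assms(1) unfolding alternating_def by (simp, metis diff_add_cancel)
  thus "\<omega> (n + 1) \<notin> Some ` edge_letters s" "\<omega> (n - 1) \<notin> Some ` edge_letters s"
    using assms(2) edge_letters_not_both[of _ s] by auto
qed

lemma involutive_lstep: "alternating \<omega> \<Longrightarrow> involutive (lstep \<omega>)"
  unfolding involutive_def
proof (intro allI)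
  fix s n assume a: "alternating \<omega>"
  consider "\<omega> n \<in> Some ` edge_letters s" | "\<omega> n \<notin> Some ` edge_letters s" "\<omega> (n - 1) \<in> Some ` edge_letters s"
    | "\<omega> n \<notin> Some ` edge_letters s" "\<omega> (n - 1) \<notin> Some ` edge_letters s" by blast
  thus "lstep \<omega> s (lstep \<omega> s n) = n"
  proof cases
    case 1
    thus ?thesis using lstep_excl[OF a 1] by (simp add: lstep_def)
  qed (simp_all add: lstep_def)
qed

lemma lstep_translate: "lstep (\<lambda>i. \<omega> (i + c)) s n = lstep \<omega> s (n + c) - c"
  by (simp add: lstep_def algebra_simps)

lemma foldr_lstep_translate:
  "foldr (lstep (\<lambda>i. \<omega> (i + c))) w n = foldr (lstep \<omega>) w (n + c) - c"
  by (induction w) (simp_all add: lstep_translate)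

lemma stab_lstep_translate: "stab (lstep (\<lambda>i. \<omega> (i + c))) n = stab (lstep \<omega>) (n + c)"
  by (auto simp: stab_def foldr_lstep_translate)

text \<open>Letters belong to gaps, so reflecting positions by \<open>i \<mapsto> -i\<close>
  reflects vertices by \<open>n \<mapsto> 1 - n\<close>. Alternation matters because
  \<open>lstep\<close> tries the upward edge first.\<close>

lemma lstep_reflect: "alternating \<omega> \<Longrightarrow> lstep (\<lambda>i. \<omega> (- i)) s n = 1 - lstep \<omega> s (1 - n)"
  using lstep_excl(2)[of \<omega> "- n + 1" s] lstep_excl(1)[of \<omega> "- n" s] by (auto simp: lstep_def)

lemma foldr_lstep_reflect:
  "alternating \<omega> \<Longrightarrow> foldr (lstep (\<lambda>i. \<omega> (- i))) w n = 1 - foldr (lstep \<omega>) w (1 - n)"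
  by (induction w) (simp_all add: lstep_reflect)

lemma stab_lstep_reflect:
  "alternating \<omega> \<Longrightarrow> stab (lstep (\<lambda>i. \<omega> (- i))) n = stab (lstep \<omega>) (1 - n)"
  by (auto simp: stab_def foldr_lstep_reflect)

lemma foldr_lstep_dist: "\<bar>foldr (lstep \<omega>) w n - n\<bar> \<le> int (length w)"
  by (induction w) (auto simp: lstep_def)

lemma foldr_lstep_agree:
  assumes "agree N \<omega> \<omega>'" "\<bar>n\<bar> + int (length w) \<le> int N"
  shows "foldr (lstep \<omega>) w n = foldr (lstep \<omega>') w n"
  using assms(2)
proof (induction w)
  case (Cons s w)
  let ?p = "foldr (lstep \<omega>') w n"
  have IH: "foldr (lstep \<omega>) w n = ?p" using Cons by simp
  \<comment> \<open>One position is kept in reserve because a step down reads the letter at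
    \<open>?p - 1\<close>.\<close>
  have "\<bar>?p\<bar> \<le> int N - 1" using foldr_lstep_dist[of \<omega>' w n] Cons.prems by simp
  hence "\<omega> ?p = \<omega>' ?p" "\<omega> (?p - 1) = \<omega>' (?p - 1)" by (auto intro!: agreeD[OF assms(1)])
  thus ?case by (simp add: IH lstep_def[of _ s])
qed simp

lemma stab_lstep_agree:
  "agree N \<omega> \<omega>' \<Longrightarrow> length w < N \<Longrightarrow> w \<in> stab (lstep \<omega>) 1 \<longleftrightarrow> w \<in> stab (lstep \<omega>') 1"
  using foldr_lstep_agree[of N \<omega> \<omega>' 1 w] by (simp add: stab_def)

text \<open>Words of length up to \<open>2 * r + 1\<close> decide the ball, and the start at vertex
  1 instead of 0 costs one more position.\<close>

lemma same_ball_lstep_agree: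
  "alternating \<omega> \<Longrightarrow> alternating \<omega>' \<Longrightarrow> agree N \<omega> \<omega>' \<Longrightarrow> 2 * r + 1 < N \<Longrightarrow>
   same_ball r (cls (lstep \<omega>) 1) (cls (lstep \<omega>') 1)"
  by (intro same_ball_clsI involutive_lstep) (auto simp: stab_lstep_agree)

section \<open>The line of a point of the subshift\<close>

lemma alternating_Omega: "\<omega> \<in> Omega_tau \<Longrightarrow> alternating (full \<omega>)"
  by (simp add: alternating_def Omega_alternating)

lemma involutive_Omega [simp]: "\<omega> \<in> Omega_tau \<Longrightarrow> involutive (lstep (full \<omega>))"
  by (intro involutive_lstep alternating_Omega)

lemma edge_letters_exist: "\<exists>s. l \<in> edge_letters s"
  by (cases l) (auto intro: exI[of _ Ga] exI[of _ Gb] exI[of _ Gc])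

lemma orb_lstep_Omega: "\<omega> \<in> Omega_tau \<Longrightarrow> orb (lstep (full \<omega>)) 1 = UNIV"
proof -
  assume w: "\<omega> \<in> Omega_tau"
  define P where "P = orb (lstep (full \<omega>)) 1"
  have up: "n + 1 \<in> P \<longleftrightarrow> n \<in> P" for n
  proof -
    obtain s where "\<omega> n \<in> edge_letters s" using edge_letters_exist by blast
    hence "lstep (full \<omega>) s n = n + 1" by (simp add: lstep_def)
    thus ?thesis using orb_step_iff[OF involutive_Omega[OF w], of s n 1] by (simp add: P_def)
  qed
  have "1 \<in> P" by (simp add: P_def)
  have "n \<in> P" for n
  proof (induction n rule: int_induct[where k = 1])
    case (step2 i)
    thus ?case using up[of "i - 1"] by simp
  qed (simp_all add: up \<open>1 \<in> P\<close>)
  thus ?thesis unfolding P_def by blast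
qed

text \<open>Of the two letters meeting at a vertex exactly one is \<open>La\<close>; so each label
  leaves the vertex exactly once, and the four summands of the multiplicity add up to 0 or
  1.\<close>

lemma gr_eq_action_graph:
  assumes "\<omega> \<in> Omega_tau"
  shows "gr \<omega> = action_graph (lstep (full \<omega>)) 1"
proof -
  have "gmult (gr \<omega>) s m n = of_bool (lstep (full \<omega>) s m = n)" for s m n
  proof -
    have "\<omega> m = La \<longleftrightarrow> \<omega> (m - 1) \<noteq> La" using Omega_alternating[OF assms, of "m - 1"] by simp
    then obtain l where "l \<noteq> La" "\<omega> m = La \<and> \<omega> (m - 1) = l \<or> \<omega> m = l \<and> \<omega> (m - 1) = La" by blast
    thus ?thesis by (cases s; cases l) (auto simp: gr_def lstep_def)
  qed
  moreover have "gverts (gr \<omega>) = UNIV" "groot (gr \<omega>) = 1" by (simp_all add: gr_def)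
  ultimately show ?thesis
    by (intro rgraph.equality) (simp_all add: fun_eq_iff orb_lstep_Omega[OF assms])
qed

lemma Gr_eq_cls: "\<omega> \<in> Omega_tau \<Longrightarrow> Gr \<omega> = cls (lstep (full \<omega>)) 1"
  by (simp add: Gr_def cls_def gr_eq_action_graph)

lemma Omega_translate: "\<omega> \<in> Omega_tau \<Longrightarrow> (\<lambda>n. \<omega> (n + c)) \<in> Omega_tau"
proof -
  assume w: "\<omega> \<in> Omega_tau"
  have "(\<lambda>i. \<omega> (m + int i + c)) = (\<lambda>i. \<omega> (m + c + int i))" for m
    by (simp add: algebra_simps)
  thus ?thesis using w unfolding Omega_tau_def mem_Collect_eq by simp
qed

lemma H_gen_translate:
  assumes "\<omega> \<in> Omega_tau"
  shows "H_gen s \<omega> = (\<lambda>i. \<omega> (i + (lstep (full \<omega>) s 1 - 1)))"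
  using assms by (auto simp: H_gen_def flip_along_def lstep_def shift_def shift_inv_def fun_eq_iff)

lemma H_gen_Omega: "\<omega> \<in> Omega_tau \<Longrightarrow> H_gen s \<omega> \<in> Omega_tau"
  by (simp add: H_gen_translate Omega_translate)

text \<open>Acting by a word amounts to walking along the line of \<open>\<omega>\<close> from
  vertex 1 and then moving the origin by the displacement. Dynamics on points and root changes in
  graphs thus become the same walk.\<close>

lemma foldr_H_gen:
  assumes "\<omega> \<in> Omega_tau"
  shows "foldr H_gen w \<omega> = (\<lambda>i. \<omega> (i + (foldr (lstep (full \<omega>)) w 1 - 1)))"
proof (induction w)
  case (Cons s w)
  let ?d = "foldr (lstep (full \<omega>)) w 1 - 1"
  have eq: "full (\<lambda>i. \<omega> (i + ?d)) = (\<lambda>i. full \<omega> (i + ?d))" by (simp add: fun_eq_iff)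
  have "foldr H_gen (s # w) \<omega> = H_gen s (\<lambda>i. \<omega> (i + ?d))" by (simp only: foldr.simps o_apply Cons.IH)
  also have "\<dots> = (\<lambda>i. \<omega> (i + (lstep (\<lambda>i. (full \<omega>) (i + ?d)) s 1 - 1) + ?d))"
    unfolding H_gen_translate[OF Omega_translate[OF assms]] eq ..
  also have "\<dots> = (\<lambda>i. \<omega> (i + (foldr (lstep (full \<omega>)) (s # w) 1 - 1)))"
    unfolding lstep_translate by (simp add: algebra_simps)
  finally show ?case .
qed simp

lemma foldr_H_gen_Omega: "\<omega> \<in> Omega_tau \<Longrightarrow> foldr H_gen w \<omega> \<in> Omega_tau"
  by (simp add: foldr_H_gen Omega_translate)

text \<open>Aperiodicity enters here: a translation fixes \<open>\<omega>\<close> only if the walk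
  has displacement 0.\<close>

lemma foldr_H_gen_fixed_iff:
  assumes "\<omega> \<in> Omega_tau"
  shows "foldr H_gen w \<omega> = \<omega> \<longleftrightarrow> w \<in> stab (lstep (full \<omega>)) 1"
proof
  assume eq: "foldr H_gen w \<omega> = \<omega>"
  define d where "d = foldr (lstep (full \<omega>)) w 1 - 1"
  have "\<omega> (n + d) = \<omega> n" for n
    using fun_cong[OF foldr_H_gen[OF assms, of w], of n] by (simp add: eq d_def)
  hence "d = 0" by (rule Omega_aperiodic[OF assms])
  thus "w \<in> stab (lstep (full \<omega>)) 1" by (simp add: stab_def d_def)
qed (simp add: stab_def foldr_H_gen[OF assms])

lemma stab_foldr_H_gen:
  assumes "\<omega> \<in> Omega_tau"
  shows "stab (lstep (full (foldr H_gen w \<omega>))) 1 = stab (lstep (full \<omega>)) (foldr (lstep (full \<omega>)) w 1)"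
proof -
  let ?d = "foldr (lstep (full \<omega>)) w 1 - 1"
  have "full (foldr H_gen w \<omega>) = (\<lambda>i. (full \<omega>) (i + ?d))"
    unfolding foldr_H_gen[OF assms] by (simp add: fun_eq_iff)
  thus ?thesis by (simp only: stab_lstep_translate) simp
qed

text \<open>\<^const>\<open>None\<close> stands for a missing edge: it cuts the line into two half-lines, each with
  three loops at its end.\<close>

definition half_ruler :: "int \<Rightarrow> letter option" where
  "half_ruler n = (if n = 0 then None else Some (ruler n))"

text \<open>Translating by a natural number \<open>m\<close> puts the root 1 on the right half-line
  of \<open>half_ruler\<close>; the windows then admit all limits of such rooted half-lines.\<close>

definition line_hull :: "(int \<Rightarrow> letter option) set" where
  "line_hull = {\<omega>. \<forall>N. \<exists>m. agree N \<omega> (\<lambda>i. half_ruler (i + int m))}"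

lemma alternating_half_ruler: "alternating half_ruler"
  unfolding alternating_def
proof
  fix n :: int
  have "half_ruler n = Some La \<longleftrightarrow> odd n" for n
    by (cases "n = 0") (auto simp: half_ruler_def ruler_eq_La_iff)
  thus "half_ruler (n + 1) = Some La \<longleftrightarrow> half_ruler n \<noteq> Some La" by simp
qed

lemma alternating_translate: "alternating \<omega> \<Longrightarrow> alternating (\<lambda>i. \<omega> (i + c))"
  unfolding alternating_def by (metis add.assoc add.commute)

lemma alternating_hull: "\<omega> \<in> line_hull \<Longrightarrow> alternating \<omega>"
  unfolding alternating_def
proof
  fix n assume "\<omega> \<in> line_hull"
  then obtain m where m: "agree (nat \<bar>n\<bar> + 1) \<omega> (\<lambda>i. half_ruler (i + int m))"
    unfolding line_hull_def by blast
  have "\<omega> n = half_ruler (n + int m)" "\<omega> (n + 1) = half_ruler (n + 1 + int m)"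
    by (rule agreeD[OF m], simp)+
  thus "\<omega> (n + 1) = Some La \<longleftrightarrow> \<omega> n \<noteq> Some La"
    using alternating_translate[OF alternating_half_ruler, of "int m"] unfolding alternating_def by simp
qed

lemma Omega_hull: "\<omega> \<in> Omega_tau \<Longrightarrow> full \<omega> \<in> line_hull"
  unfolding line_hull_def
proof safe
  fix N assume "\<omega> \<in> Omega_tau"
  then obtain q where q: "q > int N" "agree N \<omega> (\<lambda>i. ruler (q + i))" by (rule Omega_tauE)
  hence "agree N (full \<omega>) (\<lambda>i. half_ruler (i + int (nat q)))"
    by (auto simp: agree_def half_ruler_def add.commute)
  thus "\<exists>m. agree N (full \<omega>) (\<lambda>i. half_ruler (i + int m))" ..
qed

lemma half_ruler_hull: "(\<lambda>i. half_ruler (i + int m)) \<in> line_hull"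
  unfolding line_hull_def using agree_refl by blast

text \<open>A window showing \<open>None\<close> pins down the translation, as
  \<open>half_ruler\<close> has a single cut. Windows without it come from positive positions, which
  is the criterion for \<open>Omega_tau\<close>.\<close>

lemma hull_cases:
  assumes "\<omega> \<in> line_hull"
  obtains \<omega>' where "\<omega>' \<in> Omega_tau" "\<omega> = full \<omega>'" | j where "\<omega> = (\<lambda>i. half_ruler (i + j))"
proof (cases "\<exists>j. \<omega> j = None")
  case True
  then obtain j where j: "\<omega> j = None" ..
  have "\<omega> i = half_ruler (i + (- j))" for i
  proof -
    obtain m where m: "agree (nat \<bar>i\<bar> + nat \<bar>j\<bar>) \<omega> (\<lambda>i. half_ruler (i + int m))"
      using assms unfolding line_hull_def by blast
    have "half_ruler (j + int m) = None" using agreeD[OF m, of j] j by simp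
    hence "int m = - j" by (simp add: half_ruler_def split: if_splits)
    thus ?thesis using agreeD[OF m, of i] by simp
  qed
  thus thesis using that(2)[of "- j"] by blast
next
  case False
  define \<omega>' where "\<omega>' i = the (\<omega> i)" for i
  have w': "\<omega> i = Some (\<omega>' i)" for i using False by (auto simp: \<omega>'_def)
  have "\<omega>' \<in> Omega_tau"
    unfolding Omega_tau_iff
  proof
    fix N
    obtain m where m: "agree N \<omega> (\<lambda>i. half_ruler (i + int m))" using assms unfolding line_hull_def by blast
    have "int m > int N"
    proof (rule ccontr)
      assume "\<not> int m > int N"
      hence "\<omega> (- int m) = None" using agreeD[OF m, of "- int m"] by (simp add: half_ruler_def)
      thus False using False by blast
    qed
    moreover from this have "agree N \<omega>' (\<lambda>i. ruler (int m + i))"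
      using m w' by (auto simp: agree_def half_ruler_def add.commute split: if_splits)
    ultimately show "\<exists>q>int N. agree N \<omega>' (\<lambda>i. ruler (q + i))" by blast
  qed
  thus thesis using that(1) w' by (metis full_apply ext)
qed

lemma UNIV_letter: "UNIV = {La, Lx, Ly, Lz}"
  using letter.exhaust by blast

instance letter :: finite
  by standard (simp add: UNIV_letter)

text \<open>Compactness of the product over a finite alphabet, applied to the nested closures of the
  tails. Phrased as a cluster point, so that no subsequence has to be named.\<close>

lemma sequence_limit:
  fixes f :: "nat \<Rightarrow> int \<Rightarrow> 'a :: finite"
  obtains \<omega> where "\<And>N. \<exists>r\<ge>N. agree N (f r) \<omega>"
proof -
  let ?X = "product_topology (\<lambda>_ :: int. discrete_topology (UNIV :: 'a set)) UNIV"
  let ?C = "\<lambda>n. ?X closure_of (f ` {n..})"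
  have top: "topspace ?X = UNIV" by auto
  have "compact_space ?X" by (auto simp: compact_space_product_topology compact_space_discrete_topology)
  moreover have "?C n \<noteq> {}" for n by (auto simp: closure_of_eq_empty_gen disjnt_def)
  moreover have "decseq ?C" unfolding decseq_def by (intro allI impI closure_of_mono image_mono) auto
  ultimately have "(\<Inter>n. ?C n) \<noteq> {}"
    by (intro compact_space_imp_nest) auto
  then obtain \<omega> where w: "\<And>n. \<omega> \<in> ?C n" by blast
  show thesis
  proof (rule that)
    fix N
    let ?U = "PiE UNIV (\<lambda>i. if \<bar>i\<bar> \<le> int N then {\<omega> i} else UNIV)"
    have "{i. \<bar>i\<bar> \<le> int N} = {- int N..int N}" by auto
    hence "finite {i. (if \<bar>i\<bar> \<le> int N then {\<omega> i} else UNIV) \<noteq> topspace (discrete_topology UNIV)}"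
      by (rule_tac finite_subset[of _ "{i. \<bar>i\<bar> \<le> int N}"]) auto
    hence "openin ?X ?U" by (intro product_topology_basis) auto
    moreover have "\<omega> \<in> ?U" by (auto simp: PiE_def Pi_def)
    moreover have "\<forall>T. \<omega> \<in> T \<and> openin ?X T \<longrightarrow> (\<exists>y. y \<in> f ` {N..} \<and> y \<in> T)"
      using w[of N] by (simp add: in_closure_of)
    ultimately have "\<exists>y. y \<in> f ` {N..} \<and> y \<in> ?U" by simp
    then obtain r where r: "r \<ge> N" "f r \<in> ?U" by auto
    have "f r i = \<omega> i" if "\<bar>i\<bar> \<le> int N" for i using PiE_mem[OF r(2), of i] that by simp
    thus "\<exists>r\<ge>N. agree N (f r) \<omega>" using r(1) by (auto simp: agree_def)
  qed
qed


section \<open>Gray code and the action on the tree\<close>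

abbreviation boundary_gen :: "gen \<Rightarrow> (nat \<Rightarrow> bool) \<Rightarrow> nat \<Rightarrow> bool" where
  "boundary_gen s \<equiv> boundary_act (G_gen s)"

lemma length_G_gen [simp]: "length (G_gen s u) = length u"
  by (induction s u rule: G_gen.induct) simp_all

lemma G_gen_G_gen [simp]: "G_gen s (G_gen s u) = u"
proof (induction s u rule: G_gen.induct)
  case (2 i w) thus ?case by simp
next
  case (3 w) thus ?case by (cases w) simp_all
next
  case (5 w) thus ?case by (cases w) simp_all
qed simp_all

lemma take_G_gen: "take k (G_gen s u) = G_gen s (take k u)"
proof (induction k arbitrary: s u)
  case (Suc k)
  show ?case
  proof (cases u)
    case (Cons i w)
    thus ?thesis by (cases s; cases i) (simp_all add: Suc.IH)
  qed simp
qed simp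

lemma foldr_G_gen_length [simp]: "length (foldr G_gen w u) = length u"
  by (induction w) simp_all

lemma take_foldr_G_gen: "take k (foldr G_gen w u) = foldr G_gen w (take k u)"
  by (induction w) (simp_all add: take_G_gen)

lemma take_map_upt: "k \<le> n \<Longrightarrow> take k (map \<xi> [0..<n]) = map \<xi> [0..<k]"
  by (simp add: take_map)

lemma map_boundary_act:
  assumes "\<And>u. length (g u) = length u" "\<And>k u. take k (g u) = g (take k u)"
  shows "map (boundary_act g \<xi>) [0..<k] = g (map \<xi> [0..<k])"
proof (rule nth_equalityI)
  fix i assume "i < length (map (boundary_act g \<xi>) [0..<k])"
  hence i: "i < k" by simp
  have "g (map \<xi> [0..<Suc i]) = take (Suc i) (g (map \<xi> [0..<k]))"
    using i by (simp only: assms(2) take_map_upt Suc_le_eq)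
  thus "map (boundary_act g \<xi>) [0..<k] ! i = g (map \<xi> [0..<k]) ! i"
    using i by (simp add: boundary_act_def del: upt_Suc)
qed (simp add: assms(1))

lemma map_boundary_gen: "map (boundary_gen s \<xi>) [0..<k] = G_gen s (map \<xi> [0..<k])"
  by (rule map_boundary_act) (simp_all add: take_G_gen)

lemma map_foldr_boundary_gen:
  "map (foldr boundary_gen w \<xi>) [0..<k] = foldr G_gen w (map \<xi> [0..<k])"
  by (induction w) (simp_all add: map_boundary_gen)

lemma eq_if_prefixes_eq:
  assumes "\<And>k. map \<xi> [0..<k] = map \<zeta> [0..<k]"
  shows "\<xi> = \<zeta>"
proof
  fix i
  show "\<xi> i = \<zeta> i" using assms[of "Suc i"] by simp
qed

lemma boundary_act_foldr: "boundary_act (foldr G_gen w) \<xi> = foldr boundary_gen w \<xi>"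
  by (rule eq_if_prefixes_eq)
    (simp add: map_foldr_boundary_gen map_boundary_act take_foldr_G_gen)

lemma involutive_boundary_gen [simp]: "involutive boundary_gen"
  unfolding involutive_def
  by (intro allI eq_if_prefixes_eq) (simp add: map_boundary_gen)

text \<open>Equality of neighbouring binary digits, the negation of the usual exclusive or. The
  complement sends 0 to \<open>1^\<infinity>\<close>, which b, c and d all fix, as the end of the
  half-line requires.\<close>

definition ray :: "nat \<Rightarrow> nat \<Rightarrow> bool" where
  "ray m i \<longleftrightarrow> (odd (m div 2 ^ i) \<longleftrightarrow> odd (m div 2 ^ Suc i))"

lemma map_ray_Suc:
  "map (ray m) [0..<Suc k] = (odd m \<longleftrightarrow> odd (m div 2)) # map (ray (m div 2)) [0..<k]"
proof (rule nth_equalityI)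
  fix i assume "i < length (map (ray m) [0..<Suc k])"
  thus "map (ray m) [0..<Suc k] ! i = ((odd m \<longleftrightarrow> odd (m div 2)) # map (ray (m div 2)) [0..<k]) ! i"
    by (cases i) (simp_all add: ray_def div_mult2_eq[symmetric] del: upt_Suc)
qed simp

lemma ray_0: "ray 0 = (\<lambda>_. True)"
  by (simp add: ray_def fun_eq_iff)

text \<open>The first digit compares the parities of \<open>m\<close> and \<open>m div 2\<close>, so
  \<open>m\<close> is recovered as soon as \<open>m div 2\<close> is; the induction descends by
  halving.\<close>

lemma inj_ray: "ray m = ray m' \<Longrightarrow> m = m'"
proof (induction "m + m'" arbitrary: m m' rule: less_induct)
  case less
  have eq: "map (ray m) [0..<Suc k] = map (ray m') [0..<Suc k]" for k using less.prems by simp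
  show ?case
  proof (cases "m + m' = 0")
    case False
    have "ray (m div 2) = ray (m' div 2)"
      by (rule eq_if_prefixes_eq) (use eq in \<open>simp only: map_ray_Suc list.inject\<close>)
    hence "m div 2 = m' div 2" using False by (intro less.hyps) linarith+
    moreover have "(odd m \<longleftrightarrow> odd (m div 2)) \<longleftrightarrow> (odd m' \<longleftrightarrow> odd (m' div 2))"
      using eq[of 0] by (simp only: map_ray_Suc list.inject)
    ultimately have "m div 2 = m' div 2" "m mod 2 = m' mod 2" by (auto simp: odd_iff_mod_2_eq_one)
    thus ?thesis by (metis div_mult_mod_eq)
  qed simp
qed

text \<open>The string is built from its last digit, each further digit doubling the index and
  choosing its parity; the index never falls below its arbitrary start.\<close>

lemma ray_prefix_exists: "\<exists>m\<ge>M. map (ray m) [0..<length u] = u"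
proof (induction u)
  case (Cons i u)
  then obtain m where m: "m \<ge> M" "map (ray m) [0..<length u] = u" by blast
  let ?m = "2 * m + of_bool (i \<longleftrightarrow> odd m)"
  have "?m div 2 = m" "odd ?m \<longleftrightarrow> (i \<longleftrightarrow> odd m)" by auto
  hence "map (ray ?m) [0..<length (i # u)] = i # u"
    using m(2) map_ray_Suc[of ?m "length u"] by (auto simp del: upt_Suc)
  thus ?case using m(1) by (intro exI[of _ ?m]) auto
qed auto

text \<open>Below a first digit 1 the generators b, c, d continue as c, d, b. The letter of a
  doubled index is rotated in the matching way.\<close>

lemma nxt_edge_letters:
  assumes "l \<noteq> La"
  shows "nxt l \<in> edge_letters Gb \<longleftrightarrow> l \<in> edge_letters Gc"
    "nxt l \<in> edge_letters Gc \<longleftrightarrow> l \<in> edge_letters Gd"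
    "nxt l \<in> edge_letters Gd \<longleftrightarrow> l \<in> edge_letters Gb"
  using assms by (cases l; simp)+

text \<open>Vertex \<open>m\<close> is vertex \<open>m + 1\<close> of \<open>half_ruler\<close>: the
  end of the half-line is 0, and the letter joining \<open>m\<close> to \<open>m + 1\<close> is
  \<open>ruler (m + 1)\<close>.\<close>

definition nat_step :: "gen \<Rightarrow> nat \<Rightarrow> nat" where
  "nat_step s m = (if ruler (int m + 1) \<in> edge_letters s then m + 1
     else if m \<noteq> 0 \<and> ruler (int m) \<in> edge_letters s then m - 1 else m)"

lemma ruler_even_ne: "even n \<Longrightarrow> n \<noteq> 0 \<Longrightarrow> ruler n \<noteq> La"
  by (simp add: ruler_eq_La_iff)

lemma nat_step_Ga: "nat_step Ga m = (if even m then m + 1 else m - 1)"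
  using ruler_eq_La_iff[of "int m + 1"] ruler_eq_La_iff[of "int m"] by (auto simp: nat_step_def)

lemma nat_step_double:
  assumes "even m" "s \<noteq> Ga"
  shows "nat_step s (2 * m) = (if m \<noteq> 0 \<and> nxt (ruler (int m)) \<in> edge_letters s then 2 * m - 1 else 2 * m)"
    "nat_step s (2 * m + 1) = (if Lx \<in> edge_letters s then 2 * m + 2 else 2 * m + 1)"
proof -
  have "ruler (2 * int m + 1) = La" "ruler (int m + 1) = La" using assms(1) by (auto intro!: ruler_odd)
  thus "nat_step s (2 * m) = (if m \<noteq> 0 \<and> nxt (ruler (int m)) \<in> edge_letters s then 2 * m - 1 else 2 * m)"
    "nat_step s (2 * m + 1) = (if Lx \<in> edge_letters s then 2 * m + 2 else 2 * m + 1)"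
    using assms ruler_double[of "int m"] ruler_double[of "int m + 1"]
    by (auto simp: nat_step_def algebra_simps)
qed

lemma nat_step_double_odd:
  assumes "odd m" "s \<noteq> Ga"
  shows "nat_step s (2 * m) = (if Lx \<in> edge_letters s then 2 * m - 1 else 2 * m)"
    "nat_step s (2 * m + 1) = (if nxt (ruler (int m + 1)) \<in> edge_letters s then 2 * m + 2 else 2 * m + 1)"
proof -
  have "m \<noteq> 0" using assms(1) by (cases m) auto
  moreover have "ruler (2 * int m + 1) = La" "ruler (int m) = La" using assms(1) by (auto intro!: ruler_odd)
  ultimately show "nat_step s (2 * m) = (if Lx \<in> edge_letters s then 2 * m - 1 else 2 * m)"
    "nat_step s (2 * m + 1) = (if nxt (ruler (int m + 1)) \<in> edge_letters s then 2 * m + 2 else 2 * m + 1)"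
    using assms ruler_double[of "int m"] ruler_double[of "int m + 1"]
    by (auto simp: nat_step_def algebra_simps)
qed

lemma nat_step_even:
  assumes "even m" "s \<noteq> Ga"
  shows "nat_step s m = (if m \<noteq> 0 \<and> ruler (int m) \<in> edge_letters s then m - 1 else m)"
  using assms ruler_odd[of "int m + 1"] by (auto simp: nat_step_def)

lemma nat_step_odd:
  assumes "odd m" "s \<noteq> Ga"
  shows "nat_step s m = (if ruler (int m + 1) \<in> edge_letters s then m + 1 else m)"
  using assms ruler_odd[of "int m"] by (auto simp: nat_step_def)

text \<open>Along the half-line, \<^const>\<open>ray\<close> is the binary reflected Gray code with complemented
  digits: consecutive vertices differ in one digit, whose index is the 2-adic valuation.\<close>

lemma G_gen_ray: "G_gen s (map (ray m) [0..<k]) = map (ray (nat_step s m)) [0..<k]"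
proof (induction k arbitrary: s m)
  case (Suc k)
  define n where "n = m div 2"
  let ?w = "map (ray n) [0..<k]"
  have L: "map (ray m) [0..<Suc k] = (odd m \<longleftrightarrow> odd n) # ?w" by (simp only: map_ray_Suc n_def)
  show ?case
  proof (cases "s = Ga")
    case True
    have d: "nat_step s m div 2 = n" and e: "odd (nat_step s m) \<longleftrightarrow> even m"
      by (auto simp: True nat_step_Ga n_def elim!: evenE oddE)
    show ?thesis unfolding map_ray_Suc d e by (simp add: True n_def[symmetric])
  next
    case s: False
    have IH: "G_gen s' ?w = map (ray (nat_step s' n)) [0..<k]" for s' by (rule Suc.IH)
    have ne: "ruler (int n) \<noteq> La" if "even n" "n \<noteq> 0" using that by (intro ruler_even_ne) auto
    have ne': "ruler (int n + 1) \<noteq> La" if "odd n" using that by (intro ruler_even_ne) auto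
    \<comment> \<open>The first digit is 1 exactly in the cases \<open>ee\<close> and
      \<open>oo\<close>, where the tail \<open>n\<close> moves by the next generator. In
      \<open>eo\<close> and \<open>oe\<close> it is 0, and the tail moves by a if \<open>s\<close>
      is b or c, that is, if \<open>Lx\<close> carries the label \<open>s\<close>; otherwise it
      stays.\<close>
    consider (ee) "even n" "m = 2 * n" | (eo) "even n" "m = 2 * n + 1"
      | (oe) "odd n" "m = 2 * n" | (oo) "odd n" "m = 2 * n + 1"
    proof -
      have "m = 2 * n \<or> m = 2 * n + 1" unfolding n_def by presburger
      thus thesis using that by blast
    qed
    thus ?thesis
    proof cases
      case ee
      have st: "nat_step s m = (if n \<noteq> 0 \<and> nxt (ruler (int n)) \<in> edge_letters s then 2 * (n - 1) + 1 else 2 * n)"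
        using nat_step_double(1)[OF ee(1) s] ee(2) by auto
      have "odd (n - 1)" if "n \<noteq> 0" using that ee(1) by simp
      thus ?thesis using s ee ne nxt_edge_letters[of "ruler (int n)"] unfolding L st map_ray_Suc
        by (cases s) (auto simp: IH nat_step_even)
    next
      case eo
      have st: "nat_step s m = (if Lx \<in> edge_letters s then 2 * (n + 1) else 2 * n + 1)"
        using nat_step_double(2)[OF eo(1) s] eo(2) by auto
      show ?thesis using s eo unfolding L st map_ray_Suc
        by (cases s) (auto simp: IH nat_step_Ga)
    next
      case oe
      have "n \<noteq> 0" using oe(1) by (cases n) auto
      hence st: "nat_step s m = (if Lx \<in> edge_letters s then 2 * (n - 1) + 1 else 2 * n)"
        using nat_step_double_odd(1)[OF oe(1) s] oe(2) by auto
      show ?thesis using s oe unfolding L st map_ray_Suc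
        by (cases s) (auto simp: IH nat_step_Ga)
    next
      case oo
      have st: "nat_step s m = (if nxt (ruler (int n + 1)) \<in> edge_letters s then 2 * (n + 1) else 2 * n + 1)"
        using nat_step_double_odd(2)[OF oo(1) s] oo(2) by auto
      show ?thesis using s oo ne' nxt_edge_letters[of "ruler (int n + 1)"] unfolding L st map_ray_Suc
        by (cases s) (auto simp: IH nat_step_odd)
    qed
  qed
qed simp

section \<open>Words on the half-line and on other boundary points\<close>

lemma boundary_gen_ray: "boundary_gen s (ray m) = ray (nat_step s m)"
  by (rule eq_if_prefixes_eq) (simp add: map_boundary_gen G_gen_ray)

lemma foldr_boundary_gen_ray: "foldr boundary_gen w (ray m) = ray (foldr nat_step w m)"
  by (induction w) (simp_all add: boundary_gen_ray)

lemma lstep_half_ruler: "lstep half_ruler s (int m + 1) = int (nat_step s m) + 1"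
  by (auto simp: lstep_def nat_step_def half_ruler_def image_iff)

lemma foldr_lstep_half_ruler: "foldr (lstep half_ruler) w (int m + 1) = int (foldr nat_step w m) + 1"
  by (induction w) (simp_all add: lstep_half_ruler)

lemma stab_ray: "stab boundary_gen (ray m) = stab (lstep (\<lambda>i. half_ruler (i + int m))) 1"
  by (auto simp: stab_def foldr_boundary_gen_ray foldr_lstep_translate add.commute[of 1]
      foldr_lstep_half_ruler dest: inj_ray)

lemma cls_ray: "cls boundary_gen (ray m) = cls (lstep (\<lambda>i. half_ruler (i + int m))) 1"
  by (intro cls_eqI involutive_lstep alternating_translate alternating_half_ruler
      involutive_boundary_gen stab_ray)

text \<open>b, c and d pass down a run of digits 1 and, behind the first 0, act by a or not at all;
  a changes one digit. So nothing changes beyond the digit that follows a 0, whichever 0 is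
  taken.\<close>

lemma G_gen_nth:
  "\<not> u ! z \<Longrightarrow> z + 2 \<le> i \<Longrightarrow> i < length u \<Longrightarrow> G_gen s u ! i = u ! i"
proof (induction s u arbitrary: z i rule: G_gen.induct)
  case (2 j w) thus ?case by (cases i) auto
next
  case (3 w) thus ?case by (cases i; cases w) (auto simp: nth_Cons')
next
  case (5 w) thus ?case by (cases i; cases w) (auto simp: nth_Cons')
next
  case (4 w) thus ?case by (cases i; cases z) auto
next
  case (6 w) thus ?case by (cases i; cases z) auto
next
  case (8 w) thus ?case by (cases i; cases z) auto
qed auto

lemma boundary_gen_tail: "\<not> \<xi> z \<Longrightarrow> z + 2 \<le> i \<Longrightarrow> boundary_gen s \<xi> i = \<xi> i"
  using G_gen_nth[of "map \<xi> [0..<Suc i]" z i s] by (simp add: boundary_act_def del: upt_Suc)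

text \<open>\<open>foldr\<close> starts at the right, so the suffixes of \<open>w\<close> lead to
  the intermediate points; each of these must show a 0 of its own early enough.\<close>

lemma foldr_boundary_gen_tail:
  assumes "\<And>w'. suffix w' w \<Longrightarrow> \<exists>z. z + 2 \<le> N \<and> \<not> foldr boundary_gen w' \<xi> z" "N \<le> i"
  shows "foldr boundary_gen w \<xi> i = \<xi> i"
  using assms(1)
proof (induction w)
  case (Cons s w)
  obtain z where "z + 2 \<le> N" "\<not> foldr boundary_gen w \<xi> z"
    using Cons.prems[of w] by (auto simp: suffix_Cons)
  hence "foldr boundary_gen (s # w) \<xi> i = foldr boundary_gen w \<xi> i"
    using assms(2) by (simp add: boundary_gen_tail[of _ z])
  also have "\<dots> = \<xi> i" using Cons.prems by (intro Cons.IH) (auto simp: suffix_Cons)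
  finally show ?case .
qed simp

lemma eq_iff_below:
  assumes "\<And>i. N \<le> i \<Longrightarrow> f i = g i"
  shows "f = g \<longleftrightarrow> (\<forall>i<(N :: nat). f i = g i)"
proof
  assume *: "\<forall>i<N. f i = g i"
  show "f = g"
  proof
    fix i show "f i = g i" using * assms[of i] by (cases "i < N") auto
  qed
qed simp

text \<open>If the orbit of \<open>\<xi>\<close> avoids \<open>1\<^sup>\<infinity>\<close>, every point met by short words has a digit 0 early on,
  and then the generators change early digits only.\<close>

lemma stab_boundary_approx: "\<exists>m. \<forall>w. length w \<le> r \<longrightarrow> (w \<in> stab boundary_gen \<xi> \<longleftrightarrow> w \<in> stab boundary_gen (ray m))"
proof (cases "\<exists>w. foldr boundary_gen w \<xi> = ray 0")
  case True
  then obtain w where "foldr boundary_gen w \<xi> = ray 0" ..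
  \<comment> \<open>Within the orbit of \<open>1^\<infinity>\<close> the point is itself of the form
    \<open>ray m\<close>, and no approximation takes place.\<close>
  hence "\<xi> = foldr boundary_gen (rev w) (ray 0)"
    using foldr_rev_cancel[OF involutive_boundary_gen, of w \<xi>] by simp
  thus ?thesis by (metis foldr_boundary_gen_ray)
next
  case False
  hence "\<forall>w. \<exists>z. \<not> foldr boundary_gen w \<xi> z" by (auto simp: ray_0 fun_eq_iff)
  then obtain z where z: "\<And>w. \<not> foldr boundary_gen w \<xi> (z w)" by metis
  have fin: "finite {w :: gen list. length w \<le> r}"
    using finite_lists_length_le[of "UNIV :: gen set" r] by simp
  define N where "N = Max (z ` {w. length w \<le> r}) + 2"
  have zN: "z w + 2 \<le> N" if "length w \<le> r" for w
    using that fin unfolding N_def by (intro add_right_mono Max_ge) auto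
  \<comment> \<open>Whatever a word of length at most \<open>r\<close> does to \<open>\<xi>\<close>
    happens among its first \<open>N\<close> digits, and \<open>ray m\<close> shares these.\<close>
  obtain m where m: "map (ray m) [0..<N] = map \<xi> [0..<N]"
    using ray_prefix_exists[of 0 "map \<xi> [0..<N]"] by auto
  have pre: "map (foldr boundary_gen w (ray m)) [0..<N] = map (foldr boundary_gen w \<xi>) [0..<N]" for w
    by (simp only: map_foldr_boundary_gen m)
  have pre': "foldr boundary_gen w (ray m) i = foldr boundary_gen w \<xi> i" if "i < N" for w i
    using arg_cong[OF pre[of w], of "\<lambda>u. u ! i"] that by simp
  have "w \<in> stab boundary_gen \<xi> \<longleftrightarrow> w \<in> stab boundary_gen (ray m)" if w: "length w \<le> r" for w
  proof -
    have zw: "z w' + 2 \<le> N" if "suffix w' w" for w'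
      using that w by (intro zN) (auto dest: suffix_length_le)
    have 1: "foldr boundary_gen w \<xi> i = \<xi> i" if "N \<le> i" for i
      using zw z that by (intro foldr_boundary_gen_tail[of w N]) blast+
    have "\<not> foldr boundary_gen w' (ray m) (z w')" if "suffix w' w" for w'
      using z[of w'] zw[OF that] pre'[of "z w'" w'] by simp
    hence 2: "foldr boundary_gen w (ray m) i = ray m i" if "N \<le> i" for i
      using zw that by (intro foldr_boundary_gen_tail[of w N]) blast+
    have "foldr boundary_gen w \<xi> = \<xi> \<longleftrightarrow> (\<forall>i<N. foldr boundary_gen w \<xi> i = \<xi> i)"
      using 1 by (rule eq_iff_below)
    moreover have "foldr boundary_gen w (ray m) = ray m \<longleftrightarrow> (\<forall>i<N. foldr boundary_gen w (ray m) i = ray m i)"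
      using 2 by (rule eq_iff_below)
    ultimately show ?thesis using pre'[of _ w] pre'[of _ "[]"] by (simp add: stab_def)
  qed
  thus ?thesis by blast
qed

text \<open>Both sides mean that the word closes up at every vertex of the half-line; the vertices near
  its end are covered because every finite digit string occurs as a prefix arbitrarily far out.\<close>

lemma word_trivial_iff:
  "foldr G_gen w = id \<longleftrightarrow> (\<forall>\<omega>\<in>Omega_tau. foldr H_gen w \<omega> = \<omega>)"
proof
  assume triv: "foldr G_gen w = id"
  have stab: "w \<in> stab (lstep (\<lambda>i. half_ruler (i + int m))) 1" for m
  proof -
    have "foldr boundary_gen w (ray m) = ray m"
      by (rule eq_if_prefixes_eq) (simp add: map_foldr_boundary_gen triv)
    thus ?thesis using stab_ray[of m] by (auto simp: stab_def)
  qed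
  show "\<forall>\<omega>\<in>Omega_tau. foldr H_gen w \<omega> = \<omega>"
  proof
    fix \<omega> assume w: "\<omega> \<in> Omega_tau"
    hence "full \<omega> \<in> line_hull" by (rule Omega_hull)
    then obtain m where "agree (Suc (length w)) (full \<omega>) (\<lambda>i. half_ruler (i + int m))"
      unfolding line_hull_def by blast
    hence "w \<in> stab (lstep (full \<omega>)) 1" using stab by (subst stab_lstep_agree) auto
    thus "foldr H_gen w \<omega> = \<omega>" using w by (simp add: foldr_H_gen_fixed_iff)
  qed
next
  assume triv: "\<forall>\<omega>\<in>Omega_tau. foldr H_gen w \<omega> = \<omega>"
  show "foldr G_gen w = id"
  proof
    fix u
    \<comment> \<open>A window of radius \<open>length w + 1\<close> around \<open>m\<close> stays
      clear of position 0, the only place where \<open>ruler_x\<close> and \<open>half_ruler\<close>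
      differ.\<close>
    obtain m where m: "m \<ge> length w + 2" "map (ray m) [0..<length u] = u" using ray_prefix_exists by blast
    let ?\<omega> = "\<lambda>i. ruler_x (i + int m)"
    have w: "?\<omega> \<in> Omega_tau" by (rule Omega_translate[OF ruler_x_Omega])
    have "agree (Suc (length w)) (full ?\<omega>) (\<lambda>i. half_ruler (i + int m))"
      using m(1) by (auto simp: agree_def half_ruler_def ruler_x_def)
    moreover have "w \<in> stab (lstep (full ?\<omega>)) 1" using triv w by (simp add: foldr_H_gen_fixed_iff)
    ultimately have "w \<in> stab boundary_gen (ray m)" by (simp add: stab_ray stab_lstep_agree)
    hence "map (ray m) [0..<length u] = foldr G_gen w (map (ray m) [0..<length u])"
      unfolding map_foldr_boundary_gen[symmetric] by (simp add: stab_def)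
    thus "foldr G_gen w u = id u" using m(2) by simp
  qed
qed


section \<open>The two groups and the topology of the subshift\<close>

lemma mult_BijGroup: "f \<in> Bij S \<Longrightarrow> g \<in> Bij S \<Longrightarrow> f \<otimes>\<^bsub>BijGroup S\<^esub> g = compose S f g"
  and carrier_BijGroup [simp]: "carrier (BijGroup S) = Bij S"
  and one_BijGroup: "\<one>\<^bsub>BijGroup S\<^esub> = (\<lambda>x\<in>S. x)"
  by (simp_all add: BijGroup_def)

text \<open>Elements of \<open>BijGroup S\<close> are extensional, so a composite of generators is
  the product in the group only after \<open>restrict\<close>.\<close>

lemma word_BijGroup:
  assumes "\<And>s. h s \<in> Bij S"
  shows "foldr (\<lambda>s. mult (BijGroup S) (h s)) w \<one>\<^bsub>BijGroup S\<^esub> = restrict (foldr h w) S"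
    and "restrict (foldr h w) S \<in> Bij S"
proof -
  have "foldr (\<lambda>s. mult (BijGroup S) (h s)) w \<one>\<^bsub>BijGroup S\<^esub> = restrict (foldr h w) S \<and>
      restrict (foldr h w) S \<in> Bij S"
  proof (induction w)
    case Nil
    show ?case using id_Bij[of S] by (simp add: one_BijGroup restrict_def id_def cong: if_cong)
  next
    case (Cons s w)
    have eq: "compose S (h s) (restrict (foldr h w) S) = restrict (foldr h (s # w)) S"
      by (auto simp: compose_def restrict_def)
    have "h s \<otimes>\<^bsub>BijGroup S\<^esub> restrict (foldr h w) S = restrict (foldr h (s # w)) S"
      using Cons by (simp only: mult_BijGroup[OF assms] eq)
    moreover have "restrict (foldr h (s # w)) S \<in> Bij S"
      using Cons compose_Bij[OF assms, of "restrict (foldr h w) S" s] by (simp only: eq)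
    moreover have "foldr (\<lambda>s. mult (BijGroup S) (h s)) (s # w) \<one>\<^bsub>BijGroup S\<^esub> =
        h s \<otimes>\<^bsub>BijGroup S\<^esub> restrict (foldr h w) S"
      using Cons by (simp only: foldr_Cons o_apply)
    ultimately show ?case by (simp only: simp_thms)
  qed
  thus "foldr (\<lambda>s. mult (BijGroup S) (h s)) w \<one>\<^bsub>BijGroup S\<^esub> = restrict (foldr h w) S"
    "restrict (foldr h w) S \<in> Bij S" by auto
qed

text \<open>Generators are their own inverses, so reversing a word inverts it, and words without
  inverse letters already exhaust the subgroup.\<close>

lemma (in group) carrier_generated_by_involutions:
  assumes h: "\<And>s. h s \<in> carrier G" "\<And>s. h s \<otimes> h s = \<one>"
  shows "carrier (subgroup_generated G (range h)) = range (\<lambda>w. foldr (\<lambda>s. mult G (h s)) w \<one>)"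
    (is "_ = range ?f")
proof
  have closed: "?f w \<in> carrier G" for w by (induction w) (simp_all add: h)
  have append: "?f (w @ w') = ?f w \<otimes> ?f w'" for w w'
    by (induction w) (simp_all add: h closed m_assoc)
  have cancel: "?f (rev w) \<otimes> ?f w = \<one>" for w
  proof (induction w)
    case (Cons s w)
    have "?f (rev (s # w)) = ?f (rev w) \<otimes> h s" using append[of "rev w" "[s]"] h(1) by simp
    hence "?f (rev (s # w)) \<otimes> ?f (s # w) = ?f (rev w) \<otimes> (h s \<otimes> h s) \<otimes> ?f w"
      using h(1) closed[of w] closed[of "rev w"] by (simp add: m_assoc del: rev.simps)
    thus ?case using Cons closed by (simp add: h(2) del: rev.simps)
  qed simp
  have "subgroup (range ?f) G"
  proof (rule subgroupI)
    fix a assume "a \<in> range ?f"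
    then obtain w where "a = ?f w" by blast
    hence "inv a = ?f (rev w)" using cancel closed by (simp add: inv_equality)
    thus "inv a \<in> range ?f" by blast
  next
    fix a b assume "a \<in> range ?f" "b \<in> range ?f"
    then obtain w w' where "a = ?f w" "b = ?f w'" by blast
    hence "a \<otimes> b = ?f (w @ w')" by (simp only: append)
    thus "a \<otimes> b \<in> range ?f" by blast
  qed (use closed in auto)
  moreover have "range h \<subseteq> range ?f"
  proof safe
    fix s
    have "h s = ?f [s]" by (simp add: h)
    thus "h s \<in> range ?f" by blast
  qed
  ultimately show "carrier (subgroup_generated G (range h)) \<subseteq> range ?f"
    by (rule subgroup_generated_minimal)
  interpret S: group "subgroup_generated G (range h)" by simp
  have sub: "range h \<subseteq> carrier (subgroup_generated G (range h))"
    using h(1) by (intro subgroup_generated_subset_carrier_subset) blast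
  have "?f w \<in> carrier (subgroup_generated G (range h))" for w
  proof (induction w)
    case Nil
    show ?case using S.one_closed by simp
  next
    case (Cons s w)
    thus ?case using S.m_closed[of "h s" "?f w"] sub by auto
  qed
  thus "range ?f \<subseteq> carrier (subgroup_generated G (range h))" by blast
qed

lemma inv_into_involution_Bij:
  assumes "f \<in> extensional S" "\<And>x. x \<in> S \<Longrightarrow> f x \<in> S" "\<And>x. x \<in> S \<Longrightarrow> f (f x) = x"
  shows "f \<in> Bij S"
  using assms unfolding Bij_def by (auto intro!: bij_betwI[where g = f])

lemma group_tree_aut: "group tree_aut"
proof -
  interpret B: group "BijGroup UNIV :: (bool list \<Rightarrow> bool list) monoid" by (rule group_BijGroup)
  let ?C = "{f \<in> Bij UNIV. f [] = [] \<and> (\<forall>u v. tree_adj (f u) (f v) \<longleftrightarrow> tree_adj u v)}"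
  have "subgroup ?C (BijGroup UNIV)"
  proof (rule B.subgroupI)
    have "(\<lambda>x\<in>UNIV. x) \<in> ?C" using id_Bij[of "UNIV :: bool list set"] by simp
    thus "?C \<noteq> {}" by blast
  next
    fix f assume f: "f \<in> ?C"
    hence inv: "inv\<^bsub>BijGroup UNIV\<^esub> f = (\<lambda>x\<in>UNIV. inv_into UNIV f x)"
      by (intro inv_BijGroup) simp
    have bij: "bij f" using f by (simp add: Bij_def)
    hence "inv_into UNIV f [] = []" using f by (intro inv_into_f_eq) (auto dest: bij_is_inj)
    moreover have "tree_adj (inv_into UNIV f u) (inv_into UNIV f v) \<longleftrightarrow> tree_adj u v" for u v
    proof -
      have "tree_adj (f (inv_into UNIV f u)) (f (inv_into UNIV f v)) \<longleftrightarrow>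
          tree_adj (inv_into UNIV f u) (inv_into UNIV f v)" using f by simp
      thus ?thesis using bij by (simp add: bij_is_surj surj_f_inv_f)
    qed
    moreover have "inv\<^bsub>BijGroup UNIV\<^esub> f \<in> Bij UNIV" using f B.inv_closed[of f] by simp
    ultimately show "inv\<^bsub>BijGroup UNIV\<^esub> f \<in> ?C" by (simp add: inv)
  next
    fix f g assume fg: "f \<in> ?C" "g \<in> ?C"
    hence "f \<otimes>\<^bsub>BijGroup UNIV\<^esub> g = compose UNIV f g" by (simp add: mult_BijGroup)
    thus "f \<otimes>\<^bsub>BijGroup UNIV\<^esub> g \<in> ?C" using fg by (simp add: compose_Bij) (simp add: compose_def)
  qed simp
  from subgroup.subgroup_is_group[OF this B.group_axioms] show ?thesis by (simp add: tree_aut_def)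
qed

lemma G_gen_Bij: "G_gen s \<in> Bij UNIV"
  by (rule inv_into_involution_Bij) auto

lemma G_gen_tree_aut: "G_gen s \<in> carrier tree_aut"
proof -
  have 1: "tree_adj (G_gen s u) (G_gen s v)" if "tree_adj u v" for u v
  proof -
    \<comment> \<open>A map that respects lengths and prefixes sends a child of a vertex to a child
      of its image.\<close>
    have *: "\<exists>j. G_gen s (x @ [i]) = G_gen s x @ [j]" for x i
    proof -
      have "take (length x) (G_gen s (x @ [i])) = G_gen s x" by (simp add: take_G_gen)
      moreover have "length (drop (length x) (G_gen s (x @ [i]))) = 1" by simp
      ultimately show ?thesis by (metis append_take_drop_id length_0_conv length_Suc_conv One_nat_def)
    qed
    thus ?thesis using that unfolding tree_adj_def by blast
  qed
  have "tree_adj (G_gen s u) (G_gen s v) \<longleftrightarrow> tree_adj u v" for u v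
    using 1[of u v] 1[of "G_gen s u" "G_gen s v"] by auto
  thus ?thesis by (simp add: tree_aut_def G_gen_Bij)
qed

lemma involutive_G_gen: "involutive G_gen"
  by (simp add: involutive_def)

lemma carrier_G_group: "carrier G_group = range (foldr G_gen)"
proof -
  interpret group tree_aut by (rule group_tree_aut)
  have "G_gen s \<otimes>\<^bsub>tree_aut\<^esub> G_gen s = \<one>\<^bsub>tree_aut\<^esub>" for s
    by (simp add: tree_aut_def mult_BijGroup one_BijGroup G_gen_Bij compose_def)
  from carrier_generated_by_involutions[of G_gen, OF G_gen_tree_aut this]
  have "carrier G_group = range (\<lambda>w. foldr (\<lambda>s. mult tree_aut (G_gen s)) w \<one>\<^bsub>tree_aut\<^esub>)"
    by (simp add: G_group_def)
  also have "\<dots> = range (\<lambda>w. restrict (foldr G_gen w) UNIV)"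
    using word_BijGroup(1)[of G_gen UNIV, OF G_gen_Bij] by (simp add: tree_aut_def)
  finally show ?thesis by (simp add: restrict_def)
qed

lemma group_G_group: "group G_group"
  unfolding G_group_def by (rule group.group_subgroup_generated[OF group_tree_aut])

lemma foldr_G_gen_Bij: "foldr G_gen w \<in> Bij UNIV"
  using word_BijGroup(2)[of G_gen UNIV w, OF G_gen_Bij] by (simp add: restrict_def)

lemma mult_G_group: "foldr G_gen w \<otimes>\<^bsub>G_group\<^esub> foldr G_gen w' = foldr G_gen (w @ w')"
  by (simp add: G_group_def tree_aut_def mult_BijGroup foldr_G_gen_Bij compose_def fun_eq_iff)

lemma Schreier_eq: "Schreier \<xi> = action_graph boundary_gen \<xi>"
proof -
  have "orbit G_group boundary_act \<xi> = orb boundary_gen \<xi>"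
    unfolding orbit_def carrier_G_group orb_def boundary_act_foldr[symmetric] by blast
  thus ?thesis unfolding Schreier_def Let_def action_graph_def by simp
qed

lemma homeomorphic_map_restrict:
  "homeomorphic_map X Y f \<Longrightarrow> homeomorphic_map X Y (restrict f (topspace X))"
  by (erule homeomorphic_map_eq) simp

lemma group_homeo_group: "group (homeo_group X)"
proof -
  interpret B: group "BijGroup (topspace X)" by (rule group_BijGroup)
  let ?C = "{f \<in> Bij (topspace X). homeomorphic_map X X f}"
  have "subgroup ?C (BijGroup (topspace X))"
  proof (rule B.subgroupI)
    have "homeomorphic_map X X (\<lambda>x\<in>topspace X. x)"
      by (rule homeomorphic_map_eq[of _ _ id]) simp_all
    hence "(\<lambda>x\<in>topspace X. x) \<in> ?C" by (simp add: id_Bij)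
    thus "?C \<noteq> {}" by blast
  next
    fix f assume f: "f \<in> ?C"
    hence inv: "inv\<^bsub>BijGroup (topspace X)\<^esub> f = (\<lambda>x\<in>topspace X. inv_into (topspace X) f x)"
      by (intro inv_BijGroup) simp
    obtain g where g: "homeomorphic_maps X X f g" using f homeomorphic_map_maps by blast
    have "inv_into (topspace X) f x = g x" if "x \<in> topspace X" for x
    proof -
      have "inj_on f (topspace X)" using f by (simp add: Bij_def bij_betw_def)
      moreover have "g x \<in> topspace X" "f (g x) = x"
        using g that unfolding homeomorphic_maps_def continuous_map_def by auto
      ultimately show ?thesis by (metis inv_into_f_f)
    qed
    moreover have "homeomorphic_map X X g" using g homeomorphic_maps_map by blast
    ultimately have "homeomorphic_map X X (\<lambda>x\<in>topspace X. inv_into (topspace X) f x)"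
      by (elim homeomorphic_map_eq) simp
    moreover have "inv\<^bsub>BijGroup (topspace X)\<^esub> f \<in> Bij (topspace X)" using f B.inv_closed[of f] by simp
    ultimately show "inv\<^bsub>BijGroup (topspace X)\<^esub> f \<in> ?C" by (simp add: inv)
  next
    fix f g assume fg: "f \<in> ?C" "g \<in> ?C"
    hence m: "f \<otimes>\<^bsub>BijGroup (topspace X)\<^esub> g = compose (topspace X) f g" by (simp add: mult_BijGroup)
    have "homeomorphic_map X X (f \<circ> g)" using fg by (auto intro: homeomorphic_map_compose)
    hence "homeomorphic_map X X (compose (topspace X) f g)"
      by (rule homeomorphic_map_eq) (simp add: compose_def)
    thus "f \<otimes>\<^bsub>BijGroup (topspace X)\<^esub> g \<in> ?C" using fg m by (simp add: compose_Bij)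
  qed simp
  from subgroup.subgroup_is_group[OF this B.group_axioms] show ?thesis by (simp add: homeo_group_def)
qed

lemma mem_homeo_group: "f \<in> carrier (homeo_group X) \<longleftrightarrow> f \<in> Bij (topspace X) \<and> homeomorphic_map X X f"
  by (simp add: homeo_group_def)

section \<open>The topology of the subshift\<close>

abbreviation seq_top :: "(int \<Rightarrow> 'l) topology" where
  "seq_top \<equiv> product_topology (\<lambda>_. discrete_topology UNIV) UNIV"

lemma openin_seq_top_iff:
  "openin seq_top U \<longleftrightarrow> (\<forall>\<omega>\<in>U. \<exists>N. \<forall>\<omega>'. agree N \<omega> \<omega>' \<longrightarrow> \<omega>' \<in> U)"
proof
  assume U: "openin seq_top U"
  show "\<forall>\<omega>\<in>U. \<exists>N. \<forall>\<omega>'. agree N \<omega> \<omega>' \<longrightarrow> \<omega>' \<in> U"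
  proof
    fix \<omega> assume "\<omega> \<in> U"
    then obtain V where V: "finite {i. V i \<noteq> UNIV}" "\<omega> \<in> PiE UNIV V" "PiE UNIV V \<subseteq> U"
      using U unfolding openin_product_topology_alt by auto
    obtain N where N: "\<And>i. V i \<noteq> UNIV \<Longrightarrow> \<bar>i\<bar> \<le> int N"
    proof -
      have "finite ((\<lambda>i. nat \<bar>i\<bar>) ` {i. V i \<noteq> UNIV})" using V(1) by simp
      then obtain N where "\<forall>n\<in>(\<lambda>i. nat \<bar>i\<bar>) ` {i. V i \<noteq> UNIV}. n \<le> N" using finite_nat_set_iff_bounded_le by blast
      thus thesis by (intro that[of N]) auto
    qed
    have "\<omega>' \<in> PiE UNIV V" if "agree N \<omega> \<omega>'" for \<omega>'
    proof (rule PiE_I)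
      fix i
      show "\<omega>' i \<in> V i" using PiE_mem[OF V(2), of i] N[of i] agreeD[OF that, of i] by (cases "V i = UNIV") auto
    qed simp
    thus "\<exists>N. \<forall>\<omega>'. agree N \<omega> \<omega>' \<longrightarrow> \<omega>' \<in> U" using V(3) by blast
  qed
next
  assume U: "\<forall>\<omega>\<in>U. \<exists>N. \<forall>\<omega>'. agree N \<omega> \<omega>' \<longrightarrow> \<omega>' \<in> U"
  show "openin seq_top U"
    unfolding openin_product_topology_alt
  proof (intro conjI ballI)
    fix \<omega> assume "\<omega> \<in> U"
    then obtain N where N: "\<forall>\<omega>'. agree N \<omega> \<omega>' \<longrightarrow> \<omega>' \<in> U" using U by blast
    let ?V = "\<lambda>i. if \<bar>i\<bar> \<le> int N then {\<omega> i} else UNIV"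
    have "{i. \<bar>i\<bar> \<le> int N} = {- int N..int N}" by auto
    hence "finite {i. ?V i \<noteq> UNIV}" by (rule_tac finite_subset[of _ "{i. \<bar>i\<bar> \<le> int N}"]) auto
    moreover have "\<omega>' \<in> U" if "\<omega>' \<in> PiE UNIV ?V" for \<omega>'
    proof -
      have "\<omega> i = \<omega>' i" if "\<bar>i\<bar> \<le> int N" for i using PiE_mem[OF \<open>\<omega>' \<in> PiE UNIV ?V\<close>, of i] that by simp
      thus ?thesis using N by (simp add: agree_def)
    qed
    ultimately show "\<exists>V. finite {i \<in> UNIV. V i \<noteq> topspace (discrete_topology UNIV)} \<and>
        (\<forall>i\<in>UNIV. openin (discrete_topology UNIV) (V i)) \<and> \<omega> \<in> PiE UNIV V \<and> PiE UNIV V \<subseteq> U"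
      by (intro exI[of _ ?V]) auto
  qed
qed

lemma topspace_Omega [simp]: "topspace Omega_top = Omega_tau"
  by (simp add: Omega_top_def)

lemma openin_Omega_iff:
  "openin Omega_top U \<longleftrightarrow> U \<subseteq> Omega_tau \<and> (\<forall>\<omega>\<in>U. \<exists>N. \<forall>\<omega>'\<in>Omega_tau. agree N \<omega> \<omega>' \<longrightarrow> \<omega>' \<in> U)"
proof
  assume "openin Omega_top U"
  then obtain T where T: "openin seq_top T" "U = T \<inter> Omega_tau"
    unfolding Omega_top_def openin_subtopology by blast
  thus "U \<subseteq> Omega_tau \<and> (\<forall>\<omega>\<in>U. \<exists>N. \<forall>\<omega>'\<in>Omega_tau. agree N \<omega> \<omega>' \<longrightarrow> \<omega>' \<in> U)"
    unfolding openin_seq_top_iff by blast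
next
  assume U: "U \<subseteq> Omega_tau \<and> (\<forall>\<omega>\<in>U. \<exists>N. \<forall>\<omega>'\<in>Omega_tau. agree N \<omega> \<omega>' \<longrightarrow> \<omega>' \<in> U)"
  define T where "T = {\<omega>. \<exists>N. \<forall>\<omega>'\<in>Omega_tau. agree N \<omega> \<omega>' \<longrightarrow> \<omega>' \<in> U}"
  have "openin seq_top T"
    unfolding openin_seq_top_iff
  proof
    fix \<omega> assume "\<omega> \<in> T"
    then obtain N where N: "\<forall>\<omega>'\<in>Omega_tau. agree N \<omega> \<omega>' \<longrightarrow> \<omega>' \<in> U" unfolding T_def by blast
    have "\<omega>' \<in> T" if "agree N \<omega> \<omega>'" for \<omega>'
      using N agree_trans[OF that] unfolding T_def by blast
    thus "\<exists>N. \<forall>\<omega>'. agree N \<omega> \<omega>' \<longrightarrow> \<omega>' \<in> T" by blast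
  qed
  moreover have "U = T \<inter> Omega_tau" using U unfolding T_def by auto
  ultimately show "openin Omega_top U" unfolding Omega_top_def openin_subtopology by blast
qed

text \<open>A failure of the window criterion is visible in a single window, so the complement of
  \<open>Omega_tau\<close> is open in a compact product.\<close>

lemma compact_Omega: "compact_space Omega_top"
proof -
  have "openin seq_top (- Omega_tau)"
    unfolding openin_seq_top_iff
  proof
    fix \<omega> assume "\<omega> \<in> - Omega_tau"
    hence "\<not> (\<forall>N. \<exists>q>int N. agree N \<omega> (\<lambda>i. ruler (q + i)))" by (simp only: Omega_tau_iff[symmetric] Compl_iff simp_thms)
    then obtain N where N: "\<not> (\<exists>q>int N. agree N \<omega> (\<lambda>i. ruler (q + i)))" by blast
    have "\<omega>' \<notin> Omega_tau" if "agree N \<omega> \<omega>'" for \<omega>'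
      using N agree_trans[OF that] unfolding Omega_tau_iff by blast
    thus "\<exists>N. \<forall>\<omega>'. agree N \<omega> \<omega>' \<longrightarrow> \<omega>' \<in> - Omega_tau" by blast
  qed
  hence "closedin seq_top Omega_tau" by (simp add: closedin_def Compl_eq_Diff_UNIV)
  moreover have "compact_space (seq_top :: (int \<Rightarrow> letter) topology)"
    by (auto simp: compact_space_product_topology compact_space_discrete_topology)
  ultimately show ?thesis
    unfolding Omega_top_def by (simp add: closedin_compact_space compact_space_subtopology)
qed

lemma Hausdorff_Omega: "Hausdorff_space Omega_top"
  unfolding Omega_top_def
  by (intro Hausdorff_space_subtopology) (simp add: Hausdorff_space_product_topology)

lemma continuous_map_OmegaI:
  assumes "\<And>\<omega>. \<omega> \<in> Omega_tau \<Longrightarrow> f \<omega> \<in> topspace Y"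
    and "\<And>\<omega> U. \<omega> \<in> Omega_tau \<Longrightarrow> openin Y U \<Longrightarrow> f \<omega> \<in> U \<Longrightarrow>
      \<exists>N. \<forall>\<omega>'\<in>Omega_tau. agree N \<omega> \<omega>' \<longrightarrow> f \<omega>' \<in> U"
  shows "continuous_map Omega_top Y f"
  unfolding continuous_map_def openin_Omega_iff using assms by auto

text \<open>The number \<open>k\<close> is how far the map looks beyond a window, uniformly in the
  point.\<close>

lemma continuous_map_Omega_OmegaI:
  assumes "\<And>\<omega>. \<omega> \<in> Omega_tau \<Longrightarrow> f \<omega> \<in> Omega_tau"
    and "\<And>N \<omega> \<omega>'. \<omega> \<in> Omega_tau \<Longrightarrow> \<omega>' \<in> Omega_tau \<Longrightarrow> agree (N + k) \<omega> \<omega>' \<Longrightarrow> agree N (f \<omega>) (f \<omega>')"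
  shows "continuous_map Omega_top Omega_top f"
proof (rule continuous_map_OmegaI)
  fix \<omega> U assume w: "\<omega> \<in> Omega_tau" "openin Omega_top U" "f \<omega> \<in> U"
  then obtain N where "\<forall>\<omega>'\<in>Omega_tau. agree N (f \<omega>) \<omega>' \<longrightarrow> \<omega>' \<in> U" unfolding openin_Omega_iff by blast
  thus "\<exists>N. \<forall>\<omega>'\<in>Omega_tau. agree N \<omega> \<omega>' \<longrightarrow> f \<omega>' \<in> U"
    using assms w(1) by (intro exI[of _ "N + k"]) blast
qed (use assms in simp)

section \<open>The group H and the isomorphism from G\<close>

lemma foldr_H_gen_append_Omega:
  "\<omega> \<in> Omega_tau \<Longrightarrow> foldr H_gen (rev w) (foldr H_gen w \<omega>) = \<omega>"
  using foldr_H_gen[of \<omega> "rev w @ w"] foldr_rev_cancel[OF involutive_Omega, of \<omega> w 1] by simp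

lemma H_gen_H_gen: "\<omega> \<in> Omega_tau \<Longrightarrow> H_gen s (H_gen s \<omega>) = \<omega>"
  using foldr_H_gen_append_Omega[of \<omega> "[s]"] by simp

lemma H_gen_Bij: "H_gen s \<in> Bij Omega_tau"
proof (rule inv_into_involution_Bij)
  show "H_gen s \<in> extensional Omega_tau" by (simp add: H_gen_def flip_along_def)
qed (simp_all add: H_gen_Omega H_gen_H_gen)

lemma agree_shift: "agree (Suc N) \<omega> \<omega>' \<Longrightarrow> agree N (shift \<omega>) (shift \<omega>')"
  and agree_shift_inv: "agree (Suc N) \<omega> \<omega>' \<Longrightarrow> agree N (shift_inv \<omega>) (shift_inv \<omega>')"
  by (auto simp: agree_def shift_def shift_inv_def)

lemma homeomorphic_H_gen: "homeomorphic_map Omega_top Omega_top (H_gen s)"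
proof -
  have "continuous_map Omega_top Omega_top (H_gen s)"
  proof (rule continuous_map_Omega_OmegaI[where k = 1])
    fix N \<omega> \<omega>' assume w: "\<omega> \<in> Omega_tau" "\<omega>' \<in> Omega_tau" "agree (N + 1) \<omega> \<omega>'"
    hence "\<omega> 0 = \<omega>' 0" "\<omega> 1 = \<omega>' 1" by (auto intro: agreeD[of "N + 1"])
    thus "agree N (H_gen s \<omega>) (H_gen s \<omega>')"
      using w agree_shift[of N \<omega> \<omega>'] agree_shift_inv[of N \<omega> \<omega>'] agree_mono[OF w(3), of N]
      by (simp add: H_gen_def flip_along_def)
  qed (rule H_gen_Omega)
  hence "homeomorphic_maps Omega_top Omega_top (H_gen s) (H_gen s)"
    by (simp add: homeomorphic_maps_def H_gen_H_gen)
  thus ?thesis using homeomorphic_map_maps by blast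
qed

lemma H_gen_homeo_group: "H_gen s \<in> carrier (homeo_group Omega_top)"
  by (simp add: mem_homeo_group H_gen_Bij homeomorphic_H_gen)

lemma homeo_group_simps:
  "mult (homeo_group X) = mult (BijGroup (topspace X))" "\<one>\<^bsub>homeo_group X\<^esub> = \<one>\<^bsub>BijGroup (topspace X)\<^esub>"
  by (simp_all add: homeo_group_def)

lemma carrier_H_group: "carrier H_group = range (\<lambda>w. restrict (foldr H_gen w) Omega_tau)"
proof -
  interpret group "homeo_group Omega_top" by (rule group_homeo_group)
  have "H_gen s \<otimes>\<^bsub>homeo_group Omega_top\<^esub> H_gen s = \<one>\<^bsub>homeo_group Omega_top\<^esub>" for s
    unfolding homeo_group_simps
    by (auto simp: mult_BijGroup one_BijGroup H_gen_Bij compose_def restrict_def H_gen_H_gen)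
  from carrier_generated_by_involutions[of H_gen, OF H_gen_homeo_group this]
  have "carrier H_group = range (\<lambda>w. foldr (\<lambda>s. mult (homeo_group Omega_top) (H_gen s)) w \<one>\<^bsub>homeo_group Omega_top\<^esub>)"
    by (simp add: H_group_def)
  also have "\<dots> = range (\<lambda>w. restrict (foldr H_gen w) Omega_tau)"
    using word_BijGroup(1)[of H_gen Omega_tau, OF H_gen_Bij] unfolding homeo_group_simps by simp
  finally show ?thesis .
qed

lemma foldr_H_gen_Bij: "restrict (foldr H_gen w) Omega_tau \<in> Bij Omega_tau"
  by (rule word_BijGroup(2)[OF H_gen_Bij])

lemma compose_foldr_H_gen:
  "compose Omega_tau (restrict (foldr H_gen w) Omega_tau) (restrict (foldr H_gen w') Omega_tau)
     = restrict (foldr H_gen (w @ w')) Omega_tau"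
  by (auto simp: compose_def restrict_def foldr_H_gen_Omega)

lemma mult_H_group: "restrict (foldr H_gen w) Omega_tau \<otimes>\<^bsub>H_group\<^esub> restrict (foldr H_gen w') Omega_tau
     = restrict (foldr H_gen (w @ w')) Omega_tau"
  by (simp add: H_group_def homeo_group_simps mult_BijGroup foldr_H_gen_Bij compose_foldr_H_gen)

text \<open>Two words agree iff \<open>rev w' @ w\<close> is trivial, on either side. This gives
  both that \<open>rho\<close> is well defined and that it is injective.\<close>

lemma words_equal_iff:
  "foldr G_gen w = foldr G_gen w' \<longleftrightarrow> restrict (foldr H_gen w) Omega_tau = restrict (foldr H_gen w') Omega_tau"
proof -
  have "foldr G_gen w = foldr G_gen w' \<longleftrightarrow> foldr G_gen (rev w' @ w) = id"
    using foldr_eq_iff_stab[OF involutive_G_gen, of w _ w'] by (auto simp: fun_eq_iff stab_def)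
  also have "\<dots> \<longleftrightarrow> (\<forall>\<omega>\<in>Omega_tau. foldr H_gen (rev w') (foldr H_gen w \<omega>) = \<omega>)"
    by (simp add: word_trivial_iff)
  also have "\<dots> \<longleftrightarrow> (\<forall>\<omega>\<in>Omega_tau. foldr H_gen w \<omega> = foldr H_gen w' \<omega>)"
  proof (intro ball_cong refl)
    fix \<omega> assume w: "\<omega> \<in> Omega_tau"
    show "foldr H_gen (rev w') (foldr H_gen w \<omega>) = \<omega> \<longleftrightarrow> foldr H_gen w \<omega> = foldr H_gen w' \<omega>"
      using foldr_H_gen_append_Omega[OF w, of w']
        foldr_H_gen_append_Omega[OF foldr_H_gen_Omega[OF w, of w], of "rev w'"] by auto
  qed
  also have "\<dots> \<longleftrightarrow> restrict (foldr H_gen w) Omega_tau = restrict (foldr H_gen w') Omega_tau"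
    by (auto simp: restrict_def fun_eq_iff)
  finally show ?thesis .
qed

text \<open>Defined through a chosen word for \<open>g\<close>; \<open>words_equal_iff\<close> makes
  the choice immaterial.\<close>

definition rho :: "(bool list \<Rightarrow> bool list) \<Rightarrow> (int \<Rightarrow> letter) \<Rightarrow> int \<Rightarrow> letter" where
  "rho g = restrict (foldr H_gen (SOME w. g = foldr G_gen w)) Omega_tau"

lemma rho_foldr: "rho (foldr G_gen w) = restrict (foldr H_gen w) Omega_tau"
proof -
  have "foldr G_gen w = foldr G_gen (SOME w'. foldr G_gen w = foldr G_gen w')" by (rule someI) (rule refl)
  thus ?thesis unfolding rho_def by (rule iffD1[OF words_equal_iff, symmetric])
qed

lemma rho_G_gen: "rho (G_gen s) = H_gen s"
proof -
  have "rho (foldr G_gen [s]) = restrict (foldr H_gen [s]) Omega_tau" by (rule rho_foldr)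
  moreover have "foldr G_gen [s] = G_gen s" by (simp add: fun_eq_iff)
  moreover have "restrict (foldr H_gen [s]) Omega_tau = H_gen s"
    by (simp add: H_gen_def flip_along_def restrict_def fun_eq_iff)
  ultimately show ?thesis by simp
qed

lemma rho_iso: "rho \<in> iso G_group H_group"
proof -
  have "inj_on rho (carrier G_group)"
    unfolding inj_on_def carrier_G_group by (auto simp: rho_foldr words_equal_iff simp del: restrict_apply)
  moreover have "rho ` carrier G_group = carrier H_group"
    unfolding carrier_G_group carrier_H_group image_image rho_foldr ..
  moreover have "rho \<in> hom G_group H_group"
    unfolding hom_def carrier_G_group carrier_H_group
    by (auto simp: rho_foldr mult_G_group mult_H_group simp del: foldr_append restrict_apply)
  ultimately show ?thesis unfolding iso_def bij_betw_def by blast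
qed

lemma homeomorphic_foldr_H_gen: "homeomorphic_map Omega_top Omega_top (restrict (foldr H_gen w) Omega_tau)"
proof -
  have "homeomorphic_map Omega_top Omega_top (foldr H_gen w)"
  proof (induction w)
    case Nil
    show ?case using homeomorphic_map_id[of Omega_top Omega_top] by (simp add: id_def)
  next
    case (Cons s w)
    have "homeomorphic_map Omega_top Omega_top (H_gen s \<circ> foldr H_gen w)"
      by (rule homeomorphic_map_compose[OF Cons homeomorphic_H_gen])
    thus ?case by (simp add: o_def)
  qed
  from homeomorphic_map_restrict[OF this] show ?thesis by simp
qed

lemma rho_hom: "rho \<in> hom G_group (BijGroup Omega_tau)"
proof (rule homI)
  fix g assume "g \<in> carrier G_group"
  then obtain w where "g = foldr G_gen w" unfolding carrier_G_group by blast
  thus "rho g \<in> carrier (BijGroup Omega_tau)" by (simp only: rho_foldr carrier_BijGroup foldr_H_gen_Bij)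
next
  fix g g' assume "g \<in> carrier G_group" "g' \<in> carrier G_group"
  then obtain w w' where w: "g = foldr G_gen w" "g' = foldr G_gen w'" unfolding carrier_G_group by blast
  show "rho (g \<otimes>\<^bsub>G_group\<^esub> g') = rho g \<otimes>\<^bsub>BijGroup Omega_tau\<^esub> rho g'"
    by (simp only: w mult_G_group rho_foldr mult_BijGroup foldr_H_gen_Bij compose_foldr_H_gen)
qed

lemma dyn_system_Omega: "dyn_system G_group Omega_top rho"
  unfolding dyn_system_def
proof (intro conjI ballI)
  show "group_action G_group (topspace Omega_top) rho"
    unfolding group_action_def group_hom_def group_hom_axioms_def
    by (simp only: topspace_Omega group_G_group group_BijGroup rho_hom simp_thms)
  fix g assume "g \<in> carrier G_group"
  then obtain w where "g = foldr G_gen w" unfolding carrier_G_group by blast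
  thus "homeomorphic_map Omega_top Omega_top (rho g)"
    by (simp only: rho_foldr homeomorphic_foldr_H_gen)
qed (rule compact_Omega, rule Hausdorff_Omega)


section \<open>The space of Schreier graphs\<close>

lemma stab_foldr_iff:
  "involutive \<sigma> \<Longrightarrow> v \<in> stab \<sigma> (foldr \<sigma> w u) \<longleftrightarrow> rev w @ v @ w \<in> stab \<sigma> u"
  using foldr_eq_iff_stab[of \<sigma> "v @ w" u w] by (simp add: stab_def)

lemma range_ray_G_star: "range (cls boundary_gen) \<subseteq> G_star"
  by (auto intro: cls_G_star)

lemma Schreier_closure_eq_closure: "Schreier_closure = G_star_top closure_of range (cls boundary_gen)"
  by (simp add: Schreier_closure_def Schreier_eq cls_def[abs_def])

lemma Schreier_closure_subset: "Schreier_closure \<subseteq> G_star"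
  unfolding Schreier_closure_eq_closure using closure_of_subset_topspace by fastforce

lemma involutive_line_hull: "\<omega> \<in> line_hull \<Longrightarrow> involutive (lstep \<omega>)"
  by (intro involutive_lstep alternating_hull)

text \<open>A limit class \<open>p\<close> is approximated by half-lines rooted at
  \<open>m r\<close>. The lines themselves have a cluster point, and the class of that line has the
  same balls as \<open>p\<close>.\<close>

lemma Schreier_closure_line_hull: "Schreier_closure = (\<lambda>\<omega>. cls (lstep \<omega>) 1) ` line_hull"
proof
  show "(\<lambda>\<omega>. cls (lstep \<omega>) 1) ` line_hull \<subseteq> Schreier_closure"
  proof
    fix p assume "p \<in> (\<lambda>\<omega>. cls (lstep \<omega>) 1) ` line_hull"
    then obtain \<omega> where w: "\<omega> \<in> line_hull" "p = cls (lstep \<omega>) 1" by blast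
    have "\<exists>q\<in>range (cls boundary_gen). same_ball r p q" for r
    proof -
      obtain m where m: "agree (2 * r + 2) \<omega> (\<lambda>i. half_ruler (i + int m))"
        using w(1) unfolding line_hull_def by blast
      have "same_ball r p (cls boundary_gen (ray m))"
        unfolding cls_ray w(2)
        by (rule same_ball_lstep_agree[OF alternating_hull[OF w(1)]
              alternating_translate[OF alternating_half_ruler] m]) simp
      thus ?thesis by blast
    qed
    moreover have "p \<in> G_star" unfolding w(2) by (rule cls_G_star[OF involutive_line_hull[OF w(1)]])
    ultimately show "p \<in> Schreier_closure"
      unfolding Schreier_closure_eq_closure in_closure_G_star_iff[OF range_ray_G_star] by blast
  qed
  show "Schreier_closure \<subseteq> (\<lambda>\<omega>. cls (lstep \<omega>) 1) ` line_hull"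
  proof
    fix p assume "p \<in> Schreier_closure"
    hence p: "p \<in> G_star" "\<And>r. \<exists>q\<in>range (cls boundary_gen). same_ball r p q"
      unfolding Schreier_closure_eq_closure in_closure_G_star_iff[OF range_ray_G_star] by auto
    have "\<exists>m. same_ball r p (cls boundary_gen (ray m))" for r
    proof -
      obtain \<xi> where \<xi>: "same_ball r p (cls boundary_gen \<xi>)" using p(2) by blast
      \<comment> \<open>Balls of radius \<open>r\<close> require agreement on words up to length
        \<open>2 * r + 1\<close>, not just \<open>r\<close>.\<close>
      obtain m where "\<forall>w. length w \<le> 2 * r + 1 \<longrightarrow>
          (w \<in> stab boundary_gen \<xi> \<longleftrightarrow> w \<in> stab boundary_gen (ray m))"
        using stab_boundary_approx by blast
      hence "same_ball r (cls boundary_gen \<xi>) (cls boundary_gen (ray m))"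
        by (intro same_ball_clsI) auto
      hence "same_ball r p (cls boundary_gen (ray m))"
        by (intro same_ball_trans[OF p(1) _ _ \<xi>] cls_G_star involutive_boundary_gen)
      thus ?thesis ..
    qed
    then obtain m where m: "\<And>r. same_ball r p (cls boundary_gen (ray (m r)))" by metis
    define f where "f r = (\<lambda>i. half_ruler (i + int (m r)))" for r
    have f: "f r \<in> line_hull" for r by (simp add: f_def half_ruler_hull)
    obtain \<omega> where w: "\<And>N. \<exists>r\<ge>N. agree N (f r) \<omega>" using sequence_limit[of f] by blast
    have hull: "\<omega> \<in> line_hull" unfolding line_hull_def
    proof (intro CollectI allI)
      fix N
      obtain r where "agree N (f r) \<omega>" using w by blast
      hence "agree N \<omega> (f r)" by (rule agree_sym)
      thus "\<exists>k. agree N \<omega> (\<lambda>i. half_ruler (i + int k))" unfolding f_def by blast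
    qed
    have "same_ball r p (cls (lstep \<omega>) 1)" for r
    proof -
      obtain r' where r': "r' \<ge> 2 * r + 2" "agree (2 * r + 2) (f r') \<omega>" using w by blast
      have 1: "same_ball r (cls (lstep (f r')) 1) (cls (lstep \<omega>) 1)"
        by (rule same_ball_lstep_agree[OF alternating_hull[OF f] alternating_hull[OF hull] r'(2)]) simp
      have G: "cls (lstep (f r')) 1 \<in> G_star" "cls (lstep \<omega>) 1 \<in> G_star"
        by (intro cls_G_star involutive_line_hull f hull)+
      have "same_ball r' p (cls (lstep (f r')) 1)" using m[of r'] by (simp add: cls_ray f_def)
      hence "same_ball r p (cls (lstep (f r')) 1)"
        by (rule same_ball_mono[OF p(1) G(1)]) (use r'(1) in simp)
      thus ?thesis by (rule same_ball_trans[OF p(1) G _ 1])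
    qed
    hence "p = cls (lstep \<omega>) 1" by (rule eq_cls_if_same_balls[OF p(1) involutive_line_hull[OF hull]])
    thus "p \<in> (\<lambda>\<omega>. cls (lstep \<omega>) 1) ` line_hull" using hull by blast
  qed
qed

section \<open>Lines, half-lines and isolated points\<close>

definition half_cls :: "nat \<Rightarrow> gclass" where
  "half_cls m = cls (lstep half_ruler) (int m + 1)"

lemma involutive_half_ruler [simp]: "involutive (lstep half_ruler)"
  by (intro involutive_lstep alternating_half_ruler)

lemma cls_ray_half_cls: "cls boundary_gen (ray m) = half_cls m"
  unfolding half_cls_def
  by (intro cls_eqI) (simp_all add: stab_ray stab_lstep_translate add.commute)

text \<open>For negative \<open>j\<close> the root lies on the left half-line, which the symmetry of
  the ruler sequence reflects onto the right one.\<close>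

lemma half_cls_cases: "\<exists>m. cls (lstep (\<lambda>i. half_ruler (i + j))) 1 = half_cls m"
proof -
  have inv: "involutive (lstep (\<lambda>i. half_ruler (i + j)))"
    by (intro involutive_lstep alternating_translate alternating_half_ruler)
  have st: "stab (lstep (\<lambda>i. half_ruler (i + j))) 1 = stab (lstep half_ruler) (1 + j)"
    by (rule stab_lstep_translate)
  have refl: "(\<lambda>i. half_ruler (- i)) = half_ruler" by (auto simp: half_ruler_def)
  have "stab (lstep half_ruler) (1 + j) = stab (lstep half_ruler) (- j)"
    using stab_lstep_reflect[OF alternating_half_ruler, of "1 + j"] unfolding refl by simp
  hence "\<exists>m. stab (lstep half_ruler) (1 + j) = stab (lstep half_ruler) (int m + 1)"
  proof (cases "j \<ge> 0")
    case True
    thus ?thesis by (intro exI[of _ "nat j"]) (simp add: add.commute)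
  next
    case False
    thus ?thesis using \<open>stab (lstep half_ruler) (1 + j) = _\<close> by (intro exI[of _ "nat (- j - 1)"]) simp
  qed
  thus ?thesis unfolding half_cls_def using inv st by (metis cls_eqI involutive_half_ruler)
qed

lemma Gr_closure: "\<omega> \<in> Omega_tau \<Longrightarrow> Gr \<omega> \<in> Schreier_closure"
  unfolding Schreier_closure_line_hull by (auto simp: Gr_eq_cls intro: Omega_hull)

lemma half_cls_closure: "half_cls m \<in> Schreier_closure"
  unfolding Schreier_closure_eq_closure cls_ray_half_cls[symmetric]
  using closure_of_subset[of "range (cls boundary_gen)" G_star_top] range_ray_G_star by auto

lemma Schreier_closure_cases:
  assumes "p \<in> Schreier_closure"
  obtains \<omega> where "\<omega> \<in> Omega_tau" "p = Gr \<omega>" | m where "p = half_cls m"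
proof -
  obtain \<omega> where w: "\<omega> \<in> line_hull" "p = cls (lstep \<omega>) 1"
    using assms unfolding Schreier_closure_line_hull by blast
  from w(1) show thesis
  proof (cases rule: hull_cases)
    case (1 \<omega>')
    thus thesis using w(2) that(1) Gr_eq_cls by metis
  next
    case (2 j)
    thus thesis using w(2) that(2) half_cls_cases[of j] by metis
  qed
qed

lemma nat_step_nat_step: "nat_step s (nat_step s m) = m"
proof -
  have "lstep half_ruler s (lstep half_ruler s (int m + 1)) = int m + 1" by simp
  thus ?thesis unfolding lstep_half_ruler by simp
qed

lemma path_to_end: "\<exists>w. foldr (lstep half_ruler) w (int m + 1) = 1"
proof -
  have "\<exists>w. foldr nat_step w m = 0"
  proof (induction m)
    case 0
    show ?case by (intro exI[of _ "[]"]) simp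
  next
    case (Suc m)
    then obtain w where w: "foldr nat_step w m = 0" ..
    obtain s where "ruler (int m + 1) \<in> edge_letters s" using edge_letters_exist by blast
    hence "nat_step s m = Suc m" by (simp add: nat_step_def)
    hence "nat_step s (Suc m) = m" using nat_step_nat_step[of s m] by simp
    thus ?case using w by (intro exI[of _ "w @ [s]"]) simp
  qed
  then obtain w where "foldr nat_step w m = 0" ..
  thus ?thesis using foldr_lstep_half_ruler[of w m] by (intro exI[of _ w]) simp
qed

text \<open>If both letters at the vertex were present, one of them would be x, y or z and carry two
  of the labels b, c, d, which then could not all be loops.\<close>

lemma end_if_loops:
  assumes "alternating \<omega>" "\<And>s. s \<noteq> Ga \<Longrightarrow> lstep \<omega> s n = n"
  shows "\<omega> n = None \<or> \<omega> (n - 1) = None"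
proof (rule ccontr)
  assume "\<not> ?thesis"
  then obtain l l' where l: "\<omega> n = Some l" "\<omega> (n - 1) = Some l'" by auto
  have "\<omega> (n - 1 + 1) = Some La \<longleftrightarrow> \<omega> (n - 1) \<noteq> Some La"
    using assms(1) unfolding alternating_def by blast
  hence "l = La \<longleftrightarrow> l' \<noteq> La" using l by simp
  moreover have "l \<notin> edge_letters s \<and> l' \<notin> edge_letters s" if "s \<noteq> Ga" for s
    using assms(2)[OF that] l by (auto simp: lstep_def split: if_splits)
  from this[of Gb] this[of Gc] have "l \<notin> {Lx, Ly, Lz}" "l' \<notin> {Lx, Ly, Lz}" by auto
  ultimately show False by (cases l; cases l') auto
qed

lemma loops_at_end: "s \<noteq> Ga \<Longrightarrow> lstep half_ruler s 1 = 1"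
  by (auto simp: lstep_def half_ruler_def ruler_odd)

text \<open>Expresses a loop at a remote vertex by a word at the root, so that balls and stabilisers
  can detect the end of a half-line.\<close>

lemma loop_words:
  "involutive \<sigma> \<Longrightarrow> rev w @ s # w \<in> stab \<sigma> v \<longleftrightarrow> \<sigma> s (foldr \<sigma> w v) = foldr \<sigma> w v"
  using foldr_eq_iff_stab[of \<sigma> "s # w" v w] by simp

lemma no_loops_Omega:
  assumes "\<omega> \<in> Omega_tau" "\<And>s. s \<noteq> Ga \<Longrightarrow> rev w @ s # w \<in> stab (lstep (full \<omega>)) 1"
  shows False
  using end_if_loops[OF alternating_Omega[OF assms(1)], of "foldr (lstep (full \<omega>)) w 1"] assms
  by (simp add: loop_words)

lemma Gr_ne_half_cls:
  assumes "\<omega> \<in> Omega_tau"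
  shows "Gr \<omega> \<noteq> half_cls m"
proof
  assume "Gr \<omega> = half_cls m"
  hence st: "stab (lstep (full \<omega>)) 1 = stab (lstep half_ruler) (int m + 1)"
    using assms by (simp add: Gr_eq_cls half_cls_def cls_eq_iff)
  obtain w where "foldr (lstep half_ruler) w (int m + 1) = 1" using path_to_end by blast
  thus False using no_loops_Omega[OF assms, of w] loops_at_end unfolding st by (simp add: loop_words)
qed

lemma Gr_G_star: "\<omega> \<in> Omega_tau \<Longrightarrow> Gr \<omega> \<in> G_star"
  by (simp add: Gr_eq_cls cls_G_star)

text \<open>Half-lines rooted far from their end look like the line of \<open>\<omega>\<close> near
  the root, yet their classes are never equal to \<open>Gr \<omega>\<close>.\<close>

lemma Gr_not_isolated:
  assumes "\<omega> \<in> Omega_tau"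
  shows "\<not> openin (subtopology G_star_top Schreier_closure) {Gr \<omega>}"
proof
  assume "openin (subtopology G_star_top Schreier_closure) {Gr \<omega>}"
  then obtain U where U: "openin G_star_top U" "{Gr \<omega>} = U \<inter> Schreier_closure"
    unfolding openin_subtopology by blast
  then obtain r where r: "\<forall>q\<in>G_star. same_ball r (Gr \<omega>) q \<longrightarrow> q \<in> U"
    unfolding openin_G_star_iff by blast
  obtain m where m: "agree (2 * r + 2) (full \<omega>) (\<lambda>i. half_ruler (i + int m))"
    using Omega_hull[OF assms] unfolding line_hull_def by blast
  have "same_ball r (Gr \<omega>) (cls (lstep (\<lambda>i. half_ruler (i + int m))) 1)"
    unfolding Gr_eq_cls[OF assms]
    by (rule same_ball_lstep_agree[OF alternating_Omega[OF assms]
          alternating_translate[OF alternating_half_ruler] m]) simp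
  hence "half_cls m \<in> U"
    using r half_cls_closure[of m] Schreier_closure_subset by (auto simp: cls_ray[symmetric] cls_ray_half_cls)
  hence "half_cls m = Gr \<omega>" using U(2) half_cls_closure[of m] by blast
  thus False using Gr_ne_half_cls[OF assms] by metis
qed

text \<open>A large ball shows three loops at the end of the path \<open>w\<close>. This excludes
  lines, and in any other half-line the same path leads to the end, so walking it back finds the
  same root.\<close>

lemma half_cls_isolated: "openin (subtopology G_star_top Schreier_closure) {half_cls m}"
proof -
  obtain w where w: "foldr (lstep half_ruler) w (int m + 1) = 1" using path_to_end by blast
  \<comment> \<open>The length of the words \<open>rev w @ s # w\<close> that witness the three
    loops.\<close>
  define r where "r = 2 * length w + 1"
  have G: "half_cls m \<in> G_star" by (simp add: half_cls_def cls_G_star)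
  have "q = half_cls m" if "q \<in> Schreier_closure" "same_ball r (half_cls m) q" for q
    using that(1)
  proof (cases rule: Schreier_closure_cases)
    case (1 \<omega>)
    have "rev w @ s # w \<in> stab (lstep (full \<omega>)) 1" if "s \<noteq> Ga" for s
    proof -
      have "rev w @ s # w \<in> stab (lstep half_ruler) (int m + 1)"
        using w loops_at_end[OF that] by (simp add: loop_words)
      thus ?thesis using same_ball_clsD[of "lstep half_ruler" "lstep (full \<omega>)" r "int m + 1" 1 "rev w @ s # w"]
          \<open>same_ball r (half_cls m) q\<close> 1 by (simp add: half_cls_def Gr_eq_cls r_def)
    qed
    from no_loops_Omega[OF 1(1) this] show ?thesis by blast
  next
    case (2 m')
    let ?u = "foldr (lstep half_ruler) w (int m' + 1)"
    have "lstep half_ruler s ?u = ?u" if "s \<noteq> Ga" for s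
    proof -
      have "rev w @ s # w \<in> stab (lstep half_ruler) (int m + 1)"
        using w loops_at_end[OF that] by (simp add: loop_words)
      hence "rev w @ s # w \<in> stab (lstep half_ruler) (int m' + 1)"
        using same_ball_clsD[of "lstep half_ruler" "lstep half_ruler" r "int m + 1" "int m' + 1" "rev w @ s # w"]
          \<open>same_ball r (half_cls m) q\<close> 2 by (simp add: half_cls_def r_def)
      thus ?thesis by (simp add: loop_words)
    qed
    hence "half_ruler ?u = None \<or> half_ruler (?u - 1) = None"
      by (rule end_if_loops[OF alternating_half_ruler])
    \<comment> \<open>\<open>None\<close> next to \<open>?u\<close> leaves 0 and 1, the ends of the
      two half-lines; the walk cannot cross the cut and thus ends at 1.\<close>
    moreover have "?u \<ge> 1" unfolding foldr_lstep_half_ruler by simp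
    ultimately have "?u = 1" by (auto simp: half_ruler_def split: if_splits)
    hence "int m' + 1 = int m + 1"
      using w foldr_rev_cancel[OF involutive_half_ruler, of w] by metis
    thus ?thesis using 2 by simp
  qed
  hence "{half_cls m} = {q \<in> G_star. same_ball r (half_cls m) q} \<inter> Schreier_closure"
    using half_cls_closure[of m] same_ball_refl[OF G] G by blast
  thus ?thesis unfolding openin_subtopology using openin_same_ball[OF G] by blast
qed

lemma X_space_eq: "X_space = Gr ` Omega_tau"
proof
  show "X_space \<subseteq> Gr ` Omega_tau"
  proof
    fix p assume p: "p \<in> X_space"
    hence "p \<in> Schreier_closure" by (simp add: X_space_def)
    thus "p \<in> Gr ` Omega_tau"
    proof (cases rule: Schreier_closure_cases)
      case (2 m)
      thus ?thesis using p half_cls_isolated[of m] by (simp add: X_space_def)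
    qed blast
  qed
  show "Gr ` Omega_tau \<subseteq> X_space"
    using Gr_closure Gr_not_isolated by (auto simp: X_space_def)
qed

section \<open>The fibres of the map to graphs\<close>

definition mirror :: "(int \<Rightarrow> letter) \<Rightarrow> int \<Rightarrow> letter" where
  "mirror \<omega> n = \<omega> (1 - n)"

lemma mirror_Omega:
  assumes "\<omega> \<in> Omega_tau"
  shows "mirror \<omega> \<in> Omega_tau"
  unfolding Omega_tau_iff
proof
  fix N
  obtain q where q: "q > int (N + 1)" "agree (N + 1) \<omega> (\<lambda>i. ruler (q + i))"
    using assms by (rule Omega_tauE)
  \<comment> \<open>The reflected window lies at negative positions, where the ruler sequence takes
    the same values; adding a large \<open>2^k\<close> brings it back to positive ones without
    changing a valuation.\<close>
  define k where "k = nat (q + 2 + 2 * int N)"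
  have "int k < 2 ^ k" by (rule int_less_two_pow)
  hence k: "q + 2 + 2 * int N < 2 ^ k" using q(1) by (simp add: k_def)
  have "mirror \<omega> i = ruler (2 ^ k - (q + 1) + i)" if "\<bar>i\<bar> \<le> int N" for i
  proof -
    have "mirror \<omega> i = ruler (q + (1 - i))"
      using that agreeD[OF q(2), of "1 - i"] by (simp add: mirror_def)
    also have "\<dots> = ruler (i - (q + 1))" using ruler_minus[of "q + (1 - i)"] by (simp add: algebra_simps)
    also have "\<dots> = ruler (2 ^ k + (i - (q + 1)))"
      using that q(1) k by (intro ruler_add_pow[of _ k, symmetric]) auto
    finally show ?thesis by (simp add: algebra_simps)
  qed
  thus "\<exists>q>int N. agree N (mirror \<omega>) (\<lambda>i. ruler (q + i))"
    using k q(1) by (intro exI[of _ "2 ^ k - (q + 1)"]) (auto simp: agree_def)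
qed

text \<open>\<open>mirror\<close> reflects the line about its root: vertices by
  \<open>u \<mapsto> 2 - u\<close>, hence gaps and their letters by
  \<open>n \<mapsto> 1 - n\<close>.\<close>

lemma Gr_mirror:
  assumes "\<omega> \<in> Omega_tau"
  shows "Gr (mirror \<omega>) = Gr \<omega>"
proof -
  define \<omega>' where "\<omega>' = (\<lambda>i. full \<omega> (i + 1))"
  have alt: "alternating \<omega>'" unfolding \<omega>'_def by (intro alternating_translate alternating_Omega assms)
  have "full (mirror \<omega>) = (\<lambda>i. \<omega>' (- i))" by (simp add: \<omega>'_def mirror_def fun_eq_iff)
  hence "stab (lstep (full (mirror \<omega>))) 1 = stab (lstep \<omega>') 0"
    using stab_lstep_reflect[OF alt, of 1] by simp
  also have "\<dots> = stab (lstep (full \<omega>)) 1"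
    unfolding \<omega>'_def by (subst stab_lstep_translate) simp
  finally show ?thesis using assms by (simp add: Gr_eq_cls mirror_Omega cls_eq_iff)
qed

lemma edge_letters_eq: "(\<And>s. l \<in> edge_letters s \<longleftrightarrow> l' \<in> edge_letters s) \<Longrightarrow> l = l'"
proof -
  assume *: "\<And>s. l \<in> edge_letters s \<longleftrightarrow> l' \<in> edge_letters s"
  show ?thesis using *[of Ga] *[of Gb] *[of Gc] *[of Gd] by (cases l; cases l') auto
qed

lemma lstep_eq_up: "\<omega> n \<in> edge_letters s \<longleftrightarrow> lstep (full \<omega>) s n = n + 1"
  by (auto simp: lstep_def)

lemma lstep_eq_down:
  assumes "\<omega> \<in> Omega_tau"
  shows "\<omega> (n - 1) \<in> edge_letters s \<longleftrightarrow> lstep (full \<omega>) s n = n - 1"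
  using lstep_excl(1)[OF alternating_Omega[OF assms], of "n - 1" s] by (auto simp: lstep_def)

text \<open>Turning round would revisit the previous vertex, so an injective walk with unit steps
  keeps its direction.\<close>

lemma path_in_integers:
  fixes f :: "int \<Rightarrow> int"
  assumes "inj f" "\<And>n. \<bar>f (n + 1) - f n\<bar> = 1"
  obtains "\<And>n. f n = f 1 + (n - 1)" | "\<And>n. f n = f 1 - (n - 1)"
proof -
  define d where "d n = f (n + 1) - f n" for n
  have step: "d (n + 1) = d n" for n
  proof -
    have "f (n + 1 + 1) \<noteq> f n" by (simp add: inj_eq[OF assms(1)])
    thus ?thesis using assms(2)[of n] assms(2)[of "n + 1"] unfolding d_def by linarith
  qed
  have const: "d n = d 1" for n
  proof (induction n rule: int_induct[where k = 1])
    case (step2 i)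
    thus ?case using step[of "i - 1"] by simp
  qed (simp_all add: step)
  have eq: "f n = f 1 + d 1 * (n - 1)" for n
  proof (induction n rule: int_induct[where k = 1])
    case (step1 i)
    thus ?case using const[of i] unfolding d_def[of i] by (simp add: algebra_simps)
  next
    case (step2 i)
    thus ?case using const[of "i - 1"] unfolding d_def[of "i - 1"] by (simp add: algebra_simps)
  qed simp
  have "\<bar>d 1\<bar> = 1" unfolding d_def by (rule assms(2))
  hence "d 1 = 1 \<or> d 1 = - 1" by linarith
  thus thesis
  proof
    assume d: "d 1 = 1"
    have "f n = f 1 + (n - 1)" for n using eq[of n] unfolding d by simp
    thus thesis by (rule that(1))
  next
    assume d: "d 1 = - 1"
    have "f n = f 1 - (n - 1)" for n using eq[of n] unfolding d by simp
    thus thesis by (rule that(2))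
  qed
qed

text \<open>An isomorphism sends neighbours to neighbours and fixes the root, hence is the identity
  or the reflection about 1. The labels on a gap then determine its letter.\<close>

lemma Gr_eqD:
  assumes w: "\<omega> \<in> Omega_tau" "\<omega>' \<in> Omega_tau" and eq: "Gr \<omega> = Gr \<omega>'"
  shows "\<omega> = \<omega>' \<or> \<omega> = mirror \<omega>'"
proof -
  let ?A = "lstep (full \<omega>)" and ?B = "lstep (full \<omega>')"
  have "stab ?A 1 = stab ?B 1" using w eq by (simp add: Gr_eq_cls cls_eq_iff)
  hence "graph_iso (action_graph ?A 1) (action_graph ?B 1)" using w by (intro graph_iso_action_graph) auto
  then obtain f where f: "bij_betw f UNIV (UNIV :: int set)" "f 1 = 1"
    "\<And>s u v. gmult (action_graph ?A 1) s u v = gmult (action_graph ?B 1) s (f u) (f v)"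
    unfolding graph_iso_def by (auto simp: orb_lstep_Omega w)
  have inj: "inj f" using f(1) by (simp add: bij_betw_def)
  have conj: "?B s (f u) = f (?A s u)" for s u
    using f(3)[of s u "?A s u"] unfolding action_graph_simps of_bool_eq_iff by (simp add: orb_lstep_Omega w)
  have "\<bar>f (n + 1) - f n\<bar> = 1" for n
  proof -
    obtain s where "\<omega> n \<in> edge_letters s" using edge_letters_exist by blast
    hence "?A s n = n + 1" by (simp add: lstep_eq_up)
    hence "f (n + 1) = ?B s (f n)" by (simp add: conj)
    moreover have "f (n + 1) \<noteq> f n" by (simp add: inj_eq[OF inj])
    ultimately show ?thesis by (auto simp: lstep_def split: if_splits)
  qed
  from inj this show ?thesis
  proof (cases rule: path_in_integers)
    case 1
    have "f n = n" for n using 1[of n] f(2) by simp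
    hence "?B s n = ?A s n" for s n using conj[of s n] by simp
    hence "\<omega> n = \<omega>' n" for n by (intro edge_letters_eq) (simp add: lstep_eq_up)
    thus ?thesis by auto
  next
    case 2
    have "\<omega> n \<in> edge_letters s \<longleftrightarrow> mirror \<omega>' n \<in> edge_letters s" for n s
    proof -
      have "f u = 2 - u" for u using 2[of u] f(2) by simp
      hence "?B s (2 - n) = 2 - ?A s n" using conj[of s n] by simp
      thus ?thesis using lstep_eq_down[OF w(2), of "2 - n" s] lstep_eq_up[of \<omega> n s] by (auto simp: mirror_def)
    qed
    hence "\<omega> n = mirror \<omega>' n" for n by (intro edge_letters_eq) auto
    thus ?thesis by auto
  qed
qed

lemma card_Gr_fibre:
  assumes "p \<in> X_space"
  shows "card {\<omega> \<in> Omega_tau. Gr \<omega> = p} = 2"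
proof -
  obtain \<omega> where w: "\<omega> \<in> Omega_tau" "p = Gr \<omega>" using assms unfolding X_space_eq by blast
  have "{\<omega>' \<in> Omega_tau. Gr \<omega>' = p} = {\<omega>, mirror \<omega>}"
    using w Gr_eqD[of _ \<omega>] Gr_mirror[of \<omega>] mirror_Omega[of \<omega>] by auto
  moreover have "\<omega> \<noteq> mirror \<omega>"
  proof
    assume "\<omega> = mirror \<omega>"
    \<comment> \<open>\<open>mirror\<close> exchanges the letters at 0 and 1, exactly one of which
      is \<open>La\<close>.\<close>
    hence "\<omega> 0 = \<omega> 1" by (metis mirror_def diff_zero)
    thus False using Omega_alternating[OF w(1), of 0] by auto
  qed
  ultimately show ?thesis by simp
qed

section \<open>The dynamical system on the space of graphs\<close>

lemma topspace_X [simp]: "topspace X_top = X_space"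
proof -
  have "X_space \<subseteq> G_star" unfolding X_space_eq using Gr_G_star by blast
  thus ?thesis by (auto simp: X_top_def)
qed

lemma continuous_map_Gr: "continuous_map Omega_top X_top Gr"
  unfolding X_top_def continuous_map_in_subtopology
proof
  show "continuous_map Omega_top G_star_top Gr"
  proof (rule continuous_map_OmegaI)
    fix \<omega> U assume w: "\<omega> \<in> Omega_tau" "openin G_star_top U" "Gr \<omega> \<in> U"
    then obtain r where r: "\<forall>q\<in>G_star. same_ball r (Gr \<omega>) q \<longrightarrow> q \<in> U"
      unfolding openin_G_star_iff by blast
    have "Gr \<omega>' \<in> U" if w': "\<omega>' \<in> Omega_tau" "agree (2 * r + 2) \<omega> \<omega>'" for \<omega>'
    proof -
      have "agree (2 * r + 2) (full \<omega>) (full \<omega>')" using w'(2) by (simp add: agree_def)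
      hence "same_ball r (Gr \<omega>) (Gr \<omega>')"
        unfolding Gr_eq_cls[OF w(1)] Gr_eq_cls[OF w'(1)]
        by (rule same_ball_lstep_agree[OF alternating_Omega[OF w(1)] alternating_Omega[OF w'(1)]]) simp
      thus ?thesis using r Gr_G_star[OF w'(1)] by blast
    qed
    thus "\<exists>N. \<forall>\<omega>'\<in>Omega_tau. agree N \<omega> \<omega>' \<longrightarrow> Gr \<omega>' \<in> U" by blast
  qed (simp add: Gr_G_star)
  show "Gr \<in> topspace Omega_top \<rightarrow> X_space" by (auto simp: X_space_eq)
qed

lemma compact_X: "compact_space X_top"
proof -
  have "compactin X_top (Gr ` topspace Omega_top)"
    using compact_Omega continuous_map_Gr unfolding compact_space_def by (rule image_compactin)
  thus ?thesis by (simp add: compact_space_def X_space_eq)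
qed

text \<open>Distinct classes are told apart by a word \<open>v\<close>, and balls of radius
  \<open>length v\<close> decide whether \<open>v\<close> fixes the root.\<close>

lemma Hausdorff_X: "Hausdorff_space X_top"
  unfolding Hausdorff_space_def
proof (intro allI impI)
  fix p q assume pq: "p \<in> topspace X_top \<and> q \<in> topspace X_top \<and> p \<noteq> q"
  then obtain \<omega> \<omega>' where w: "\<omega> \<in> Omega_tau" "p = Gr \<omega>" "\<omega>' \<in> Omega_tau" "q = Gr \<omega>'"
    by (auto simp: X_space_eq)
  hence "stab (lstep (full \<omega>)) 1 \<noteq> stab (lstep (full \<omega>')) 1"
    using pq by (auto simp: Gr_eq_cls cls_eq_iff)
  then obtain v where v: "v \<in> stab (lstep (full \<omega>)) 1 \<longleftrightarrow> v \<notin> stab (lstep (full \<omega>')) 1" by blast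
  define U where "U p = {t \<in> G_star. same_ball (length v) p t} \<inter> X_space" for p
  have op: "openin X_top (U (Gr \<omega>)) \<and> Gr \<omega> \<in> U (Gr \<omega>)" if "\<omega> \<in> Omega_tau" for \<omega>
    using that openin_same_ball[OF Gr_G_star[OF that]] Gr_G_star[OF that] same_ball_refl[OF Gr_G_star[OF that]]
    unfolding X_top_def openin_subtopology U_def by (auto simp: X_space_eq)
  have stab: "v \<in> stab (lstep (full \<omega>)) 1 \<longleftrightarrow> v \<in> stab (lstep (full \<zeta>)) 1"
    if "\<omega> \<in> Omega_tau" "\<zeta> \<in> Omega_tau" "Gr \<zeta> \<in> U (Gr \<omega>)" for \<omega> \<zeta>
    using that same_ball_clsD[of "lstep (full \<omega>)" "lstep (full \<zeta>)" "length v" 1 1 v]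
    by (simp add: U_def Gr_eq_cls)
  have "disjnt (U p) (U q)"
    unfolding disjnt_iff
  proof (intro allI notI)
    fix t assume t: "t \<in> U p \<and> t \<in> U q"
    then obtain \<zeta> where "\<zeta> \<in> Omega_tau" "t = Gr \<zeta>" by (auto simp: U_def X_space_eq)
    thus False using stab[OF w(1), of \<zeta>] stab[OF w(3), of \<zeta>] t v w by auto
  qed
  thus "\<exists>U V. openin X_top U \<and> openin X_top V \<and> p \<in> U \<and> q \<in> V \<and> disjnt U V"
    using op[OF w(1)] op[OF w(3)] w(2,4) by blast
qed

text \<open>Moving the root along \<open>w\<close> conjugates its stabiliser by \<open>w\<close>; so
  the new stabiliser depends on the old one only, and the action descends to classes.\<close>

lemma Gr_foldr_cong:
  assumes "\<omega> \<in> Omega_tau" "\<omega>' \<in> Omega_tau" "Gr \<omega> = Gr \<omega>'"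
  shows "Gr (foldr H_gen w \<omega>) = Gr (foldr H_gen w \<omega>')"
proof -
  have "stab (lstep (full \<omega>)) 1 = stab (lstep (full \<omega>')) 1"
    using assms by (simp add: Gr_eq_cls cls_eq_iff)
  hence "stab (lstep (full (foldr H_gen w \<omega>))) 1 = stab (lstep (full (foldr H_gen w \<omega>'))) 1"
    using assms by (auto simp: stab_foldr_H_gen stab_foldr_iff)
  thus ?thesis using assms by (simp add: Gr_eq_cls cls_eq_iff foldr_H_gen_Omega)
qed

text \<open>The action is pushed forward from a chosen preimage; for elements of G the choice is
  immaterial by \<open>Gr_foldr_cong\<close>.\<close>

definition beta :: "(bool list \<Rightarrow> bool list) \<Rightarrow> gclass \<Rightarrow> gclass" where
  "beta g = (\<lambda>p\<in>X_space. Gr (rho g (SOME \<omega>. \<omega> \<in> Omega_tau \<and> Gr \<omega> = p)))"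

lemma beta_Gr:
  assumes "\<omega> \<in> Omega_tau"
  shows "beta (foldr G_gen w) (Gr \<omega>) = Gr (foldr H_gen w \<omega>)"
proof -
  let ?\<omega> = "SOME \<omega>'. \<omega>' \<in> Omega_tau \<and> Gr \<omega>' = Gr \<omega>"
  have *: "?\<omega> \<in> Omega_tau \<and> Gr ?\<omega> = Gr \<omega>" by (rule someI[of _ \<omega>]) (simp add: assms)
  have "beta (foldr G_gen w) (Gr \<omega>) = Gr (foldr H_gen w ?\<omega>)"
    using assms * by (simp add: beta_def X_space_eq rho_foldr)
  also have "\<dots> = Gr (foldr H_gen w \<omega>)" using * assms by (intro Gr_foldr_cong) auto
  finally show ?thesis .
qed

lemma beta_extensional: "beta g \<in> extensional X_space"
  by (simp add: beta_def)

lemma beta_append: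
  assumes "p \<in> X_space"
  shows "beta (foldr G_gen (w @ w')) p = beta (foldr G_gen w) (beta (foldr G_gen w') p)"
    and "beta (foldr G_gen w) p \<in> X_space"
    and "beta (foldr G_gen (rev w)) (beta (foldr G_gen w) p) = p"
    and "beta (foldr G_gen w) (beta (foldr G_gen (rev w)) p) = p"
proof -
  obtain \<omega> where w: "\<omega> \<in> Omega_tau" "p = Gr \<omega>" using assms unfolding X_space_eq by blast
  show "beta (foldr G_gen (w @ w')) p = beta (foldr G_gen w) (beta (foldr G_gen w') p)"
    using w by (simp add: beta_Gr foldr_H_gen_Omega del: foldr_append) simp
  show "beta (foldr G_gen w) p \<in> X_space"
    using w by (simp add: beta_Gr foldr_H_gen_Omega X_space_eq)
  show "beta (foldr G_gen (rev w)) (beta (foldr G_gen w) p) = p"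
    "beta (foldr G_gen w) (beta (foldr G_gen (rev w)) p) = p"
    using w foldr_H_gen_append_Omega[OF w(1), of w] foldr_H_gen_append_Omega[OF w(1), of "rev w"]
    by (simp_all add: beta_Gr foldr_H_gen_Omega)
qed

lemma beta_Bij: "beta (foldr G_gen w) \<in> Bij X_space"
  unfolding Bij_def
  by (auto intro!: bij_betwI[where g = "beta (foldr G_gen (rev w))"] simp: beta_append beta_extensional)

lemma beta_hom: "beta \<in> hom G_group (BijGroup X_space)"
proof (rule homI)
  fix g assume "g \<in> carrier G_group"
  then obtain w where "g = foldr G_gen w" unfolding carrier_G_group by blast
  thus "beta g \<in> carrier (BijGroup X_space)" by (simp only: carrier_BijGroup beta_Bij)
next
  fix g g' assume "g \<in> carrier G_group" "g' \<in> carrier G_group"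
  then obtain w w' where w: "g = foldr G_gen w" "g' = foldr G_gen w'" unfolding carrier_G_group by blast
  have "beta (foldr G_gen (w @ w')) = compose X_space (beta (foldr G_gen w)) (beta (foldr G_gen w'))"
    by (rule extensionalityI[of _ X_space])
      (simp_all add: beta_extensional compose_eq beta_append(1) del: foldr_append)
  thus "beta (g \<otimes>\<^bsub>G_group\<^esub> g') = beta g \<otimes>\<^bsub>BijGroup X_space\<^esub> beta g'"
    by (simp only: w mult_G_group mult_BijGroup beta_Bij)
qed

text \<open>A continuous map from a compact space onto a Hausdorff space is a quotient map, so
  continuity of \<open>beta\<close> can be checked on the subshift.\<close>

lemma quotient_map_Gr: "quotient_map Omega_top X_top Gr"
  by (intro continuous_closed_imp_quotient_map continuous_map_Gr
      continuous_imp_closed_map compact_Omega Hausdorff_X) (simp add: X_space_eq)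

lemma continuous_beta: "continuous_map X_top X_top (beta (foldr G_gen w))"
proof (rule continuous_compose_quotient_map[OF quotient_map_Gr])
  have "continuous_map Omega_top X_top (Gr \<circ> restrict (foldr H_gen w) Omega_tau)"
    by (rule continuous_map_compose[OF homeomorphic_imp_continuous_map[OF homeomorphic_foldr_H_gen] continuous_map_Gr])
  thus "continuous_map Omega_top X_top (beta (foldr G_gen w) \<circ> Gr)"
    by (rule continuous_map_eq) (simp add: beta_Gr)
qed

lemma homeomorphic_beta: "homeomorphic_map X_top X_top (beta (foldr G_gen w))"
proof -
  have "homeomorphic_maps X_top X_top (beta (foldr G_gen w)) (beta (foldr G_gen (rev w)))"
    by (simp add: homeomorphic_maps_def continuous_beta beta_append)
  thus ?thesis using homeomorphic_map_maps by blast
qed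

lemma dyn_system_X: "dyn_system G_group X_top beta"
  unfolding dyn_system_def
proof (intro conjI ballI)
  show "group_action G_group (topspace X_top) beta"
    unfolding group_action_def group_hom_def group_hom_axioms_def
    by (simp only: topspace_X group_G_group group_BijGroup beta_hom simp_thms)
  fix g assume "g \<in> carrier G_group"
  then obtain w where "g = foldr G_gen w" unfolding carrier_G_group by blast
  thus "homeomorphic_map X_top X_top (beta g)" by (simp only: homeomorphic_beta)
qed (rule compact_X, rule Hausdorff_X)

lemma root_change_beta: "root_change_action beta"
  unfolding root_change_action_def
proof (intro conjI allI ballI)
  fix s p assume "p \<in> X_space"
  then obtain \<omega> where w: "\<omega> \<in> Omega_tau" "p = Gr \<omega>" unfolding X_space_eq by blast
  have "G_gen s = foldr G_gen [s]" by (simp add: fun_eq_iff)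
  hence "beta (G_gen s) p = Gr (H_gen s \<omega>)" using beta_Gr[OF w(1), of "[s]"] w(2) by simp
  also have "\<dots> = cls (lstep (full (H_gen s \<omega>))) 1" by (rule Gr_eq_cls[OF H_gen_Omega[OF w(1)]])
  also have "\<dots> = cls (lstep (full \<omega>)) (lstep (full \<omega>) s 1)"
    using stab_foldr_H_gen[OF w(1), of "[s]"]
    by (intro cls_eqI involutive_Omega H_gen_Omega w(1)) simp
  also have "\<dots> = reroot s p" using w by (simp add: Gr_eq_cls reroot_cls)
  finally show "beta (G_gen s) p = reroot s p" .
qed (rule dyn_system_X)

lemma factor_map_Gr: "factor_map G_group Omega_top rho X_top beta Gr"
  unfolding factor_map_def
proof (intro conjI ballI)
  fix g \<omega> assume "g \<in> carrier G_group" and w: "\<omega> \<in> topspace Omega_top"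
  then obtain w where "g = foldr G_gen w" unfolding carrier_G_group by blast
  thus "Gr (rho g \<omega>) = beta g (Gr \<omega>)" using w by (simp add: rho_foldr beta_Gr)
qed (simp_all add: continuous_map_Gr X_space_eq)

section \<open>Powers of the shift and orbits\<close>

definition translate :: "int \<Rightarrow> (int \<Rightarrow> letter) \<Rightarrow> int \<Rightarrow> letter" where
  "translate c = (\<lambda>\<omega>\<in>Omega_tau. \<lambda>n. \<omega> (n + c))"

lemma translate_apply: "\<omega> \<in> Omega_tau \<Longrightarrow> translate c \<omega> = (\<lambda>n. \<omega> (n + c))"
  by (simp add: translate_def)

lemma translate_Omega: "\<omega> \<in> Omega_tau \<Longrightarrow> translate c \<omega> \<in> Omega_tau"
  by (simp add: translate_apply Omega_translate)

lemma translate_translate: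
  "\<omega> \<in> Omega_tau \<Longrightarrow> translate c (translate c' \<omega>) = translate (c + c') \<omega>"
  by (simp add: translate_apply Omega_translate add.assoc)

lemma translate_0: "\<omega> \<in> Omega_tau \<Longrightarrow> translate 0 \<omega> = \<omega>"
  by (simp add: translate_apply)

lemma translate_homeo_group: "translate c \<in> carrier (homeo_group Omega_top)"
proof -
  have cont: "continuous_map Omega_top Omega_top (translate c)" for c
  proof (rule continuous_map_Omega_OmegaI[where k = "nat \<bar>c\<bar>"])
    fix N \<omega> \<omega>' assume "\<omega> \<in> Omega_tau" "\<omega>' \<in> Omega_tau" "agree (N + nat \<bar>c\<bar>) \<omega> \<omega>'"
    thus "agree N (translate c \<omega>) (translate c \<omega>')" by (simp add: translate_apply agree_def)
  qed (rule translate_Omega)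
  have "homeomorphic_maps Omega_top Omega_top (translate c) (translate (- c))"
    using cont by (simp add: homeomorphic_maps_def translate_translate translate_0)
  hence "homeomorphic_map Omega_top Omega_top (translate c)" using homeomorphic_map_maps by blast
  moreover have "bij_betw (translate c) Omega_tau Omega_tau"
    by (rule bij_betwI[where g = "translate (- c)"]) (auto simp: translate_Omega translate_translate translate_0)
  moreover have "translate c \<in> extensional Omega_tau" by (simp add: translate_def)
  ultimately show ?thesis by (simp add: mem_homeo_group Bij_def)
qed

lemma translate_mult: "translate c \<otimes>\<^bsub>homeo_group Omega_top\<^esub> translate c' = translate (c + c')"
proof -
  have "translate c \<in> Bij Omega_tau" for c using translate_homeo_group[of c] by (simp add: mem_homeo_group)
  hence "translate c \<otimes>\<^bsub>homeo_group Omega_top\<^esub> translate c' = compose Omega_tau (translate c) (translate c')"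
    unfolding homeo_group_simps topspace_Omega by (intro mult_BijGroup)
  also have "\<dots> = translate (c + c')"
    by (rule extensionalityI[of _ Omega_tau])
      (simp_all add: compose_eq translate_translate, simp add: translate_def)
  finally show ?thesis .
qed

lemma translate_pow: "translate 1 [^]\<^bsub>homeo_group Omega_top\<^esub> (n :: int) = translate n"
proof -
  interpret group "homeo_group Omega_top" by (rule group_homeo_group)
  have one: "\<one>\<^bsub>homeo_group Omega_top\<^esub> = translate 0"
    by (simp add: homeo_group_simps one_BijGroup translate_def restrict_def)
  have nat: "translate 1 [^]\<^bsub>homeo_group Omega_top\<^esub> k = translate (int k)" for k :: nat
    by (induction k) (simp_all add: one translate_mult add.commute)
  show ?thesis
  proof (cases "n \<ge> 0")
    case True
    then obtain k where "n = int k" using nonneg_int_cases by blast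
    thus ?thesis using nat by (simp add: int_pow_int)
  next
    case False
    then obtain k where k: "n = - int k" by (metis nle_le nonpos_int_cases)
    have "inv\<^bsub>homeo_group Omega_top\<^esub> translate (int k) = translate (- int k)"
      by (intro inv_equality translate_homeo_group) (simp add: translate_mult one)
    thus ?thesis using nat[of k] translate_homeo_group[of 1] by (simp add: k int_pow_neg int_pow_int)
  qed
qed

lemma shift_Omega_eq: "shift_Omega = translate 1"
  by (simp add: shift_Omega_def translate_def shift_def restrict_def fun_eq_iff)

text \<open>The words walk along the line of \<open>\<omega>\<close> and reach every vertex, so
  every displacement, hence every translate, occurs.\<close>

lemma orbits_coincide:
  assumes "\<omega> \<in> Omega_tau"
  shows "{(shift_Omega [^]\<^bsub>homeo_group Omega_top\<^esub> n) \<omega> |n :: int. True} = orbit G_group rho \<omega>"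
proof -
  have "orbit G_group rho \<omega> = range (\<lambda>w. foldr H_gen w \<omega>)"
    unfolding orbit_def carrier_G_group Setcompr_eq_image Collect_mem_eq image_image
    using assms by (simp add: rho_foldr)
  also have "\<dots> = range (\<lambda>w. translate (foldr (lstep (full \<omega>)) w 1 - 1) \<omega>)"
    using assms by (simp add: foldr_H_gen translate_def)
  also have "\<dots> = (\<lambda>n. translate (n - 1) \<omega>) ` orb (lstep (full \<omega>)) 1"
    unfolding orb_def image_image ..
  also have "\<dots> = range (\<lambda>n. translate (n - 1) \<omega>)" by (simp add: orb_lstep_Omega assms)
  also have "\<dots> = range (\<lambda>n. translate n \<omega>)"
    by (auto intro: range_eqI[of _ _ "_ + 1 :: int"])
  finally show ?thesis unfolding shift_Omega_eq translate_pow by auto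
qed


section \<open>Phases and invariant measures\<close>

abbreviation Omega_borel :: "(int \<Rightarrow> letter) measure" where
  "Omega_borel \<equiv> sigma Omega_tau {U. openin Omega_top U}"

lemma opens_subset_Pow: "{U. openin Omega_top U} \<subseteq> Pow Omega_tau"
proof
  fix U assume "U \<in> {U. openin Omega_top U}"
  thus "U \<in> Pow Omega_tau" using openin_subset[of Omega_top U] by simp
qed

lemma sets_Omega_borel: "sets Omega_borel = sigma_sets Omega_tau {U. openin Omega_top U}"
  and space_Omega_borel [simp]: "space Omega_borel = Omega_tau"
  using opens_subset_Pow by (simp_all add: space_measure_of)

lemma open_Omega_borel: "openin Omega_top U \<Longrightarrow> U \<in> sets Omega_borel"
  unfolding sets_Omega_borel by (intro sigma_sets.Basic) simp

lemma invariant_prob_iff: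
  "invariant_prob Omega_top F \<mu> \<longleftrightarrow> sets \<mu> = sets Omega_borel \<and> prob_space \<mu> \<and>
     (\<forall>f\<in>F. \<forall>S\<in>sets Omega_borel. emeasure \<mu> (f -` S \<inter> Omega_tau) = emeasure \<mu> S)"
proof -
  have "space \<mu> = Omega_tau" if "sets \<mu> = sets Omega_borel"
    using sets_eq_imp_space_eq[OF that] by simp
  thus ?thesis unfolding invariant_prob_def topspace_Omega sets_Omega_borel[symmetric] by auto
qed

lemma measurable_Omega_continuous:
  assumes "continuous_map Omega_top Omega_top f"
  shows "f \<in> measurable Omega_borel Omega_borel"
proof (rule measurable_measure_of[OF opens_subset_Pow])
  show "f \<in> space Omega_borel \<rightarrow> Omega_tau"
    using assms by (auto simp: continuous_map_def)
  fix U assume "U \<in> {U. openin Omega_top U}"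
  hence "openin Omega_top {x \<in> topspace Omega_top. f x \<in> U}"
    using assms by (intro openin_continuous_map_preimage) auto
  moreover have "{x \<in> topspace Omega_top. f x \<in> U} = f -` U \<inter> space Omega_borel" by auto
  ultimately show "f -` U \<inter> space Omega_borel \<in> sets Omega_borel" by (metis open_Omega_borel)
qed

section \<open>Cylinders as a generator of the Borel sets\<close>

definition cylinder :: "int set \<Rightarrow> (int \<Rightarrow> letter) \<Rightarrow> (int \<Rightarrow> letter) set" where
  "cylinder J \<eta> = {\<omega> \<in> Omega_tau. \<forall>i\<in>J. \<omega> i = \<eta> i}"

definition cylinders :: "(int \<Rightarrow> letter) set set" where
  "cylinders = insert {} {cylinder J \<eta> |J \<eta>. finite J}"

text \<open>A nonempty intersection of two cylinders is the cylinder around any of its points; the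
  empty set was added for the remaining case.\<close>

lemma Int_stable_cylinders: "Int_stable cylinders"
proof (rule Int_stableI)
  fix A B assume AB: "A \<in> cylinders" "B \<in> cylinders"
  show "A \<inter> B \<in> cylinders"
  proof (cases "A \<inter> B = {}")
    case False
    then obtain \<omega> where w: "\<omega> \<in> A" "\<omega> \<in> B" by blast
    then obtain J \<eta> J' \<eta>' where J: "finite J" "finite J'" "A = cylinder J \<eta>" "B = cylinder J' \<eta>'"
      using AB by (auto simp: cylinders_def)
    have "A \<inter> B = cylinder (J \<union> J') \<omega>" using w unfolding J(3,4) by (auto simp: cylinder_def)
    thus ?thesis using J(1,2) by (auto simp: cylinders_def)
  qed (simp add: cylinders_def)
qed

lemma agree_cylinder: "cylinder {- int N..int N} \<eta> = {\<omega> \<in> Omega_tau. agree N \<eta> \<omega>}"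
  by (auto simp: cylinder_def agree_def abs_le_iff)

lemma finite_int_bound:
  assumes "finite (J :: int set)"
  obtains N where "\<And>i. i \<in> J \<Longrightarrow> \<bar>i\<bar> \<le> int N"
proof -
  have "finite ((\<lambda>i. nat \<bar>i\<bar>) ` J)" using assms by simp
  then obtain N where N: "\<forall>n\<in>(\<lambda>i. nat \<bar>i\<bar>) ` J. n \<le> N" using finite_nat_set_iff_bounded_le by blast
  have "\<bar>i\<bar> \<le> int N" if "i \<in> J" for i using N that by (simp add: nat_le_iff)
  thus thesis by (rule that)
qed

lemma openin_cylinder: "finite J \<Longrightarrow> openin Omega_top (cylinder J \<eta>)"
proof -
  assume "finite J"
  then obtain N where N: "\<And>i. i \<in> J \<Longrightarrow> \<bar>i\<bar> \<le> int N" using finite_int_bound by blast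
  have "\<omega>' \<in> cylinder J \<eta>" if "\<omega> \<in> cylinder J \<eta>" "\<omega>' \<in> Omega_tau" "agree N \<omega> \<omega>'" for \<omega> \<omega>'
    unfolding cylinder_def
  proof (intro CollectI conjI ballI that(2))
    fix i assume "i \<in> J"
    moreover from this have "\<bar>i\<bar> \<le> int N" by (rule N)
    ultimately show "\<omega>' i = \<eta> i" using that(1) agreeD[OF that(3), of i] by (simp add: cylinder_def)
  qed
  hence "\<forall>\<omega>\<in>cylinder J \<eta>. \<exists>N. \<forall>\<omega>'\<in>Omega_tau. agree N \<omega> \<omega>' \<longrightarrow> \<omega>' \<in> cylinder J \<eta>" by blast
  moreover have "cylinder J \<eta> \<subseteq> Omega_tau" by (auto simp: cylinder_def)
  ultimately show ?thesis unfolding openin_Omega_iff by blast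
qed

text \<open>There are only countably many window cylinders, and an open set is the union of those it
  contains.\<close>

lemma sets_Omega_borel_cylinders: "sets Omega_borel = sigma_sets Omega_tau cylinders"
  unfolding sets_Omega_borel
proof (rule sigma_sets_eqI)
  fix C assume "C \<in> cylinders"
  thus "C \<in> sigma_sets Omega_tau {U. openin Omega_top U}"
    by (auto simp: cylinders_def intro!: sigma_sets.Basic sigma_sets.Empty openin_cylinder)
next
  fix U assume "U \<in> {U. openin Omega_top U}"
  hence U: "openin Omega_top U" by simp
  \<comment> \<open>Prescribing \<open>La\<close> outside the window selects one function per
    pattern, which keeps the family finite for each \<open>N\<close>.\<close>
  define \<C> where "\<C> = (\<Union>N. cylinder {- int N..int N} `
      {f. \<forall>x. (x \<in> {- int N..int N} \<longrightarrow> f x \<in> (UNIV :: letter set)) \<and> (x \<notin> {- int N..int N} \<longrightarrow> f x = La)})"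
  have "countable \<C>"
    unfolding \<C>_def
  proof (rule countable_UN)
    fix N :: nat
    have "finite {f. \<forall>x. (x \<in> {- int N..int N} \<longrightarrow> f x \<in> (UNIV :: letter set)) \<and> (x \<notin> {- int N..int N} \<longrightarrow> f x = La)}"
      by (rule finite_set_of_finite_funs) simp_all
    thus "countable (cylinder {- int N..int N} `
      {f. \<forall>x. (x \<in> {- int N..int N} \<longrightarrow> f x \<in> (UNIV :: letter set)) \<and> (x \<notin> {- int N..int N} \<longrightarrow> f x = La)})"
      by (rule countable_finite[OF finite_imageI])
  qed simp
  have "\<C> \<subseteq> cylinders" by (auto simp: \<C>_def cylinders_def)
  have "U = \<Union> {C \<in> \<C>. C \<subseteq> U}"
  proof
    show "U \<subseteq> \<Union> {C \<in> \<C>. C \<subseteq> U}"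
    proof
      fix \<omega> assume w: "\<omega> \<in> U"
      then obtain N where N: "\<forall>\<omega>'\<in>Omega_tau. agree N \<omega> \<omega>' \<longrightarrow> \<omega>' \<in> U"
        using U unfolding openin_Omega_iff by blast
      let ?f = "\<lambda>i. if i \<in> {- int N..int N} then \<omega> i else La"
      have ag: "agree N ?f \<omega>" "agree N \<omega> ?f" by (auto simp: agree_def)
      have "\<omega> \<in> Omega_tau" using w U openin_subset by fastforce
      hence "\<omega> \<in> cylinder {- int N..int N} ?f" unfolding agree_cylinder using ag by simp
      moreover have "cylinder {- int N..int N} ?f \<subseteq> U"
        unfolding agree_cylinder using N agree_trans[OF ag(2)] by blast
      moreover have "cylinder {- int N..int N} ?f \<in> \<C>" unfolding \<C>_def by (intro UN_I imageI) auto
      ultimately show "\<omega> \<in> \<Union> {C \<in> \<C>. C \<subseteq> U}" by blast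
    qed
  qed blast
  moreover have "\<Union> {C \<in> \<C>. C \<subseteq> U} \<in> sigma_sets Omega_tau cylinders"
  proof (rule sigma_sets_UNION)
    show "countable {C \<in> \<C>. C \<subseteq> U}" using \<open>countable \<C>\<close> by (rule countable_subset[rotated]) blast
    show "\<And>C. C \<in> {C \<in> \<C>. C \<subseteq> U} \<Longrightarrow> C \<in> sigma_sets Omega_tau cylinders"
      using \<open>\<C> \<subseteq> cylinders\<close> by (blast intro: sigma_sets.Basic)
  qed
  ultimately show "U \<in> sigma_sets Omega_tau cylinders" by simp
qed

text \<open>In terms of the 2-adic odometer, of which the subshift is an extension, the phases are the
  cosets of \<open>2\<^sup>k\<close>.\<close>

definition phase :: "nat \<Rightarrow> int \<Rightarrow> (int \<Rightarrow> letter) set" where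
  "phase k r = {\<omega> \<in> Omega_tau. \<forall>n. \<not> 2 ^ k dvd (n + r) \<longrightarrow> \<omega> n = ruler (n + r)}"

lemma phase_subset: "phase k r \<subseteq> Omega_tau"
  by (auto simp: phase_def)

lemma phase_borel: "phase k r \<in> sets Omega_borel"
proof -
  have "openin Omega_top (Omega_tau - phase k r)"
    unfolding openin_Omega_iff
  proof (intro conjI ballI)
    fix \<omega> assume "\<omega> \<in> Omega_tau - phase k r"
    then obtain n where n: "\<not> 2 ^ k dvd (n + r)" "\<omega> n \<noteq> ruler (n + r)" by (auto simp: phase_def)
    have "\<omega>' \<notin> phase k r" if "agree (nat \<bar>n\<bar>) \<omega> \<omega>'" for \<omega>'
      using n agreeD[OF that, of n] by (auto simp: phase_def)
    thus "\<exists>N. \<forall>\<omega>'\<in>Omega_tau. agree N \<omega> \<omega>' \<longrightarrow> \<omega>' \<in> Omega_tau - phase k r" by blast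
  qed blast
  hence "space Omega_borel - (Omega_tau - phase k r) \<in> sets Omega_borel"
    by (intro sets.compl_sets open_Omega_borel)
  moreover have "space Omega_borel - (Omega_tau - phase k r) = phase k r" by (auto simp: phase_def)
  ultimately show ?thesis by simp
qed

text \<open>If every residue failed, each would do so at some position, and one window would contain
  these finitely many positions. The local copy in that window is centred at some \<open>q\<close>,
  whose residue does not fail there.\<close>

lemma phase_exists:
  assumes "\<omega> \<in> Omega_tau"
  shows "\<exists>r\<in>{0..<2 ^ k}. \<omega> \<in> phase k r"
proof (rule ccontr)
  assume "\<not> ?thesis"
  hence "\<forall>r\<in>{0..<2 ^ k}. \<exists>n. \<not> 2 ^ k dvd (n + r) \<and> \<omega> n \<noteq> ruler (n + r)"
    using assms by (auto simp: phase_def)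
  then obtain n where n: "\<And>r. r \<in> {0..<2 ^ k} \<Longrightarrow> \<not> 2 ^ k dvd (n r + r) \<and> \<omega> (n r) \<noteq> ruler (n r + r)"
    by metis
  have "finite (n ` {0..<2 ^ k})" by simp
  then obtain N where N: "\<And>i. i \<in> n ` {0..<2 ^ k} \<Longrightarrow> \<bar>i\<bar> \<le> int N" using finite_int_bound by blast
  obtain q where q: "agree N \<omega> (\<lambda>i. ruler (q + i))" using assms by (rule Omega_tauE)
  define r where "r = q mod 2 ^ k"
  have r: "r \<in> {0..<2 ^ k}" by (simp add: r_def)
  have "\<bar>n r\<bar> \<le> int N" using r by (intro N imageI)
  hence "\<omega> (n r) = ruler (q + n r)" by (rule agreeD[OF q])
  also have "\<dots> = ruler (n r + r)"
  proof (rule ruler_cong[symmetric])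
    show "\<not> 2 ^ k dvd n r + r" using n[OF r] by blast
    have "2 ^ k dvd r - q" unfolding r_def by (simp add: mod_eq_dvd_iff[symmetric])
    thus "2 ^ k dvd n r + r - (q + n r)" by (simp add: algebra_simps)
  qed
  finally show False using n[OF r] by blast
qed

text \<open>Compare \<open>r\<close> with the centre \<open>q\<close> of a local copy. If
  \<open>q - r\<close> had valuation \<open>v < k\<close>, a position of level \<open>v + 1\<close>
  in the copy would have level \<open>v\<close> according to the phase.\<close>

lemma phase_unique:
  assumes "\<omega> \<in> phase k r" "\<omega> \<in> phase k r'"
  shows "2 ^ k dvd (r - r')"
proof -
  have w: "\<omega> \<in> Omega_tau" using assms by (simp add: phase_def)
  define N :: nat where "N = 2 ^ (k + 2)"
  obtain q where q: "agree N \<omega> (\<lambda>i. ruler (q + i))" using w by (rule Omega_tauE)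
  have "2 ^ k dvd (q - r)" if r: "\<omega> \<in> phase k r" for r
  proof (rule ccontr)
    assume "\<not> 2 ^ k dvd (q - r)"
    then obtain v where v: "v < k" "2 ^ v dvd (q - r)" "\<not> 2 ^ Suc v dvd (q - r)" by (rule two_pow_decomp)
    \<comment> \<open>Makes \<open>q + i\<close> congruent to \<open>2^(v+1)\<close> modulo
      \<open>2^(v+2)\<close>; subtracting \<open>q - r\<close> leaves \<open>i + r\<close> with
      valuation exactly \<open>v\<close>.\<close>
    define i where "i = (2 ^ Suc v - q) mod 2 ^ (v + 2)"
    have "(2 :: int) ^ (v + 2) \<le> 2 ^ (k + 2)" using v(1) by (intro power_increasing) auto
    moreover have "0 \<le> i" "i < 2 ^ (v + 2)" by (simp_all add: i_def)
    ultimately have "\<bar>i\<bar> \<le> 2 ^ (k + 2)" by linarith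
    hence i: "\<bar>i\<bar> \<le> int N" by (simp add: N_def)
    have "2 ^ (v + 2) dvd (2 ^ Suc v - q) - i" unfolding i_def by simp
    then obtain t where "2 ^ Suc v - q - i = 2 ^ (v + 2) * t" by (rule dvdE)
    hence "q + i = 2 ^ Suc v - 2 ^ (v + 2) * t" by linarith
    hence qi: "q + i = 2 ^ Suc v * (1 - 2 * t)" by (simp add: algebra_simps)
    have "\<not> 2 ^ Suc (Suc v) dvd 2 ^ Suc v * (1 - 2 * t)"
      by (simp only: power_Suc2[of _ "Suc v"] dvd_mult_cancel_left) simp
    hence "ruler (q + i) = lev (Suc v)" using qi by (intro ruler_lev) auto
    hence 1: "\<omega> i = lev (Suc v)" using agreeD[OF q i] by simp
    have "2 ^ Suc v dvd q + i" using qi by simp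
    moreover from this have "2 ^ v dvd q + i" by (rule power_le_dvd) simp
    ultimately have d: "2 ^ v dvd i + r" "\<not> 2 ^ Suc v dvd i + r"
      using v(2,3) dvd_diff[of "2 ^ v" "q + i" "q - r"] dvd_diff[of "2 ^ Suc v" "q + i" "i + r"]
      by (auto simp: algebra_simps)
    hence "\<not> 2 ^ k dvd i + r" using v(1) power_le_dvd[of 2 k "i + r" "Suc v"] by auto
    hence "\<omega> i = lev v" using r d ruler_lev[of v "i + r"] by (simp add: phase_def)
    thus False using 1 lev_Suc_ne[of v] by simp
  qed
  from dvd_diff[OF this[OF assms(2)] this[OF assms(1)]] show ?thesis by simp
qed

lemma disjoint_phases: "disjoint_family_on (phase k) {0..<2 ^ k}"
  unfolding disjoint_family_on_def
proof (intro ballI impI)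
  fix r r' :: int assume r: "r \<in> {0..<2 ^ k}" "r' \<in> {0..<2 ^ k}" "r \<noteq> r'"
  hence "\<not> 2 ^ k dvd (r - r')" by (intro two_pow_not_dvd_small) auto
  thus "phase k r \<inter> phase k r' = {}" using phase_unique by blast
qed

lemma Union_phases: "(\<Union>r\<in>{0..<2 ^ k}. phase k r) = Omega_tau"
  using phase_exists by (auto simp: phase_def)

lemma vimage_translate_phase: "translate c -` phase k r \<inter> Omega_tau = phase k (r - c)"
proof -
  have "\<omega> \<in> phase k (r - c) \<longleftrightarrow> translate c \<omega> \<in> phase k r" if w: "\<omega> \<in> Omega_tau" for \<omega>
  proof
    assume *: "\<omega> \<in> phase k (r - c)"
    have "\<omega> (n + c) = ruler (n + r)" if "\<not> 2 ^ k dvd (n + r)" for n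
    proof -
      have "n + c + (r - c) = n + r" by simp
      thus ?thesis using * that unfolding phase_def by (auto dest!: spec[of _ "n + c"])
    qed
    thus "translate c \<omega> \<in> phase k r" using translate_Omega[OF w] by (simp add: phase_def translate_apply w)
  next
    assume *: "translate c \<omega> \<in> phase k r"
    have "\<omega> n = ruler (n + (r - c))" if "\<not> 2 ^ k dvd (n + (r - c))" for n
    proof -
      have eq: "n - c + r = n + (r - c)" by simp
      thus ?thesis using * that w unfolding phase_def by (auto dest!: spec[of _ "n - c"] simp: translate_apply eq)
    qed
    thus "\<omega> \<in> phase k (r - c)" using w by (simp add: phase_def)
  qed
  thus ?thesis using phase_subset by blast
qed

section \<open>Equidistributed measures\<close>

definition equidistributed :: "(int \<Rightarrow> letter) measure \<Rightarrow> bool" where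
  "equidistributed \<mu> \<longleftrightarrow> sets \<mu> = sets Omega_borel \<and> prob_space \<mu> \<and>
     (\<forall>k. \<forall>r\<in>{0..<2 ^ k}. measure \<mu> (phase k r) = 1 / 2 ^ k)"

lemma equidistributed_all:
  assumes "equidistributed \<mu>"
  shows "measure \<mu> (phase k r) = 1 / 2 ^ k"
proof -
  define r' where "r' = r mod 2 ^ k"
  have d: "2 ^ k dvd (r - r')" unfolding r'_def by simp
  have "\<not> 2 ^ k dvd (n + r) \<Longrightarrow> ruler (n + r) = ruler (n + r')"
       "2 ^ k dvd (n + r) \<longleftrightarrow> 2 ^ k dvd (n + r')" for n
  proof -
    show "\<not> 2 ^ k dvd (n + r) \<Longrightarrow> ruler (n + r) = ruler (n + r')"
      using d by (intro ruler_cong) simp_all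
    show "2 ^ k dvd (n + r) \<longleftrightarrow> 2 ^ k dvd (n + r')"
      using dvd_add[OF d, of "n + r'"] dvd_diff[OF _ d, of "n + r"] by (auto simp: algebra_simps)
  qed
  hence "phase k r = phase k r'" by (auto simp: phase_def)
  moreover have "r' \<in> {0..<2 ^ k}" by (simp add: r'_def)
  ultimately show ?thesis using assms by (simp add: equidistributed_def)
qed

text \<open>The phase decides whether a point lies in the cylinder, unless one of the \<open>card J\<close> positions
  falls into the undetermined residue class.\<close>

lemma measure_cylinder_diff:
  assumes "equidistributed \<mu>" "equidistributed \<nu>" "finite J"
  shows "\<bar>measure \<mu> (cylinder J \<eta>) - measure \<nu> (cylinder J \<eta>)\<bar> \<le> real (card J) / 2 ^ k"
proof -
  let ?D = "{0..<2 ^ k} :: int set" and ?C = "cylinder J \<eta>"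
  define B where "B = {r \<in> ?D. \<exists>i\<in>J. 2 ^ k dvd (i + r)}"
  have decomp: "measure \<mu> ?C = (\<Sum>r\<in>?D. measure \<mu> (?C \<inter> phase k r))" if "equidistributed \<mu>" for \<mu>
  proof -
    interpret prob_space \<mu> using that by (simp add: equidistributed_def)
    have sets: "sets \<mu> = sets Omega_borel" using that by (simp add: equidistributed_def)
    have "measure \<mu> (\<Union>r\<in>?D. ?C \<inter> phase k r) = (\<Sum>r\<in>?D. measure \<mu> (?C \<inter> phase k r))"
    proof (rule finite_measure_finite_Union)
      show "disjoint_family_on (\<lambda>r. ?C \<inter> phase k r) ?D"
        using disjoint_phases[of k] by (auto simp: disjoint_family_on_def)
      show "(\<lambda>r. ?C \<inter> phase k r) ` ?D \<subseteq> sets \<mu>"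
        unfolding sets using phase_borel open_Omega_borel[OF openin_cylinder[OF assms(3)]] by auto
    qed simp
    moreover have "(\<Union>r\<in>?D. ?C \<inter> phase k r) = ?C"
      using Union_phases[of k] by (auto simp: cylinder_def)
    ultimately show ?thesis by simp
  qed
  have good: "measure \<mu> (?C \<inter> phase k r) - measure \<nu> (?C \<inter> phase k r) = 0" if "r \<in> ?D - B" for r
  proof -
    have det: "\<omega> i = ruler (i + r)" if "\<omega> \<in> phase k r" "i \<in> J" for \<omega> i
      using that \<open>r \<in> ?D - B\<close> by (auto simp: phase_def B_def)
    \<comment> \<open>Every letter at a position of \<open>J\<close> is constant on this phase, so
      the cylinder contains the phase or misses it.\<close>
    have "?C \<inter> phase k r = phase k r \<or> ?C \<inter> phase k r = {}"
    proof (cases "\<forall>i\<in>J. \<eta> i = ruler (i + r)")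
      case True
      have "\<omega> \<in> ?C" if "\<omega> \<in> phase k r" for \<omega>
        using True that by (simp add: cylinder_def det[OF that] phase_subset[THEN subsetD])
      thus ?thesis by blast
    next
      case False
      then obtain i where i: "i \<in> J" "\<eta> i \<noteq> ruler (i + r)" by blast
      have "\<omega> \<notin> ?C" if "\<omega> \<in> phase k r" for \<omega>
      proof
        assume "\<omega> \<in> ?C"
        hence "\<omega> i = \<eta> i" using i(1) by (simp add: cylinder_def)
        thus False using det[OF that i(1)] i(2) by simp
      qed
      thus ?thesis by blast
    qed
    thus ?thesis using equidistributed_all[OF assms(1), of k r] equidistributed_all[OF assms(2), of k r] by auto
  qed
  have bad: "\<bar>measure \<mu> (?C \<inter> phase k r) - measure \<nu> (?C \<inter> phase k r)\<bar> \<le> 1 / 2 ^ k" for r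
  proof -
    have "0 \<le> measure \<mu> (?C \<inter> phase k r) \<and> measure \<mu> (?C \<inter> phase k r) \<le> 1 / 2 ^ k" if "equidistributed \<mu>" for \<mu>
    proof -
      interpret prob_space \<mu> using that by (simp add: equidistributed_def)
      have "phase k r \<in> sets \<mu>" using that phase_borel by (simp add: equidistributed_def)
      hence "measure \<mu> (?C \<inter> phase k r) \<le> measure \<mu> (phase k r)" by (intro finite_measure_mono) auto
      thus ?thesis using equidistributed_all[OF that, of k r] by simp
    qed
    from this[OF assms(1)] this[OF assms(2)] show ?thesis by linarith
  qed
  \<comment> \<open>Each position of \<open>J\<close> is left undetermined by a single residue, so
    at most \<open>card J\<close> phases are bad, whatever \<open>k\<close> is.\<close>
  have "B \<subseteq> (\<lambda>i. (- i) mod 2 ^ k) ` J"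
  proof
    fix r assume "r \<in> B"
    then obtain i where i: "r \<in> ?D" "i \<in> J" "2 ^ k dvd (i + r)" by (auto simp: B_def)
    have "(- i) mod 2 ^ k = r mod 2 ^ k" using i(3) by (simp add: mod_eq_dvd_iff dvd_minus_iff[symmetric, of _ "- i - r"] add.commute)
    thus "r \<in> (\<lambda>i. (- i) mod 2 ^ k) ` J" using i(1,2) by auto
  qed
  hence cardB: "card B \<le> card J" using assms(3) by (meson card_image_le card_mono finite_imageI le_trans)
  have "measure \<mu> ?C - measure \<nu> ?C = (\<Sum>r\<in>?D. measure \<mu> (?C \<inter> phase k r) - measure \<nu> (?C \<inter> phase k r))"
    using decomp[OF assms(1)] decomp[OF assms(2)] by (simp add: sum_subtractf)
  also have "\<dots> = (\<Sum>r\<in>B. measure \<mu> (?C \<inter> phase k r) - measure \<nu> (?C \<inter> phase k r))"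
    by (rule sum.mono_neutral_right) (use good in \<open>auto simp: B_def\<close>)
  finally have "\<bar>measure \<mu> ?C - measure \<nu> ?C\<bar> \<le> (\<Sum>r\<in>B. \<bar>measure \<mu> (?C \<inter> phase k r) - measure \<nu> (?C \<inter> phase k r)\<bar>)"
    by (simp only: sum_abs)
  also have "\<dots> \<le> (\<Sum>r\<in>B. 1 / 2 ^ k)" by (rule sum_mono) (rule bad)
  also have "\<dots> \<le> real (card J) / 2 ^ k" using cardB by (simp add: divide_right_mono)
  finally show ?thesis .
qed

lemma equidistributed_unique:
  assumes "equidistributed \<mu>" "equidistributed \<nu>"
  shows "\<mu> = \<nu>"
proof (rule measure_eqI_generator_eq[OF Int_stable_cylinders])
  interpret \<mu>: prob_space \<mu> using assms(1) by (simp add: equidistributed_def)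
  interpret \<nu>: prob_space \<nu> using assms(2) by (simp add: equidistributed_def)
  show "sets \<mu> = sigma_sets Omega_tau cylinders" "sets \<nu> = sigma_sets Omega_tau cylinders"
    using assms by (simp_all add: equidistributed_def sets_Omega_borel_cylinders del: sets_measure_of)
  show "cylinders \<subseteq> Pow Omega_tau" by (auto simp: cylinders_def cylinder_def)
  have "cylinder {} (\<lambda>_. La) = Omega_tau" by (simp add: cylinder_def)
  moreover have "cylinder {} (\<lambda>_. La) \<in> cylinders" by (auto simp: cylinders_def)
  ultimately show "range (\<lambda>_ :: nat. Omega_tau) \<subseteq> cylinders" by auto
  show "emeasure \<mu> Omega_tau \<noteq> \<infinity>" using \<mu>.emeasure_finite[of Omega_tau] by simp
  show "emeasure \<mu> C = emeasure \<nu> C" if "C \<in> cylinders" for C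
  proof (cases "C = {}")
    case False
    then obtain J \<eta> where J: "finite J" "C = cylinder J \<eta>" using \<open>C \<in> cylinders\<close> by (auto simp: cylinders_def)
    let ?d = "\<bar>measure \<mu> C - measure \<nu> C\<bar>"
    have "?d = 0"
    proof (rule ccontr)
      assume "?d \<noteq> 0"
      hence pos: "?d > 0" by simp
      obtain k where "real (card J) / ?d < 2 ^ k" using real_arch_pow[of 2] by auto
      hence "real (card J) / 2 ^ k < ?d" using pos by (simp add: field_simps)
      thus False using measure_cylinder_diff[OF assms J(1), of \<eta> k] J(2) by simp
    qed
    thus ?thesis by (simp add: \<mu>.emeasure_eq_measure \<nu>.emeasure_eq_measure)
  qed simp
qed auto

lemma translate_measurable: "translate c \<in> measurable Omega_borel Omega_borel"
  using translate_homeo_group[of c]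
  by (intro measurable_Omega_continuous homeomorphic_imp_continuous_map) (simp add: mem_homeo_group)

text \<open>Translation permutes the phases of each level, so the image measure is equidistributed
  too, and uniqueness identifies it with \<open>\<mu>\<close>.\<close>

lemma equidistributed_invariant:
  assumes "equidistributed \<mu>" "S \<in> sets Omega_borel"
  shows "emeasure \<mu> (translate c -` S \<inter> Omega_tau) = emeasure \<mu> S"
proof -
  interpret prob_space \<mu> using assms(1) by (simp add: equidistributed_def)
  have sets: "sets \<mu> = sets Omega_borel" using assms(1) by (simp add: equidistributed_def)
  hence space: "space \<mu> = Omega_tau" using sets_eq_imp_space_eq[OF sets] by simp
  have m: "translate c \<in> measurable \<mu> Omega_borel"
    using translate_measurable[of c] sets by (simp add: measurable_cong_sets[OF sets refl])
  have "equidistributed (distr \<mu> Omega_borel (translate c))"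
    unfolding equidistributed_def
  proof (intro conjI allI ballI)
    fix k r
    show "measure (distr \<mu> Omega_borel (translate c)) (phase k r) = 1 / 2 ^ k"
      using measure_distr[OF m phase_borel, of k r] equidistributed_all[OF assms(1), of k "r - c"]
      by (simp add: space vimage_translate_phase)
  qed (simp_all add: prob_space_distr[OF m])
  hence "distr \<mu> Omega_borel (translate c) = \<mu>" using assms(1) by (rule equidistributed_unique)
  thus ?thesis using emeasure_distr[OF m assms(2)] by (simp add: space)
qed

text \<open>The preimage of a phase under the shift is the phase of the preceding residue; the
  \<open>2^k\<close> phases of a level partition the space and so share the mass equally.\<close>

lemma equidistributed_iff_shift_invariant:
  "invariant_prob Omega_top {shift_Omega} \<mu> \<longleftrightarrow> equidistributed \<mu>"
proof
  assume "equidistributed \<mu>"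
  thus "invariant_prob Omega_top {shift_Omega} \<mu>"
    using equidistributed_invariant[of \<mu> _ 1]
    unfolding invariant_prob_iff shift_Omega_eq equidistributed_def by blast
next
  assume inv: "invariant_prob Omega_top {shift_Omega} \<mu>"
  hence sets: "sets \<mu> = sets Omega_borel" and "prob_space \<mu>"
    and inv1: "\<And>S. S \<in> sets Omega_borel \<Longrightarrow> emeasure \<mu> (translate 1 -` S \<inter> Omega_tau) = emeasure \<mu> S"
    by (auto simp: invariant_prob_iff shift_Omega_eq)
  interpret prob_space \<mu> by fact
  have space: "space \<mu> = Omega_tau" using sets_eq_imp_space_eq[OF sets] by simp
  have step: "measure \<mu> (phase k (r - 1)) = measure \<mu> (phase k r)" for k r
    using inv1[OF phase_borel[of k r]] by (simp add: vimage_translate_phase measure_def)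
  have const: "measure \<mu> (phase k (int n)) = measure \<mu> (phase k 0)" for k n
  proof (induction n)
    case (Suc n)
    thus ?case using step[of k "int (Suc n)"] by simp
  qed simp
  have "measure \<mu> (phase k r) = 1 / 2 ^ k" if "r \<in> {0..<2 ^ k}" for k r
  proof -
    have eq: "measure \<mu> (phase k r') = measure \<mu> (phase k r)" if "r' \<in> {0..<2 ^ k}" for r'
      using const[of k "nat r'"] const[of k "nat r"] that \<open>r \<in> {0..<2 ^ k}\<close> by simp
    have "1 = measure \<mu> (\<Union>r\<in>{0..<2 ^ k}. phase k r)" using prob_space by (simp add: Union_phases space)
    also have "\<dots> = (\<Sum>r'\<in>{0..<2 ^ k}. measure \<mu> (phase k r'))"
      using phase_borel by (intro finite_measure_finite_Union disjoint_phases) (auto simp: sets)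
    also have "\<dots> = (\<Sum>r'\<in>{0..<2 ^ k :: int}. measure \<mu> (phase k r))" by (rule sum.cong[OF refl eq])
    also have "\<dots> = 2 ^ k * measure \<mu> (phase k r)" by simp
    finally show ?thesis by (simp add: field_simps)
  qed
  thus "equidistributed \<mu>" using sets \<open>prob_space \<mu>\<close> by (simp add: equidistributed_def)
qed


section \<open>Unique ergodicity\<close>

lemma shift_Omega_homeo_group: "shift_Omega \<in> carrier (homeo_group Omega_top)"
  unfolding shift_Omega_eq by (rule translate_homeo_group)

text \<open>As \<open>f\<close> is bijective, the images of the pieces again partition the space. It
  is used in both directions: generators are piecewise translations, and the shift is piecewise a
  generator.\<close>

lemma piecewise_invariant:
  assumes "sets \<mu> = sets Omega_borel" "finite I"
    and f: "f \<in> carrier (homeo_group Omega_top)"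
    and g: "\<And>i. i \<in> I \<Longrightarrow> g i \<in> carrier (homeo_group Omega_top)"
    and inv: "\<And>i S. i \<in> I \<Longrightarrow> S \<in> sets Omega_borel \<Longrightarrow> emeasure \<mu> (g i -` S \<inter> Omega_tau) = emeasure \<mu> S"
    and P: "\<And>i. i \<in> I \<Longrightarrow> openin Omega_top (P i)" "disjoint_family_on P I" "(\<Union>i\<in>I. P i) = Omega_tau"
    and fg: "\<And>i \<omega>. i \<in> I \<Longrightarrow> \<omega> \<in> P i \<Longrightarrow> f \<omega> = g i \<omega>"
    and S: "S \<in> sets Omega_borel"
  shows "emeasure \<mu> (f -` S \<inter> Omega_tau) = emeasure \<mu> S"
proof -
  have homeo: "homeomorphic_map Omega_top Omega_top h" "bij_betw h Omega_tau Omega_tau"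
    if "h \<in> carrier (homeo_group Omega_top)" for h
    using that by (auto simp: mem_homeo_group Bij_def)
  have sub: "P i \<subseteq> Omega_tau" if "i \<in> I" for i using P(3) that by blast
  have img: "f ` P i \<in> sets Omega_borel" if "i \<in> I" for i
    using homeo(1)[OF f] P(1)[OF that]
    by (intro open_Omega_borel) (metis homeomorphic_map_openness_eq)
  \<comment> \<open>Cutting \<open>S\<close> down to \<open>f\<close> P
    i\<open>, which equals\<close>g i \<open>P i\<close>, forces the preimage under the injective
    \<open>g i\<close> into \<open>P i\<close>, where it agrees with \<open>f\<close>.\<close>
  have pre: "f -` S \<inter> P i = g i -` (S \<inter> f ` P i) \<inter> Omega_tau" if i: "i \<in> I" for i
  proof -
    have "inj_on (g i) Omega_tau" using homeo(2)[OF g[OF i]] by (simp add: bij_betw_def)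
    moreover have "f ` P i = g i ` P i" using fg[OF i] by (rule image_cong[OF refl])
    ultimately show ?thesis using sub[OF i] fg[OF i] by (auto dest: inj_onD)
  qed
  have S': "S \<inter> f ` P i \<in> sets Omega_borel" if "i \<in> I" for i using img[OF that] S by (rule sets.Int[rotated])
  have meas: "f -` S \<inter> P i \<in> sets \<mu>" if i: "i \<in> I" for i
    unfolding pre[OF i] assms(1)
    using measurable_sets[OF measurable_Omega_continuous[OF homeomorphic_imp_continuous_map[OF homeo(1)[OF g[OF i]]]] S'[OF i]]
    by simp
  have "emeasure \<mu> (f -` S \<inter> Omega_tau) = emeasure \<mu> (\<Union>i\<in>I. f -` S \<inter> P i)"
    by (rule arg_cong[where f = "emeasure \<mu>"]) (use P(3) in blast)
  also have "\<dots> = (\<Sum>i\<in>I. emeasure \<mu> (f -` S \<inter> P i))"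
    by (rule sum_emeasure[symmetric]) (use meas P(2) assms(2) in \<open>auto simp: disjoint_family_on_def\<close>)
  also have "\<dots> = (\<Sum>i\<in>I. emeasure \<mu> (S \<inter> f ` P i))"
  proof (rule sum.cong[OF refl])
    fix i assume i: "i \<in> I"
    show "emeasure \<mu> (f -` S \<inter> P i) = emeasure \<mu> (S \<inter> f ` P i)"
      unfolding pre[OF i] by (rule inv[OF i S'[OF i]])
  qed
  also have "\<dots> = emeasure \<mu> (\<Union>i\<in>I. S \<inter> f ` P i)"
  proof (rule sum_emeasure)
    show "disjoint_family_on (\<lambda>i. S \<inter> f ` P i) I"
      unfolding disjoint_family_on_def
    proof (intro ballI impI)
      fix i j assume ij: "i \<in> I" "j \<in> I" "i \<noteq> j"
      have "f ` P i \<inter> f ` P j = f ` (P i \<inter> P j)"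
        using homeo(2)[OF f] sub ij by (intro inj_on_image_Int[symmetric]) (auto simp: bij_betw_def)
      thus "(S \<inter> f ` P i) \<inter> (S \<inter> f ` P j) = {}" using P(2) ij unfolding disjoint_family_on_def by blast
    qed
  qed (use S' assms(1,2) in auto)
  also have "(\<Union>i\<in>I. S \<inter> f ` P i) = S \<inter> f ` Omega_tau" using P(3) by blast
  also have "\<dots> = S" using homeo(2)[OF f] sets.sets_into_space[OF S] by (auto simp: bij_betw_def)
  finally show ?thesis .
qed

lemma openin_letter: "openin Omega_top {\<omega> \<in> Omega_tau. \<omega> i \<in> L}"
  unfolding openin_Omega_iff
proof (intro conjI ballI)
  fix \<omega> assume w: "\<omega> \<in> {\<omega> \<in> Omega_tau. \<omega> i \<in> L}"
  have "\<omega>' i = \<omega> i" if "agree (nat \<bar>i\<bar>) \<omega> \<omega>'" for \<omega>' using agreeD[OF that, of i] by simp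
  thus "\<exists>N. \<forall>\<omega>'\<in>Omega_tau. agree N \<omega> \<omega>' \<longrightarrow> \<omega>' \<in> {\<omega> \<in> Omega_tau. \<omega> i \<in> L}"
    using w by (intro exI[of _ "nat \<bar>i\<bar>"]) auto
qed blast

text \<open>A generator is translation by 1, -1 or 0 on three open pieces. The first two are
  disjoint because exactly one of the letters at 0 and 1 is \<open>La\<close>.\<close>

lemma H_gen_invariant:
  assumes "equidistributed \<mu>" "S \<in> sets Omega_borel"
  shows "emeasure \<mu> (H_gen s -` S \<inter> Omega_tau) = emeasure \<mu> S"
proof -
  let ?P = "\<lambda>i :: int. if i = 1 then {\<omega> \<in> Omega_tau. \<omega> 1 \<in> edge_letters s}
    else if i = - 1 then {\<omega> \<in> Omega_tau. \<omega> 0 \<in> edge_letters s}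
    else {\<omega> \<in> Omega_tau. \<omega> 0 \<in> - edge_letters s} \<inter> {\<omega> \<in> Omega_tau. \<omega> 1 \<in> - edge_letters s}"
  have not_both: "\<not> (\<omega> 0 \<in> edge_letters s \<and> \<omega> 1 \<in> edge_letters s)" if "\<omega> \<in> Omega_tau" for \<omega>
    using edge_letters_not_both[of "\<omega> 0" s "\<omega> 1"] Omega_alternating[OF that, of 0] by auto
  show ?thesis
  proof (rule piecewise_invariant[where I = "{- 1, 0, 1 :: int}" and g = translate and P = ?P])
    show "openin Omega_top (?P i)" for i by (auto simp del: Compl_iff intro: openin_letter openin_Int)
    show "disjoint_family_on ?P {- 1, 0, 1}"
      using not_both by (auto simp: disjoint_family_on_def)
    show "(\<Union>i\<in>{- 1, 0, 1}. ?P i) = Omega_tau" by auto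
    show "H_gen s \<omega> = translate i \<omega>" if "i \<in> {- 1, 0, 1}" "\<omega> \<in> ?P i" for i \<omega>
      using that not_both[of \<omega>]
      by (auto simp: H_gen_def flip_along_def translate_def shift_def shift_inv_def)
  qed (use assms in \<open>simp_all add: equidistributed_def H_gen_homeo_group translate_homeo_group
      equidistributed_invariant\<close>)
qed

lemma foldr_H_gen_invariant:
  assumes "equidistributed \<mu>" "S \<in> sets Omega_borel"
  shows "emeasure \<mu> (restrict (foldr H_gen w) Omega_tau -` S \<inter> Omega_tau) = emeasure \<mu> S"
  using assms(2)
proof (induction w arbitrary: S)
  case Nil
  have "restrict (foldr H_gen []) Omega_tau -` S \<inter> Omega_tau = S"
    using sets.sets_into_space[OF Nil] by auto
  thus ?case by (simp only:)
next
  case (Cons s w)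
  have "H_gen s \<in> measurable Omega_borel Omega_borel"
    by (intro measurable_Omega_continuous homeomorphic_imp_continuous_map homeomorphic_H_gen)
  hence S': "H_gen s -` S \<inter> Omega_tau \<in> sets Omega_borel"
    using measurable_sets[OF _ Cons.prems, of "H_gen s" Omega_borel] by simp
  have eq: "restrict (foldr H_gen (s # w)) Omega_tau -` S \<inter> Omega_tau =
      restrict (foldr H_gen w) Omega_tau -` (H_gen s -` S \<inter> Omega_tau) \<inter> Omega_tau"
    using foldr_H_gen_Omega by auto
  show ?case unfolding eq Cons.IH[OF S'] by (rule H_gen_invariant[OF assms(1) Cons.prems])
qed

lemma equidistributed_if_G_invariant:
  assumes "invariant_prob Omega_top (rho ` carrier G_group) \<mu>"
  shows "equidistributed \<mu>"
proof -
  have sets: "sets \<mu> = sets Omega_borel" and "prob_space \<mu>"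
    and inv: "\<And>g S. g \<in> carrier G_group \<Longrightarrow> S \<in> sets Omega_borel \<Longrightarrow> emeasure \<mu> (rho g -` S \<inter> Omega_tau) = emeasure \<mu> S"
    using assms by (auto simp: invariant_prob_iff)
  have gen: "emeasure \<mu> (H_gen s -` S \<inter> Omega_tau) = emeasure \<mu> S" if "S \<in> sets Omega_borel" for s S
  proof -
    have "G_gen s = foldr G_gen [s]" by (simp add: fun_eq_iff)
    hence "G_gen s \<in> carrier G_group" unfolding carrier_G_group by blast
    from inv[OF this that] show ?thesis by (simp add: rho_G_gen)
  qed
  \<comment> \<open>Each \<open>?L s\<close> lies inside \<open>edge_letters s\<close>, so
    \<open>H_gen s\<close> shifts forward there; \<open>Lx\<close> is assigned to b alone in order
    that the pieces be disjoint.\<close>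
  let ?L = "\<lambda>s. if s = Ga then {La} else if s = Gb then {Lx, Ly} else {Lz}"
  have "emeasure \<mu> (shift_Omega -` S \<inter> Omega_tau) = emeasure \<mu> S" if "S \<in> sets Omega_borel" for S
  proof (rule piecewise_invariant[where I = "{Ga, Gb, Gc}" and g = H_gen and P = "\<lambda>s. {\<omega> \<in> Omega_tau. \<omega> 1 \<in> ?L s}"])
    show "openin Omega_top {\<omega> \<in> Omega_tau. \<omega> 1 \<in> ?L s}" for s by (rule openin_letter)
    show "disjoint_family_on (\<lambda>s. {\<omega> \<in> Omega_tau. \<omega> 1 \<in> ?L s}) {Ga, Gb, Gc}"
      by (auto simp: disjoint_family_on_def)
    have "\<exists>s\<in>{Ga, Gb, Gc}. l \<in> ?L s" for l by (cases l) auto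
    thus "(\<Union>s\<in>{Ga, Gb, Gc}. {\<omega> \<in> Omega_tau. \<omega> 1 \<in> ?L s}) = Omega_tau" by blast
    show "shift_Omega \<omega> = H_gen s \<omega>" if "s \<in> {Ga, Gb, Gc}" "\<omega> \<in> {\<omega> \<in> Omega_tau. \<omega> 1 \<in> ?L s}" for s \<omega>
      using that by (auto simp: shift_Omega_def H_gen_def flip_along_def)
  qed (use sets that in \<open>simp_all add: H_gen_homeo_group shift_Omega_homeo_group gen\<close>)
  hence "invariant_prob Omega_top {shift_Omega} \<mu>"
    using sets \<open>prob_space \<mu>\<close> by (simp add: invariant_prob_iff)
  thus ?thesis by (simp only: equidistributed_iff_shift_invariant)
qed

lemma equidistributed_iff_G_invariant:
  "invariant_prob Omega_top (rho ` carrier G_group) \<mu> \<longleftrightarrow> equidistributed \<mu>"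
proof
  assume eq: "equidistributed \<mu>"
  have "emeasure \<mu> (rho g -` S \<inter> Omega_tau) = emeasure \<mu> S"
    if "g \<in> carrier G_group" "S \<in> sets Omega_borel" for g S
  proof -
    obtain w where "g = foldr G_gen w" using \<open>g \<in> carrier G_group\<close> unfolding carrier_G_group by blast
    thus ?thesis using foldr_H_gen_invariant[OF eq that(2), of w] by (simp only: rho_foldr)
  qed
  thus "invariant_prob Omega_top (rho ` carrier G_group) \<mu>"
    using eq by (auto simp: invariant_prob_iff equidistributed_def)
qed (rule equidistributed_if_G_invariant)

section \<open>Construction of the measure by coin tossing\<close>

abbreviation coins :: "(nat \<Rightarrow> bool) measure" where
  "coins \<equiv> PiM UNIV (\<lambda>_ :: nat. measure_pmf (bernoulli_pmf (1 / 2)))"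

text \<open>\<open>address k b\<close> is the residue modulo \<open>2\<^sup>k\<close> of the 2-adic integer with digits \<open>b\<close>.\<close>

definition address :: "nat \<Rightarrow> (nat \<Rightarrow> bool) \<Rightarrow> int" where
  "address k b = horner_sum of_bool 2 (map b [0..<k])"

lemma bit_address: "bit (address k b) i \<longleftrightarrow> i < k \<and> b i"
  by (auto simp: address_def bit_horner_sum_bit_iff)

lemma address_eq_iff:
  assumes "r \<in> {0..<2 ^ k}"
  shows "address k b = r \<longleftrightarrow> (\<forall>i\<in>{..<k}. b i = bit r i)"
proof -
  have "take_bit k r = r" using assms by (simp add: take_bit_eq_mod)
  hence lt: "i < k" if "bit r i" for i using that by (metis bit_take_bit_iff)
  show ?thesis unfolding bit_eq_iff by (auto simp: bit_address dest: lt)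
qed

lemma address_mod: "k \<le> k' \<Longrightarrow> address k' b mod 2 ^ k = address k b"
  unfolding take_bit_eq_mod[symmetric] by (rule bit_eqI) (auto simp: bit_take_bit_iff bit_address)

lemma address_range: "address k b \<in> {0..<2 ^ k}"
proof -
  have "address k b = address k b mod 2 ^ k" by (simp add: address_mod)
  thus ?thesis by (metis atLeastLessThan_iff pos_mod_bound pos_mod_sign zero_less_numeral zero_less_power)
qed

lemma address_cong: "k \<le> k' \<Longrightarrow> 2 ^ k dvd (address k' b - address k b)"
  using address_mod[of k k' b] by (metis dvd_minus_mod)

text \<open>The phases leave at most one position undetermined; any letter but \<^const>\<open>La\<close> may fill it.\<close>

definition toeplitz :: "(nat \<Rightarrow> bool) \<Rightarrow> int \<Rightarrow> letter" where
  "toeplitz b n = (if \<exists>k. \<not> 2 ^ k dvd (n + address k b)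
     then ruler (n + address (LEAST k. \<not> 2 ^ k dvd (n + address k b)) b) else Lx)"

text \<open>Further digits change the address by multiples of \<open>2^k\<close> only; so any
  \<open>k\<close> that determines the letter gives the same one as the least.\<close>

lemma toeplitz_eq:
  assumes "\<not> 2 ^ k dvd (n + address k b)"
  shows "toeplitz b n = ruler (n + address k b)"
proof -
  define l where "l = (LEAST k. \<not> 2 ^ k dvd (n + address k b))"
  have l: "\<not> 2 ^ l dvd (n + address l b)" unfolding l_def using assms by (rule LeastI)
  have "l \<le> k" unfolding l_def using assms by (rule Least_le)
  hence d: "2 ^ l dvd (address k b - address l b)" by (rule address_cong)
  have "2 ^ l dvd (n + address l b - (n + address k b))"
    using d by (simp add: dvd_diff_commute)
  from ruler_cong[OF l this] show ?thesis using assms by (auto simp: toeplitz_def l_def)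
qed

text \<open>A window may contain the position that no digits determine (\<open>?hole\<close>). If
  so, a power of 2 of letter \<open>Lx\<close> is placed there; if not, finitely many digits fix the
  whole window.\<close>

lemma toeplitz_Omega: "toeplitz b \<in> Omega_tau"
  unfolding Omega_tau_iff
proof
  fix N :: nat
  let ?hole = "\<lambda>j. \<forall>k. 2 ^ k dvd (j + address k b)"
  have small: "int N < 2 ^ k" if "N \<le> k" for k
  proof -
    have "int k < 2 ^ k" by (rule int_less_two_pow)
    moreover have "int N \<le> int k" using that by simp
    ultimately show ?thesis by linarith
  qed
  show "\<exists>q>int N. agree N (toeplitz b) (\<lambda>i. ruler (q + i))"
  proof (cases "\<exists>j. \<bar>j\<bar> \<le> int N \<and> ?hole j")
    case True
    then obtain j where j: "\<bar>j\<bar> \<le> int N" "?hole j" by blast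
    \<comment> \<open>A level carrying \<open>Lx\<close>, with \<open>2^k\<close> exceeding the
      distance between any two positions of the window.\<close>
    define k where "k = Suc (3 * (2 * N + 1))"
    have k: "2 * int N + 1 < 2 ^ k"
    proof -
      have "int k < 2 ^ k" by (rule int_less_two_pow)
      thus ?thesis by (simp add: k_def)
    qed
    have "toeplitz b i = ruler (2 ^ k - j + i)" if i: "\<bar>i\<bar> \<le> int N" for i
    proof (cases "i = j")
      case True
      hence "toeplitz b i = Lx" using j(2) by (simp add: toeplitz_def)
      thus ?thesis using True ruler_pow[of k] lev_3[of "2 * N + 1"] by (simp add: k_def del: ruler_pow)
    next
      case False
      have ij: "\<bar>i - j\<bar> < 2 ^ k" "i - j \<noteq> 0" using i j(1) k False by auto
      hence nd: "\<not> 2 ^ k dvd (i - j)" by (intro two_pow_not_dvd_small)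
      have d: "2 ^ k dvd (j + address k b)" using j(2) by blast
      have "\<not> 2 ^ k dvd (i + address k b)"
      proof
        assume "2 ^ k dvd (i + address k b)"
        from dvd_diff[OF this d] nd show False by simp
      qed
      hence t: "toeplitz b i = ruler (i + address k b)" by (rule toeplitz_eq)
      have "i - j - (i + address k b) = - (j + address k b)" by simp
      hence "2 ^ k dvd (i - j - (i + address k b))" by (simp only: dvd_minus_iff d)
      hence "toeplitz b i = ruler (i - j)" unfolding t by (rule ruler_cong[symmetric, OF nd])
      also have "\<dots> = ruler (2 ^ k + (i - j))" by (rule ruler_add_pow[symmetric, OF ij(2,1)]) simp
      finally show ?thesis by (simp add: algebra_simps)
    qed
    thus ?thesis using k j(1) by (intro exI[of _ "2 ^ k - j"]) (auto simp: agree_def)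
  next
    case False
    hence "\<forall>i\<in>{- int N..int N}. \<exists>k. \<not> 2 ^ k dvd (i + address k b)" by (auto simp: abs_le_iff)
    then obtain K where K: "\<And>i. i \<in> {- int N..int N} \<Longrightarrow> \<not> 2 ^ K i dvd (i + address (K i) b)" by metis
    \<comment> \<open>Including \<open>N\<close> ensures that adding \<open>2^k\<close> carries the
      window to positive positions.\<close>
    define k where "k = Max (insert N (K ` {- int N..int N}))"
    have "N \<le> k" unfolding k_def by (intro Max_ge) auto
    have "toeplitz b i = ruler (2 ^ k + address k b + i)" if i: "\<bar>i\<bar> \<le> int N" for i
    proof -
      have iN: "i \<in> {- int N..int N}" using i by auto
      have Kk: "K i \<le> k" unfolding k_def using iN by (intro Max_ge) auto
      have "\<not> 2 ^ k dvd (i + address k b)"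
      proof
        assume "2 ^ k dvd (i + address k b)"
        hence "2 ^ K i dvd (i + address k b)" using Kk by (rule power_le_dvd)
        from dvd_diff[OF this address_cong[OF Kk, of b]] K[OF iN] show False by simp
      qed
      thus ?thesis using toeplitz_eq[of k i b] ruler_cong[of k "i + address k b" "2 ^ k + address k b + i"] by simp
    qed
    moreover have "2 ^ k + address k b > int N" using small[OF \<open>N \<le> k\<close>] address_range[of k b]
      unfolding atLeastLessThan_iff by linarith
    ultimately show ?thesis by (intro exI[of _ "2 ^ k + address k b"]) (auto simp: agree_def)
  qed
qed

lemma toeplitz_phase: "toeplitz b \<in> phase k (address k b)"
  by (simp add: phase_def toeplitz_Omega toeplitz_eq)

lemma address_eq_Collect:
  assumes "r \<in> {0..<2 ^ k}"
  shows "{b \<in> space coins. address k b = r} = {b \<in> space coins. \<forall>i\<in>{..<k}. b i \<in> {bit r i}}"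
  using address_eq_iff[OF assms] by auto

lemma address_measurable: "{b \<in> space coins. Q (address k b)} \<in> sets coins"
proof -
  have "{b \<in> space coins. Q (address k b)} =
      (\<Union>r\<in>{r \<in> {0..<2 ^ k}. Q r}. {b \<in> space coins. address k b = r})"
  proof (rule Set.set_eqI)
    fix b
    show "b \<in> {b \<in> space coins. Q (address k b)} \<longleftrightarrow>
        b \<in> (\<Union>r\<in>{r \<in> {0..<2 ^ k}. Q r}. {b \<in> space coins. address k b = r})"
      using address_range[of k b] by auto
  qed
  also have "\<dots> \<in> sets coins"
  proof (rule sets.finite_UN)
    show "finite {r \<in> {0..<2 ^ k :: int}. Q r}" by (rule finite_subset[of _ "{0..<2 ^ k}"]) auto
    fix r assume "r \<in> {r \<in> {0..<2 ^ k}. Q r}"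
    hence r: "r \<in> {0..<2 ^ k}" by simp
    show "{b \<in> space coins. address k b = r} \<in> sets coins"
      unfolding address_eq_Collect[OF r]
      by (intro sets.sets_Collect_finite_All sets_Collect_single') auto
  qed
  finally show ?thesis .
qed

lemma address_prob:
  assumes "r \<in> {0..<2 ^ k}"
  shows "emeasure coins {b \<in> space coins. address k b = r} = ennreal (1 / 2 ^ k)"
proof -
  interpret product_prob_space "\<lambda>_ :: nat. measure_pmf (bernoulli_pmf (1 / 2))" UNIV
    by unfold_locales
  have "emeasure coins {b \<in> space coins. address k b = r} =
      (\<Prod>i\<in>{..<k}. emeasure (measure_pmf (bernoulli_pmf (1 / 2))) {bit r i})"
    unfolding address_eq_Collect[OF assms] by (rule emeasure_PiM_Collect) auto
  also have "\<dots> = (\<Prod>i\<in>{..<k}. ennreal (1 / 2))"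
    by (rule prod.cong[OF refl]) (simp add: emeasure_pmf_single)
  also have "\<dots> = ennreal (\<Prod>i\<in>{..<k}. 1 / 2)" by (rule prod_ennreal) simp
  also have "(\<Prod>i\<in>{..<k}. 1 / 2) = (1 / 2 ^ k :: real)" by (simp add: power_one_over)
  finally show ?thesis .
qed

lemma toeplitz_measurable: "toeplitz \<in> measurable coins Omega_borel"
proof (rule measurable_sigma_sets[OF sets_Omega_borel_cylinders])
  show "cylinders \<subseteq> Pow Omega_tau" by (auto simp: cylinders_def cylinder_def)
  show "toeplitz \<in> space coins \<rightarrow> Omega_tau" by (simp add: toeplitz_Omega)
  have single: "{b \<in> space coins. toeplitz b n = l} \<in> sets coins" for n l
  proof -
    \<comment> \<open>By \<open>toeplitz_eq\<close> any determining \<open>k\<close> may replace the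
      least one, which leaves a countable combination of conditions on finitely many digits
      each.\<close>
    have "{b \<in> space coins. toeplitz b n = l} =
       (\<Union>k. {b \<in> space coins. \<not> 2 ^ k dvd (n + address k b) \<and> ruler (n + address k b) = l}) \<union>
       (\<Inter>k. {b \<in> space coins. 2 ^ k dvd (n + address k b) \<and> l = Lx})" (is "_ = ?R")
    proof (rule Set.set_eqI)
      fix b
      show "b \<in> {b \<in> space coins. toeplitz b n = l} \<longleftrightarrow> b \<in> ?R"
      proof (cases "\<exists>k. \<not> 2 ^ k dvd (n + address k b)")
        case True
        then obtain k where "\<not> 2 ^ k dvd (n + address k b)" ..
        thus ?thesis using toeplitz_eq[of k n b] by (auto dest: toeplitz_eq)
      next
        case False
        thus ?thesis by (auto simp: toeplitz_def)
      qed
    qed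
    also have "\<dots> \<in> sets coins"
      by (intro sets.Un sets.countable_UN sets.countable_INT image_subsetI address_measurable)
        (auto intro: address_measurable)
    finally show ?thesis .
  qed
  fix C assume "C \<in> cylinders"
  then consider "C = {}" | J \<eta> where "finite J" "C = cylinder J \<eta>" by (auto simp: cylinders_def)
  thus "toeplitz -` C \<inter> space coins \<in> sets coins"
  proof cases
    case (2 J \<eta>)
    have "toeplitz -` C \<inter> space coins = {b \<in> space coins. \<forall>i\<in>J. toeplitz b i = \<eta> i}"
      using toeplitz_Omega by (auto simp: 2 cylinder_def)
    also have "\<dots> \<in> sets coins" using 2(1) single by (intro sets.sets_Collect_finite_All) auto
    finally show ?thesis .
  qed simp
qed

lemma equidistributed_exists: "equidistributed (distr coins Omega_borel toeplitz)"
proof -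
  interpret prob_space coins by (rule prob_space_PiM) (rule prob_space_measure_pmf)
  show ?thesis
    unfolding equidistributed_def
  proof (intro conjI allI ballI)
    fix k and r :: int assume r: "r \<in> {0..<2 ^ k}"
    have "toeplitz -` phase k r \<inter> space coins = {b \<in> space coins. address k b = r}"
    proof -
      \<comment> \<open>\<open>toeplitz b\<close> lies in the phase \<open>address k b\<close>, and
        the phases of one level are disjoint.\<close>
      have "toeplitz b \<in> phase k r \<longleftrightarrow> address k b = r" for b
      proof
        assume "toeplitz b \<in> phase k r"
        thus "address k b = r"
          using toeplitz_phase[of b k] disjoint_phases[of k] r address_range[of k b]
          unfolding disjoint_family_on_def by blast
      qed (use toeplitz_phase in blast)
      thus ?thesis by auto
    qed
    thus "measure (distr coins Omega_borel toeplitz) (phase k r) = 1 / 2 ^ k"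
      using measure_distr[OF toeplitz_measurable phase_borel, of k r] address_prob[OF r]
      by (simp add: measure_def)
  qed (simp_all add: prob_space_distr[OF toeplitz_measurable])
qed

theorem theorem3p5:
  shows "\<exists>\<rho>.
    \<comment> \<open>(a)\<close>
    \<rho> \<in> iso G_group H_group \<and>
    \<rho> (G_gen Ga) = H_gen Ga \<and> \<rho> (G_gen Gb) = H_gen Gb \<and>
    \<rho> (G_gen Gc) = H_gen Gc \<and> \<rho> (G_gen Gd) = H_gen Gd \<and>
    dyn_system G_group Omega_top \<rho> \<and>
    \<comment> \<open>(b)\<close>
    (\<exists>\<beta>. root_change_action \<beta> \<and> factor_map G_group Omega_top \<rho> X_top \<beta> Gr) \<and>
    (\<forall>p\<in>X_space. card {\<omega> \<in> Omega_tau. Gr \<omega> = p} = 2) \<and>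
    \<comment> \<open>(c)\<close>
    (\<forall>\<omega>\<in>Omega_tau.
       {(shift_Omega [^]\<^bsub>homeo_group Omega_top\<^esub> n) \<omega> |n :: int. True} = orbit G_group \<rho> \<omega>) \<and>
    \<comment> \<open>(d)\<close>
    uniquely_ergodic Omega_top (\<rho> ` carrier G_group) \<and>
    (\<exists>\<mu>. {\<nu>. invariant_prob Omega_top {shift_Omega} \<nu>} = {\<mu>} \<and>
         {\<nu>. invariant_prob Omega_top (\<rho> ` carrier G_group) \<nu>} = {\<mu>})"
proof (intro exI[of _ rho] conjI)
  show "\<exists>\<beta>. root_change_action \<beta> \<and> factor_map G_group Omega_top rho X_top \<beta> Gr"
    using root_change_beta factor_map_Gr by blast
  show "\<forall>p\<in>X_space. card {\<omega> \<in> Omega_tau. Gr \<omega> = p} = 2" by (simp add: card_Gr_fibre)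
  show "\<forall>\<omega>\<in>Omega_tau.
       {(shift_Omega [^]\<^bsub>homeo_group Omega_top\<^esub> n) \<omega> |n :: int. True} = orbit G_group rho \<omega>"
    using orbits_coincide by blast
  show "uniquely_ergodic Omega_top (rho ` carrier G_group)"
    unfolding uniquely_ergodic_def equidistributed_iff_G_invariant
    using equidistributed_exists equidistributed_unique by blast
  \<comment> \<open>Both kinds of invariance amount to being equidistributed, so one measure serves
    for both.\<close>
  show "\<exists>\<mu>. {\<nu>. invariant_prob Omega_top {shift_Omega} \<nu>} = {\<mu>} \<and>
         {\<nu>. invariant_prob Omega_top (rho ` carrier G_group) \<nu>} = {\<mu>}"
    unfolding equidistributed_iff_G_invariant equidistributed_iff_shift_invariant
    using equidistributed_exists equidistributed_unique by blast
qed (simp_all add: rho_iso rho_G_gen dyn_system_Omega)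

end
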